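(* Let $K$ be an infinite field with algebraic closure $\overline{K}$, and let $A$ be a finite-dimensional $K$-algebra (possibly with additional structure). Put $\overline{A}=A\otimes_K\overline{K}$, let $G$ be the identity connected component of the $\overline{K}$-algebraic group $\mathrm{Aut}_{\overline{K}}(\overline{A})$, and suppose that the action of $G(\overline{K})$ on the maximal subalgebras of the $\overline{K}$-algebra $\overline{A}$ has finitely many orbits. Then there exist integers $a,b\geq 0$ such that for every sufficiently large $r$, $\dim Z_r=ar+b$.
   Context: An algebra with additional structure means a $K$-multialgebra: a $K$-vector space $A$ with $K$-multilinear operations $\{\mu_i:A^{n_i}\to A\}_{i\in I}$ (e.g. a product, an involution, or a unit element encoded as an operation with $0$ arguments). A subalgebra is a subspace closed under all the operations; a maximal subalgebra is a maximal proper subalgebra; the subalgebra generated by a subset is the smallest subalgebra containing it. For $r\in\mathbb{N}$, $V_r$ is the $K$-affine space underlying $A^r$, and $Z_r$ is the closed subscheme of $V_r$ such that for every field extension $L/K$, $Z_r(L)$ is the set of $r$-tuples in $A_L^r$ (where $A_L=A\otimes_KL$) which do not generate $A_L$ as an $L$-algebra (with the extra structure). *)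

theory Defs
  imports
    "HOL-Algebra.Algebraic_Closure_Type"
    "HOL-Algebra.QuotRing"
    "HOL-Analysis.Abstract_Topology_2"
    "HOL-Library.Extended_Nat"
    "HOL-Library.Function_Algebras"
    "HOL-Library.Poly_Mapping"
begin

section \<open>Multialgebras\<close>

text \<open>The index set of the operations may be empty, and an operation may have arity 0 (a
  distinguished element such as a unit). The value of \<open>ma_op A i\<close> matters only on lists of
  length \<open>ma_arity A i\<close> over \<open>ma_space A\<close>.\<close>

record ('k, 'v, 'i) multialgebra =
  ma_space :: "'v set"
  ma_scale :: "'k \<Rightarrow> 'v \<Rightarrow> 'v"
  ma_ops :: "'i set"
  ma_arity :: "'i \<Rightarrow> nat"
  ma_op :: "'i \<Rightarrow> 'v list \<Rightarrow> 'v"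

text \<open>The vector space is a whole type and \<open>B\<close> is some finite basis of it.\<close>

definition finite_dim_multialgebra ::
    "('k::field, 'a::ab_group_add, 'i) multialgebra \<Rightarrow> 'a set \<Rightarrow> bool" where
  "finite_dim_multialgebra A B \<longleftrightarrow>
     ma_space A = UNIV \<and> finite_dimensional_vector_space (ma_scale A) B \<and>
     (\<forall>i\<in>ma_ops A. \<forall>xs j. length xs = ma_arity A i \<longrightarrow> j < ma_arity A i \<longrightarrow>
        Vector_Spaces.linear (ma_scale A) (ma_scale A) (\<lambda>x. ma_op A i (xs[j := x])))"

definition subalgebra :: "('k::comm_ring_1, 'v::ab_group_add, 'i) multialgebra \<Rightarrow> 'v set \<Rightarrow> bool" where
  "subalgebra A S \<longleftrightarrow>
     S \<subseteq> ma_space A \<and> module.subspace (ma_scale A) S \<and>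
     (\<forall>i\<in>ma_ops A. \<forall>xs. length xs = ma_arity A i \<longrightarrow> set xs \<subseteq> S \<longrightarrow> ma_op A i xs \<in> S)"

definition maximal_subalgebra ::
    "('k::comm_ring_1, 'v::ab_group_add, 'i) multialgebra \<Rightarrow> 'v set \<Rightarrow> bool" where
  "maximal_subalgebra A M \<longleftrightarrow>
     subalgebra A M \<and> M \<noteq> ma_space A \<and>
     (\<forall>S. subalgebra A S \<longrightarrow> M \<subseteq> S \<longrightarrow> S = M \<or> S = ma_space A)"

definition generates :: "('k::comm_ring_1, 'v::ab_group_add, 'i) multialgebra \<Rightarrow> 'v set \<Rightarrow> bool" where
  "generates A T \<longleftrightarrow> subalgebra A hull T = ma_space A"

section \<open>Base change\<close>

definition affine_space :: "'v set \<Rightarrow> ('v \<Rightarrow> 'l::zero) set" where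
  "affine_space V = {x. \<forall>v. v \<notin> V \<longrightarrow> x v = 0}"

text \<open>For an embedding of fields \<open>h : K \<rightarrow> L\<close>, the base change \<open>A \<otimes>\<^sub>K L\<close> in the coordinates given by
  a basis \<open>B\<close> of \<open>A\<close>: its vectors are the \<open>L\<close>-valued functions supported on \<open>B\<close>, the function
  \<open>x\<close> standing for the sum of the \<open>b \<otimes> x b\<close>. The operations are the \<open>L\<close>-multilinear extensions of
  those of \<open>A\<close>, i.e. they are given by the structure constants of \<open>A\<close> with respect to \<open>B\<close>.\<close>

definition base_change ::
    "('k::field \<Rightarrow> 'l::field) \<Rightarrow> 'a set \<Rightarrow> ('k, 'a::ab_group_add, 'i) multialgebra \<Rightarrow>
     ('l, 'a \<Rightarrow> 'l, 'i) multialgebra" where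
  "base_change h B A =
     \<lparr>ma_space = affine_space B,
      ma_scale = (\<lambda>c x b. c * x b),
      ma_ops = ma_ops A,
      ma_arity = ma_arity A,
      ma_op = (\<lambda>i xs b. \<Sum>ys | length ys = ma_arity A i \<and> set ys \<subseteq> B.
         (\<Prod>j<ma_arity A i. (xs ! j) (ys ! j)) *
         h (module.representation (ma_scale A) B (ma_op A i ys) b))\<rparr>"

abbreviation geometric_algebra ::
    "'a set \<Rightarrow> ('k::field, 'a::ab_group_add, 'i) multialgebra \<Rightarrow>
     ('k alg_closure, 'a \<Rightarrow> 'k alg_closure, 'i) multialgebra" where
  "geometric_algebra \<equiv> base_change to_ac"

section \<open>Polynomials and the Zariski topology\<close>

text \<open>Polynomials with variables in \<open>'v\<close> are the finitely supported functions from monomials to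
  coefficients, a monomial being a finitely supported exponent function.\<close>

definition mpoly_ring :: "'v set \<Rightarrow> (('v \<Rightarrow>\<^sub>0 nat) \<Rightarrow>\<^sub>0 'k::comm_ring_1) ring" where
  "mpoly_ring V =
     \<lparr>carrier = {f. \<forall>m\<in>Poly_Mapping.keys f. Poly_Mapping.keys m \<subseteq> V},
      monoid.mult = (*), one = 1, ring.zero = 0, add = (+)\<rparr>"

text \<open>Evaluation at \<open>x\<close>, with \<open>h\<close> applied to the coefficients.\<close>

definition mpoly_eval ::
    "('k::zero \<Rightarrow> 'l::comm_semiring_1) \<Rightarrow> ('v \<Rightarrow> 'l) \<Rightarrow> (('v \<Rightarrow>\<^sub>0 nat) \<Rightarrow>\<^sub>0 'k) \<Rightarrow> 'l" where
  "mpoly_eval h x f =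
     (\<Sum>m\<in>Poly_Mapping.keys f. h (Poly_Mapping.lookup f m) *
        (\<Prod>v\<in>Poly_Mapping.keys m. x v ^ Poly_Mapping.lookup m v))"

definition zariski :: "'v set \<Rightarrow> ('v \<Rightarrow> 'l::field) topology" where
  "zariski V = topology_generated_by
     ((\<lambda>f. {x \<in> affine_space V. mpoly_eval id x f \<noteq> 0}) ` carrier (mpoly_ring V))"

section \<open>Automorphisms\<close>

text \<open>A square matrix with rows and columns indexed by \<open>B\<close> is a point of
  \<open>affine_space (B \<times> B)\<close>, and acts on \<open>affine_space B\<close> by the usual matrix-vector product.\<close>

definition mat_act :: "'a set \<Rightarrow> ('a \<times> 'a \<Rightarrow> 'l::field) \<Rightarrow> ('a \<Rightarrow> 'l) \<Rightarrow> ('a \<Rightarrow> 'l)" where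
  "mat_act B g x = (\<lambda>b. \<Sum>c\<in>B. g (b, c) * x c)"

definition id_mat :: "'a set \<Rightarrow> 'a \<times> 'a \<Rightarrow> 'l::field" where
  "id_mat B = (\<lambda>(b, c). if b \<in> B \<and> b = c then 1 else 0)"

text \<open>The linear automorphisms compatible with all operations, for an algebra with underlying
  space \<open>affine_space B\<close>.\<close>

definition automorphisms :: "'a set \<Rightarrow> ('l::field, 'a \<Rightarrow> 'l, 'i) multialgebra \<Rightarrow> ('a \<times> 'a \<Rightarrow> 'l) set" where
  "automorphisms B A =
     {g \<in> affine_space (B \<times> B).
        bij_betw (mat_act B g) (ma_space A) (ma_space A) \<and>
        (\<forall>i\<in>ma_ops A. \<forall>xs. length xs = ma_arity A i \<longrightarrow> set xs \<subseteq> ma_space A \<longrightarrow>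
           mat_act B g (ma_op A i xs) = ma_op A i (map (mat_act B g) xs))}"

text \<open>Over an algebraically closed field these are the rational points of the identity component
  of the automorphism group scheme: the component is a matter of the underlying space, so that a
  possibly non-reduced structure of the group scheme plays no role here.\<close>

definition identity_component ::
    "'a set \<Rightarrow> ('l::field, 'a \<Rightarrow> 'l, 'i) multialgebra \<Rightarrow> ('a \<times> 'a \<Rightarrow> 'l) set" where
  "identity_component B A =
     connected_component_of_set (subtopology (zariski (B \<times> B)) (automorphisms B A)) (id_mat B)"

definition maximal_subalgebra_orbits ::
    "'a set \<Rightarrow> ('l::field, 'a \<Rightarrow> 'l, 'i) multialgebra \<Rightarrow> ('a \<Rightarrow> 'l) set set set" where
  "maximal_subalgebra_orbits B A =
     (\<lambda>M. (\<lambda>g. mat_act B g ` M) ` identity_component B A) ` {M. maximal_subalgebra A M}"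

section \<open>The scheme of non-generating tuples\<close>

text \<open>Supremum of the lengths of chains of prime ideals. As a supremum in \<^typ>\<open>enat\<close>, it is
  \<open>0\<close> for the zero ring: here the dimension of the empty scheme is \<open>0\<close>.\<close>

definition krull_dim :: "('r, 'm) ring_scheme \<Rightarrow> enat" where
  "krull_dim R =
     Sup {enat n | n. \<exists>P. (\<forall>i\<le>n. primeideal (P i) R) \<and> (\<forall>i<n. P i \<subset> P (Suc i))}"

text \<open>The coordinate ring of the affine space \<open>V\<^sub>r\<close> underlying \<open>A\<^sup>r\<close>; the variable \<open>(j, b)\<close> is the
  \<open>b\<close>-coordinate of the \<open>j\<close>-th entry of the tuple.\<close>

abbreviation tuple_ring :: "'a set \<Rightarrow> nat \<Rightarrow> ((nat \<times> 'a \<Rightarrow>\<^sub>0 nat) \<Rightarrow>\<^sub>0 'k::comm_ring_1) ring" where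
  "tuple_ring B r \<equiv> mpoly_ring ({..<r} \<times> B)"

text \<open>The closed subscheme of \<open>V\<^sub>r\<close> with ideal \<open>I\<close> has, as its \<open>L\<close>-points, exactly the \<open>r\<close>-tuples
  that do not generate \<open>A\<^sub>L\<close>, where \<open>L\<close> is a field extension of \<open>K\<close> via \<open>h\<close>.\<close>

definition cuts_out_nongenerators ::
    "('k::field \<Rightarrow> 'l::field) \<Rightarrow> 'a set \<Rightarrow> ('k, 'a::ab_group_add, 'i) multialgebra \<Rightarrow> nat \<Rightarrow>
     ((nat \<times> 'a \<Rightarrow>\<^sub>0 nat) \<Rightarrow>\<^sub>0 'k) set \<Rightarrow> bool" where
  "cuts_out_nongenerators h B A r I \<longleftrightarrow>
     {x \<in> affine_space ({..<r} \<times> B). \<forall>f\<in>I. mpoly_eval h x f = 0} =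
     {x \<in> affine_space ({..<r} \<times> B). \<not> generates (base_change h B A) ((\<lambda>j b. x (j, b)) ` {..<r})}"

text \<open>\<open>I\<close> is the ideal of a closed subscheme \<open>Z\<^sub>r\<close> of \<open>V\<^sub>r\<close>. The condition on the points is required
  only for the extension \<open>L\<close> of \<open>K\<close> that is its algebraic closure. By the Nullstellensatz this
  determines \<open>Z\<^sub>r\<close> up to nilpotents, hence its dimension, and every \<open>Z\<^sub>r\<close> satisfying the condition
  for all \<open>L\<close> is included.\<close>

definition nongenerator_ideal ::
    "'a set \<Rightarrow> ('k::field, 'a::ab_group_add, 'i) multialgebra \<Rightarrow> nat \<Rightarrow>
     ((nat \<times> 'a \<Rightarrow>\<^sub>0 nat) \<Rightarrow>\<^sub>0 'k) set \<Rightarrow> bool" where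
  "nongenerator_ideal B A r I \<longleftrightarrow>
     ideal I (tuple_ring B r) \<and> cuts_out_nongenerators to_ac B A r I"

end

theory Submission
  imports Defs
begin

text \<open>
  For an ideal \<open>I\<close> of \<open>K[V]\<close>, the Krull dimension of \<open>K[V]/I\<close> is the largest number of variables \<open>U \<subseteq> V\<close>
  with \<open>I \<inter> K[U] = 0\<close>. By the Nullstellensatz this condition says that the zero set of \<open>I\<close> over the
  algebraic closure projects to a Zariski dense subset of the affine space with coordinates in \<open>U\<close>.

  The non-generating tuples are those contained in some proper subalgebra. Let \<open>a\<close> be the largest
  dimension of a proper subalgebra of the geometric algebra, \<open>n\<close> the dimension of the algebra, and
  \<open>d r\<close> the dimension of the set of non-generating \<open>r\<close>-tuples. The tuples in subalgebras of dimension \<open>m\<close>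
  are determined by \<open>m r\<close> coordinates and a basis, so they have dimension at most \<open>m (r + n)\<close>;
  hence \<open>d r \<le> a (r + n)\<close>, and for large \<open>r\<close> only the subalgebras of dimension \<open>a\<close> matter. Appending an
  arbitrary element of the subalgebra to such a tuple gives \<open>d (r + 1) \<ge> d r + a\<close>. So
  \<open>d r - a r\<close> is eventually nondecreasing, and it is bounded, hence eventually constant.
\<close>

section \<open>Commutative rings\<close>

text \<open>Both halves of the dimension criterion rest on one fact: if U is a maximal set of
  variables independent modulo a prime P, then K[V]/P is a finite module over K[U] once a single
  nonzero s in K[U] is inverted. Lying over then lifts a flag of primes of K[U] through a point
  where s does not vanish, which gives chains of length card U. Conversely, an element outside P
  divides a nonzero element of K[U] modulo P, so a set that is independent modulo a strictly larger
  prime can still be enlarged modulo P. The same finiteness yields the Nullstellensatz, by lying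
  over the ideal of a point. Instead of localizing, denominators are cleared by powers of s. Rings
  are subsets of one type, so that K[U] lies inside K[V] without embeddings.\<close>

definition is_subring :: "'r::comm_ring_1 set \<Rightarrow> bool" where
  "is_subring C \<longleftrightarrow> 1 \<in> C \<and> (\<forall>x\<in>C. \<forall>y\<in>C. x - y \<in> C \<and> x * y \<in> C)"

definition is_ideal :: "'r::comm_ring_1 set \<Rightarrow> 'r set \<Rightarrow> bool" where
  "is_ideal C J \<longleftrightarrow> J \<subseteq> C \<and> 0 \<in> J \<and> (\<forall>x\<in>J. \<forall>y\<in>J. x + y \<in> J) \<and> (\<forall>c\<in>C. \<forall>x\<in>J. c * x \<in> J)"

definition is_prime :: "'r::comm_ring_1 set \<Rightarrow> 'r set \<Rightarrow> bool" where
  "is_prime C P \<longleftrightarrow> is_ideal C P \<and> 1 \<notin> P \<and> (\<forall>x\<in>C. \<forall>y\<in>C. x * y \<in> P \<longrightarrow> x \<in> P \<or> y \<in> P)"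

context
  fixes C :: "'r::comm_ring_1 set"
  assumes C: "is_subring C"
begin

lemma subring_one: "1 \<in> C"
  and subring_diff: "x \<in> C \<Longrightarrow> y \<in> C \<Longrightarrow> x - y \<in> C"
  and subring_mult: "x \<in> C \<Longrightarrow> y \<in> C \<Longrightarrow> x * y \<in> C"
  using C by (auto simp: is_subring_def)

lemma subring_zero: "0 \<in> C"
  using subring_diff[OF subring_one subring_one] by simp

lemma subring_uminus: "x \<in> C \<Longrightarrow> - x \<in> C"
  using subring_diff[OF subring_zero] by simp

lemma subring_add: "x \<in> C \<Longrightarrow> y \<in> C \<Longrightarrow> x + y \<in> C"
  using subring_diff[of x "- y"] subring_uminus by simp

lemma subring_power: "x \<in> C \<Longrightarrow> x ^ n \<in> C"
  by (induction n) (auto intro: subring_one subring_mult)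

lemma subring_sum: "(\<And>i. i \<in> I \<Longrightarrow> f i \<in> C) \<Longrightarrow> sum f I \<in> C"
  by (induction I rule: infinite_finite_induct) (auto intro: subring_zero subring_add)

lemma subring_prod: "(\<And>i. i \<in> I \<Longrightarrow> f i \<in> C) \<Longrightarrow> prod f I \<in> C"
  by (induction I rule: infinite_finite_induct) (auto intro: subring_one subring_mult)

lemma ideal_self: "is_ideal C C"
  by (auto simp: is_ideal_def subring_zero subring_add subring_mult)

context
  fixes J
  assumes J: "is_ideal C J"
begin

lemma ideal_subset: "J \<subseteq> C"
  and ideal_zero: "0 \<in> J"
  and ideal_add: "x \<in> J \<Longrightarrow> y \<in> J \<Longrightarrow> x + y \<in> J"
  and ideal_mult_left: "c \<in> C \<Longrightarrow> x \<in> J \<Longrightarrow> c * x \<in> J"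
  and ideal_mult_right: "c \<in> C \<Longrightarrow> x \<in> J \<Longrightarrow> x * c \<in> J"
  using J by (auto simp: is_ideal_def mult.commute)

lemma ideal_uminus: "x \<in> J \<Longrightarrow> - x \<in> J"
  using ideal_mult_left[of "- 1" x] subring_uminus[OF subring_one] by simp

lemma ideal_diff: "x \<in> J \<Longrightarrow> y \<in> J \<Longrightarrow> x - y \<in> J"
  using ideal_add[of x "- y"] ideal_uminus by simp

lemma ideal_sum: "(\<And>i. i \<in> I \<Longrightarrow> f i \<in> J) \<Longrightarrow> sum f I \<in> J"
  by (induction I rule: infinite_finite_induct) (auto intro: ideal_zero ideal_add)

end

lemma prime_power:
  assumes "is_prime C P" "x \<in> C" "x \<notin> P"
  shows "x ^ n \<notin> P"
  using assms by (induction n) (auto simp: is_prime_def subring_power)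

lemma prime_prod:
  assumes "is_prime C P" "\<And>i. i \<in> I \<Longrightarrow> f i \<in> C - P"
  shows "prod f I \<notin> P"
  using assms(2)
proof (induction I rule: infinite_finite_induct)
  case (insert i I)
  then show ?case
    using assms(1) subring_prod[of I f] by (auto simp: is_prime_def)
qed (use assms(1) in \<open>auto simp: is_prime_def\<close>)

text \<open>An ideal P maximal among those that contain J and miss S is prime: if x and y lie
  outside P, then P + C x and P + C y both meet S, and with x * y in P the product of the two
  elements found would lie in both P and S.\<close>

lemma ex_prime_avoiding:
  assumes J: "is_ideal C J" and S: "S \<subseteq> C" "1 \<in> S" "\<And>x y. x \<in> S \<Longrightarrow> y \<in> S \<Longrightarrow> x * y \<in> S"
    and disj: "J \<inter> S = {}"
  shows "\<exists>P. is_prime C P \<and> J \<subseteq> P \<and> P \<inter> S = {}"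
proof -
  define \<A> where "\<A> = {I. is_ideal C I \<and> J \<subseteq> I \<and> I \<inter> S = {}}"
  have "\<exists>P\<in>\<A>. \<forall>Y\<in>\<A>. P \<subseteq> Y \<longrightarrow> Y = P"
  proof (rule subset_Zorn_nonempty)
    show "\<A> \<noteq> {}" using J disj by (auto simp: \<A>_def)
  next
    fix \<C> assume \<C>: "\<C> \<noteq> {}" "subset.chain \<A> \<C>"
    have sub: "\<And>I. I \<in> \<C> \<Longrightarrow> I \<in> \<A>" and tot: "\<And>I I'. I \<in> \<C> \<Longrightarrow> I' \<in> \<C> \<Longrightarrow> I \<subseteq> I' \<or> I' \<subseteq> I"
      using \<C>(2) by (auto simp: subset.chain_def)
    have "is_ideal C (\<Union>\<C>)"
      unfolding is_ideal_def
    proof (intro conjI ballI)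
      show "\<Union>\<C> \<subseteq> C" using sub unfolding \<A>_def is_ideal_def by blast
      show "0 \<in> \<Union>\<C>" using sub \<C>(1) by (auto simp: \<A>_def is_ideal_def)
      show "x + y \<in> \<Union>\<C>" if "x \<in> \<Union>\<C>" "y \<in> \<Union>\<C>" for x y
      proof -
        obtain I I' where I: "I \<in> \<C>" "I' \<in> \<C>" "x \<in> I" "y \<in> I'" using \<open>x \<in> \<Union>\<C>\<close> \<open>y \<in> \<Union>\<C>\<close> by blast
        then obtain I'' where "I'' \<in> \<C>" "x \<in> I''" "y \<in> I''" using tot by blast
        then show ?thesis using sub[of I''] by (auto simp: \<A>_def is_ideal_def)
      qed
      show "c * x \<in> \<Union>\<C>" if "c \<in> C" "x \<in> \<Union>\<C>" for c x
      proof -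
        obtain I where I: "I \<in> \<C>" "x \<in> I" using \<open>x \<in> \<Union>\<C>\<close> by blast
        then have "is_ideal C I" using sub by (auto simp: \<A>_def)
        then have "c * x \<in> I" using I(2) that(1) by (simp add: is_ideal_def)
        then show ?thesis using I(1) by blast
      qed
    qed
    moreover obtain I where "I \<in> \<C>" using \<C>(1) by blast
    then have "J \<subseteq> \<Union>\<C>" using sub unfolding \<A>_def by blast
    moreover have "\<Union>\<C> \<inter> S = {}" using sub unfolding \<A>_def by blast
    ultimately show "\<Union>\<C> \<in> \<A>" unfolding \<A>_def by blast
  qed
  then obtain P where "P \<in> \<A>" and max': "\<And>Y. Y \<in> \<A> \<Longrightarrow> P \<subseteq> Y \<Longrightarrow> Y = P"
    by meson
  then have P: "is_ideal C P" "J \<subseteq> P" "P \<inter> S = {}" by (simp_all add: \<A>_def)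
  have max: "Y = P" if "is_ideal C Y" "Y \<inter> S = {}" "P \<subseteq> Y" for Y
    using max'[of Y] that P(2) by (simp add: \<A>_def)
  have ext: "\<exists>p\<in>P. \<exists>c\<in>C. p + c * x \<in> S" if x: "x \<in> C" "x \<notin> P" for x
  proof (rule ccontr)
    assume *: "\<not> ?thesis"
    let ?Y = "{p + c * x |p c. p \<in> P \<and> c \<in> C}"
    have "is_ideal C ?Y"
      unfolding is_ideal_def
    proof (intro conjI ballI)
      show "?Y \<subseteq> C" using x ideal_subset[OF P(1)] by (auto intro: subring_add subring_mult)
      show "0 \<in> ?Y" using ideal_zero[OF P(1)] subring_zero by force
      show "y + z \<in> ?Y" if yz: "y \<in> ?Y" "z \<in> ?Y" for y z
      proof -
        obtain p c p' c' where "y = p + c * x" "z = p' + c' * x" "p \<in> P" "c \<in> C" "p' \<in> P" "c' \<in> C"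
          using yz by blast
        then have "y + z = (p + p') + (c + c') * x" "p + p' \<in> P" "c + c' \<in> C"
          using ideal_add[OF P(1)] subring_add by (auto simp: algebra_simps)
        then show ?thesis by blast
      qed
      show "d * y \<in> ?Y" if d: "d \<in> C" "y \<in> ?Y" for d y
      proof -
        obtain p c where "y = p + c * x" "p \<in> P" "c \<in> C" using d by blast
        then have "d * y = (d * p) + (d * c) * x" "d * p \<in> P" "d * c \<in> C"
          using d ideal_mult_left[OF P(1)] subring_mult by (auto simp: algebra_simps)
        then show ?thesis by blast
      qed
    qed
    moreover have "?Y \<inter> S = {}" using * by blast
    moreover have "P \<subseteq> ?Y" using subring_zero by force
    ultimately have "?Y = P" by (rule max)
    moreover have "x \<in> ?Y" using ideal_zero[OF P(1)] subring_one by force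
    ultimately show False using x by simp
  qed
  have "x \<in> P \<or> y \<in> P" if xy: "x \<in> C" "y \<in> C" "x * y \<in> P" for x y
  proof (rule ccontr)
    assume "\<not> (x \<in> P \<or> y \<in> P)"
    then obtain p c p' c' where pc: "p \<in> P" "c \<in> C" "p + c * x \<in> S" "p' \<in> P" "c' \<in> C" "p' + c' * y \<in> S"
      using ext[of x] ext[of y] xy by blast
    have "(p + c * x) * (p' + c' * y) = (p' + c' * y) * p + c * x * p' + c * c' * (x * y)"
      by (simp add: algebra_simps)
    also have "\<dots> \<in> P"
      using pc xy S(1)
      by (intro ideal_add[OF P(1)] ideal_mult_left[OF P(1) _ pc(1)] ideal_mult_left[OF P(1) _ pc(4)]
          ideal_mult_left[OF P(1) _ xy(3)]) (auto intro: subring_mult)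
    finally show False using S(3)[OF pc(3,6)] P(3) by auto
  qed
  then have "is_prime C P" using P S(2) by (auto simp: is_prime_def)
  then show ?thesis using P by blast
qed

end

section \<open>Lying over for extensions that are finite after inverting one element\<close>

lemma prime_contract:
  assumes "is_subring D" "D \<subseteq> C" "is_prime C P"
  shows "is_prime D (P \<inter> D)"
proof -
  have "is_ideal D (P \<inter> D)"
    using assms(2,3) subring_zero[OF assms(1)] subring_add[OF assms(1)] subring_mult[OF assms(1)]
    by (simp add: is_prime_def is_ideal_def subset_iff)
  then show ?thesis
    using assms(2,3) subring_mult[OF assms(1)] unfolding is_prime_def by (simp add: subset_iff)
qed

text \<open>Fraction-free Gaussian elimination: a matrix over \<open>D\<close> that is diagonal and invertible
  modulo \<open>q\<close> keeps this form when a row and a column are eliminated.\<close>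

lemma elimination:
  assumes D: "is_subring D" "D \<subseteq> C" and P: "is_subring C" "is_ideal C P" and q: "is_prime D q"
    and "finite F" "i0 \<notin> F"
    and "\<And>i j. i \<in> insert i0 F \<Longrightarrow> j \<in> insert i0 F \<Longrightarrow> a i j \<in> D"
    and "\<And>i. i \<in> insert i0 F \<Longrightarrow> a i i \<notin> q"
    and "\<And>i j. i \<in> insert i0 F \<Longrightarrow> j \<in> insert i0 F \<Longrightarrow> i \<noteq> j \<Longrightarrow> a i j \<in> q"
    and "\<And>i. i \<in> insert i0 F \<Longrightarrow> (\<Sum>j\<in>insert i0 F. a i j * m j) \<in> P"
  shows "\<exists>d\<in>D - q. d * m i0 \<in> P"
  using assms(6-)
proof (induction F arbitrary: a rule: finite_induct)
  case empty
  then show ?case by (intro bexI[of _ "a i0 i0"]) auto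
next
  case (insert p F)
  have qi: "is_ideal D q" using q by (simp add: is_prime_def)
  \<comment> \<open>Row i is multiplied by the pivot a p p and a multiple of row p is subtracted, so
    that column p drops out. The correction a i p * a p j lies in q because its factors are
    off-diagonal; on the diagonal there remains, modulo q, a product of two elements outside
    q.\<close>
  define b where "b i j = a p p * a i j - a i p * a p j" for i j
  note [simp] = insert.hyps
  show ?case
  proof (rule insert.IH[of b])
    show "i0 \<notin> F" using insert.prems by auto
    show "b i j \<in> D" if "i \<in> insert i0 F" "j \<in> insert i0 F" for i j
      unfolding b_def using that insert.prems by (intro subring_diff[OF D(1)] subring_mult[OF D(1)]) auto
    show "b i i \<notin> q" if i: "i \<in> insert i0 F" for i
    proof
      assume "b i i \<in> q"
      moreover have "i \<noteq> p" using i insert.prems(1) insert.hyps by auto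
      then have "a i p * a p i \<in> q"
        using i insert.prems by (intro ideal_mult_left[OF D(1) qi]) auto
      ultimately have "b i i + a i p * a p i \<in> q" by (rule ideal_add[OF D(1) qi])
      then have "a p p * a i i \<in> q" by (simp add: b_def)
      moreover have "a p p \<in> D" "a i i \<in> D" "a p p \<notin> q" "a i i \<notin> q"
        using i insert.prems(2,3) by auto
      ultimately show False using q by (auto simp: is_prime_def)
    qed
    show "b i j \<in> q" if ij: "i \<in> insert i0 F" "j \<in> insert i0 F" "i \<noteq> j" for i j
    proof -
      have "j \<noteq> p" using ij insert.prems(1) insert.hyps by auto
      then show ?thesis unfolding b_def using ij insert.prems
        by (intro ideal_diff[OF D(1) qi] ideal_mult_left[OF D(1) qi]) auto
    qed
    show "(\<Sum>j\<in>insert i0 F. b i j * m j) \<in> P" if i: "i \<in> insert i0 F" for i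
    proof -
      have eq: "insert i0 (insert p F) = insert p (insert i0 F)" by auto
      have p: "p \<notin> insert i0 F" using insert.prems(1) by auto
      have "(\<Sum>j\<in>insert i0 F. b i j * m j) =
        a p p * (\<Sum>j\<in>insert i0 F. a i j * m j) - a i p * (\<Sum>j\<in>insert i0 F. a p j * m j)"
        by (simp add: b_def sum_distrib_left algebra_simps sum_subtractf del: sum.insert)
      also have "\<dots> = a p p * (\<Sum>j\<in>insert i0 (insert p F). a i j * m j) - a i p * (\<Sum>j\<in>insert i0 (insert p F). a p j * m j)"
        unfolding eq using p by (subst (3 4) sum.insert) (auto simp: algebra_simps)
      also have "\<dots> \<in> P"
        using i D insert.prems by (intro ideal_diff[OF P] ideal_mult_left[OF P]) auto
      finally show ?thesis .
    qed
  qed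
qed

text \<open>Modulo P this is the E-span of F. Two choices of E occur: E = D gives the module M
  spanned by F, and a prime q of D gives the submodule q M.\<close>

definition combinations :: "'r::comm_ring_1 set \<Rightarrow> 'r set \<Rightarrow> 'r set \<Rightarrow> 'r set" where
  "combinations P F E = {y. \<exists>c. (\<forall>g\<in>F. c g \<in> E) \<and> y - (\<Sum>g\<in>F. c g * g) \<in> P}"

text \<open>Given \<open>1 \<in> F\<close>, this says that \<open>C/P\<close> becomes a finite module over \<open>D\<close>, spanned by \<open>F\<close>, once
  \<open>s\<close> is inverted.\<close>

definition finite_over :: "'r::comm_ring_1 set \<Rightarrow> 'r set \<Rightarrow> 'r set \<Rightarrow> 'r \<Rightarrow> 'r set \<Rightarrow> bool" where
  "finite_over C D P s F \<longleftrightarrow>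
     (\<forall>w\<in>C. \<exists>L. \<forall>g\<in>F. s ^ L * w * g \<in> combinations P F D)"

locale subring_pair =
  fixes C D :: "'r::comm_ring_1 set" and P
  assumes C: "is_subring C" and D: "is_subring D" and DC: "D \<subseteq> C" and P: "is_prime C P"
begin

lemma Pi: "is_ideal C P" using P by (simp add: is_prime_def)

lemma combinations_add:
  assumes E: "is_ideal D E" and "x \<in> combinations P F E" "y \<in> combinations P F E"
  shows "x + y \<in> combinations P F E"
proof -
  obtain c d where cd: "\<forall>g\<in>F. c g \<in> E" "x - (\<Sum>g\<in>F. c g * g) \<in> P"
    "\<forall>g\<in>F. d g \<in> E" "y - (\<Sum>g\<in>F. d g * g) \<in> P"
    using assms(2,3) by (auto simp: combinations_def)
  have "x + y - (\<Sum>g\<in>F. (c g + d g) * g) \<in> P"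
    using ideal_add[OF C Pi cd(2,4)] by (simp add: algebra_simps sum.distrib)
  then show ?thesis using cd ideal_add[OF D E] by (auto simp: combinations_def intro!: exI[of _ "\<lambda>g. c g + d g"])
qed

lemma combinations_mult:
  assumes "d \<in> D" "\<And>e. e \<in> E \<Longrightarrow> d * e \<in> E'" "x \<in> combinations P F E"
  shows "d * x \<in> combinations P F E'"
proof -
  obtain c where c: "\<forall>g\<in>F. c g \<in> E" "x - (\<Sum>g\<in>F. c g * g) \<in> P"
    using assms(3) by (auto simp: combinations_def)
  have "d * x - (\<Sum>g\<in>F. (d * c g) * g) \<in> P"
    using ideal_mult_left[OF C Pi _ c(2), of d] assms(1) DC by (auto simp: algebra_simps sum_distrib_left)
  then show ?thesis using c assms(2) by (auto simp: combinations_def intro!: exI[of _ "\<lambda>g. d * c g"])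
qed

lemma combinations_P:
  assumes "is_ideal D E" "x \<in> P"
  shows "x \<in> combinations P F E"
  using assms ideal_zero[OF D assms(1)] by (auto simp: combinations_def intro!: exI[of _ "\<lambda>_. 0"])

lemma combinations_sum:
  assumes E: "is_ideal D E" and "\<And>i. i \<in> I \<Longrightarrow> f i \<in> combinations P F E"
  shows "sum f I \<in> combinations P F E"
  using assms(2) combinations_add[OF E] combinations_P[OF E ideal_zero[OF C Pi]]
  by (induction I rule: infinite_finite_induct) auto

lemma combinations_base:
  assumes E: "is_ideal D E" and "finite F" "g \<in> F" "e \<in> E"
  shows "e * g \<in> combinations P F E"
proof -
  have "(\<Sum>h\<in>F. (if h = g then e else 0) * h) = (\<Sum>h\<in>F. if h = g then e * h else 0)"
    by (intro sum.cong) auto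
  also have "\<dots> = e * g" using assms by (simp add: sum.delta')
  finally have "e * g - (\<Sum>h\<in>F. (if h = g then e else 0) * h) \<in> P"
    using ideal_zero[OF C Pi] by simp
  moreover have "\<forall>h\<in>F. (if h = g then e else 0) \<in> E"
    using assms ideal_zero[OF D E] by simp
  ultimately show ?thesis unfolding combinations_def by (intro CollectI exI conjI)
qed

lemma combinations_compose:
  assumes E: "is_ideal D E" and x: "x \<in> combinations P F E" and w: "w \<in> C"
    and *: "\<And>g. g \<in> F \<Longrightarrow> w * g \<in> combinations P G D"
  shows "w * x \<in> combinations P G E"
proof -
  obtain c where c: "\<forall>g\<in>F. c g \<in> E" "x - (\<Sum>g\<in>F. c g * g) \<in> P"
    using x by (auto simp: combinations_def)
  have "c g * (w * g) \<in> combinations P G E" if "g \<in> F" for g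
    using that c ideal_subset[OF D E]
    by (intro combinations_mult[OF _ _ *]) (auto intro: ideal_mult_right[OF D E])
  then have "w * (x - (\<Sum>g\<in>F. c g * g)) + (\<Sum>g\<in>F. c g * (w * g)) \<in> combinations P G E"
    by (intro combinations_add[OF E] combinations_sum[OF E] combinations_P[OF E ideal_mult_left[OF C Pi w c(2)]]) auto
  then show ?thesis by (simp add: algebra_simps sum_distrib_left)
qed

text \<open>Assumption \<open>ind\<close> expresses that D and Y generate C as a ring. The elements
  w that admit some power of s are closed under sums and products, the exponents being added, so
  generators are enough; for those in Y the first power of s does.\<close>

lemma finite_over_generated:
  assumes "s \<in> D" "finite F"
    and ind: "\<And>N. D \<subseteq> N \<Longrightarrow> Y \<subseteq> N \<Longrightarrow> (\<And>x y. x \<in> N \<Longrightarrow> y \<in> N \<Longrightarrow> x + y \<in> N) \<Longrightarrow>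
        (\<And>x y. x \<in> N \<Longrightarrow> y \<in> N \<Longrightarrow> x * y \<in> N) \<Longrightarrow> C \<subseteq> N"
    and Y: "Y \<subseteq> C" "\<And>x f. x \<in> Y \<Longrightarrow> f \<in> F \<Longrightarrow> s * x * f \<in> combinations P F D"
  shows "finite_over C D P s F"
proof -
  note DD = ideal_self[OF D]
  let ?N = "{w\<in>C. \<exists>L. \<forall>g\<in>F. s ^ L * w * g \<in> combinations P F D}"
  have "C \<subseteq> ?N"
  proof (rule ind)
    show "D \<subseteq> ?N"
    proof
      fix d assume "d \<in> D"
      then show "d \<in> ?N" using DC combinations_base[OF DD assms(2)] by (auto intro!: exI[of _ 0])
    qed
    show "Y \<subseteq> ?N"
    proof
      fix x assume "x \<in> Y"
      then show "x \<in> ?N" using Y by (auto intro!: exI[of _ 1])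
    qed
    fix x y assume "x \<in> ?N" "y \<in> ?N"
    then obtain L M where xy: "x \<in> C" "y \<in> C"
      "\<And>g. g \<in> F \<Longrightarrow> s ^ L * x * g \<in> combinations P F D" "\<And>g. g \<in> F \<Longrightarrow> s ^ M * y * g \<in> combinations P F D"
      by blast
    have s: "s ^ n \<in> D" for n using subring_power[OF D assms(1)] .
    have "s ^ M * (s ^ L * x * g) + s ^ L * (s ^ M * y * g) \<in> combinations P F D" if "g \<in> F" for g
      using that s subring_mult[OF D]
      by (intro combinations_add[OF DD] combinations_mult[where E = D, OF _ _ xy(3)]
          combinations_mult[where E = D, OF _ _ xy(4)]) blast+
    then have "\<forall>g\<in>F. s ^ (L + M) * (x + y) * g \<in> combinations P F D"
      by (simp add: algebra_simps power_add)
    then show "x + y \<in> ?N" using xy subring_add[OF C] by blast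
    have "(s ^ L * x) * (s ^ M * y * g) \<in> combinations P F D" if "g \<in> F" for g
      by (rule combinations_compose[OF DD xy(4)[OF that]]) (use xy(3) subring_mult[OF C _ xy(1)] s DC in auto)
    then have "\<forall>g\<in>F. s ^ (L + M) * (x * y) * g \<in> combinations P F D"
      by (simp add: algebra_simps power_add)
    then show "x * y \<in> ?N" using xy subring_mult[OF C] by blast
  qed
  then show ?thesis by (auto simp: finite_over_def)
qed

text \<open>Products of powers x ^ i with i < e, one range for each x in Y, span everything: the
  relation for x rewrites s * x ^ e through lower powers. All relations have the same leading
  coefficient s, so one factor s is enough for each multiplication by an x.\<close>

lemma ex_spanning_set:
  assumes "finite Y" "Y \<subseteq> C" "s \<in> D"
    and "\<And>x. x \<in> Y \<Longrightarrow> \<exists>e c. e > 0 \<and> (\<forall>i<e. c i \<in> D) \<and> s * x ^ e - (\<Sum>i<e. c i * x ^ i) \<in> P"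
  shows "\<exists>F. finite F \<and> F \<subseteq> C \<and> 1 \<in> F \<and> (\<forall>x\<in>Y. \<forall>f\<in>F. s * x * f \<in> combinations P F D)"
  using assms(1,2,4)
proof (induction Y rule: finite_induct)
  case empty
  then show ?case by (intro exI[of _ "{1}"]) (auto simp: subring_one[OF C])
next
  case (insert x Y)
  note DD = ideal_self[OF D]
  obtain F where F: "finite F" "F \<subseteq> C" "1 \<in> F" "\<And>y f. y \<in> Y \<Longrightarrow> f \<in> F \<Longrightarrow> s * y * f \<in> combinations P F D"
    using insert.IH[OF _ insert.prems(2)] insert.prems(1) by blast
  obtain e c where e: "e > 0" "\<And>i. i < e \<Longrightarrow> c i \<in> D" "s * x ^ e - (\<Sum>i<e. c i * x ^ i) \<in> P"
    using insert.prems(2)[of x] by blast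
  have x: "x \<in> C" using insert.prems by auto
  define G where "G = (\<lambda>(i, f). x ^ i * f) ` ({..<e} \<times> F)"
  have fG: "finite G" using F by (simp add: G_def)
  have inG: "x ^ i * f \<in> G" if "i < e" "f \<in> F" for i f using that by (force simp: G_def)
  have cG: "d * (x ^ i * f) \<in> combinations P G D" if "d \<in> D" "i < e" "f \<in> F" for d i f
    using combinations_base[OF DD fG inG] that by blast
  have "s * y * h \<in> combinations P G D" if yh: "y \<in> insert x Y" "h \<in> G" for y h
  proof -
    obtain i f where i: "h = x ^ i * f" "i < e" "f \<in> F" using yh by (auto simp: G_def)
    show ?thesis
    proof (cases "y = x")
      case False
      then have "s * y * f \<in> combinations P F D" using F yh i by blast
      moreover have "x ^ i * g \<in> combinations P G D" if "g \<in> F" for g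
        using cG[OF subring_one[OF D] i(2) that] by simp
      ultimately have "x ^ i * (s * y * f) \<in> combinations P G D"
        by (rule combinations_compose[OF DD _ subring_power[OF C x]])
      then show ?thesis by (simp add: i algebra_simps)
    next
      case True
      show ?thesis
      proof (cases "Suc i < e")
        case True
        then show ?thesis using cG[of s "Suc i" f] assms(3) i \<open>y = x\<close> by (simp add: algebra_simps)
      next
        case False
        then have ei: "e = Suc i" using i by auto
        have "(s * x ^ e - (\<Sum>i<e. c i * x ^ i)) * f + (\<Sum>j<e. c j * (x ^ j * f)) \<in> combinations P G D"
          using i e F by (intro combinations_add[OF DD] combinations_P[OF DD] combinations_sum[OF DD] cG ideal_mult_right[OF C Pi]) auto
        then show ?thesis by (simp add: i ei \<open>y = x\<close> algebra_simps sum_distrib_left)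
      qed
    qed
  qed
  moreover have "G \<subseteq> C" using F x by (auto simp: G_def intro!: subring_mult[OF C] subring_power[OF C])
  moreover have "1 \<in> G" using inG[of 0 1] e F by simp
  ultimately show ?case using fG by blast
qed

text \<open>With M the span of F over D modulo P, \<open>J\<close> collects the x with x M
  \<subseteq> q M up to a power of s. It contains P and q, so a prime that contains \<open>J\<close>
  and misses D - q lies over q. Such a prime exists because \<open>J\<close> itself misses D - q, by
  the determinant trick in the form of \<open>elimination\<close>.\<close>

lemma going_up:
  assumes q: "is_prime D q" "P \<inter> D \<subseteq> q" and s: "s \<in> D" "s \<notin> q"
    and F: "finite F" "F \<subseteq> C" "1 \<in> F" "finite_over C D P s F"
  shows "\<exists>Q. is_prime C Q \<and> P \<subseteq> Q \<and> Q \<inter> D = q"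
proof -
  note DD = ideal_self[OF D]
  have qi: "is_ideal D q" using q by (simp add: is_prime_def)
  have sL: "s ^ n \<in> D" for n using subring_power[OF D s(1)] .
  define J where "J = {x\<in>C. \<exists>L. \<forall>f\<in>F. s ^ L * x * f \<in> combinations P F q}"
  have Ji: "is_ideal C J"
    unfolding is_ideal_def
  proof (intro conjI ballI)
    show "J \<subseteq> C" by (auto simp: J_def)
    show "0 \<in> J" using subring_zero[OF C] combinations_P[OF qi ideal_zero[OF C Pi]] by (auto simp: J_def)
  next
    fix x y assume "x \<in> J" "y \<in> J"
    then obtain L M where xy: "x \<in> C" "y \<in> C"
      "\<And>g. g \<in> F \<Longrightarrow> s ^ L * x * g \<in> combinations P F q" "\<And>g. g \<in> F \<Longrightarrow> s ^ M * y * g \<in> combinations P F q"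
      unfolding J_def by blast
    have "s ^ M * (s ^ L * x * g) + s ^ L * (s ^ M * y * g) \<in> combinations P F q" if "g \<in> F" for g
      using that sL ideal_mult_left[OF D qi]
      by (intro combinations_add[OF qi] combinations_mult[where E = q, OF _ _ xy(3)]
          combinations_mult[where E = q, OF _ _ xy(4)]) blast+
    then have "\<forall>g\<in>F. s ^ (L + M) * (x + y) * g \<in> combinations P F q"
      by (simp add: algebra_simps power_add)
    then show "x + y \<in> J" unfolding J_def using xy subring_add[OF C] by blast
  next
    fix w x assume w: "w \<in> C" and "x \<in> J"
    then obtain L where x: "x \<in> C" "\<And>g. g \<in> F \<Longrightarrow> s ^ L * x * g \<in> combinations P F q"
      unfolding J_def by blast
    obtain M where M: "\<And>g. g \<in> F \<Longrightarrow> s ^ M * w * g \<in> combinations P F D"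
      using F(4) w unfolding finite_over_def by blast
    have "(s ^ M * w) * (s ^ L * x * g) \<in> combinations P F q" if "g \<in> F" for g
      by (rule combinations_compose[OF qi x(2)[OF that]]) (use M subring_mult[OF C _ w] sL DC in auto)
    then have "\<forall>g\<in>F. s ^ (M + L) * (w * x) * g \<in> combinations P F q"
      by (simp add: algebra_simps power_add)
    then show "w * x \<in> J" unfolding J_def using x w subring_mult[OF C] by blast
  qed
  have PJ: "P \<subseteq> J"
    using ideal_subset[OF C Pi] F combinations_P[OF qi] ideal_mult_left[OF C Pi] ideal_mult_right[OF C Pi]
    by (auto simp: J_def intro!: exI[of _ 0])
  have qJ: "q \<subseteq> J"
    using ideal_subset[OF D qi] DC combinations_base[OF qi F(1)] by (auto simp: J_def intro!: exI[of _ 0])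
  have "J \<inter> (D - q) = {}"
  proof (rule ccontr)
    assume "\<not> ?thesis"
    then obtain u L where u: "u \<in> D" "u \<notin> q" "\<And>f. f \<in> F \<Longrightarrow> s ^ L * u * f \<in> combinations P F q"
      by (auto simp: J_def)
    then have "\<forall>f\<in>F. \<exists>c. (\<forall>g\<in>F. c g \<in> q) \<and> s ^ L * u * f - (\<Sum>g\<in>F. c g * g) \<in> P"
      unfolding combinations_def by blast
    then obtain c where c: "\<And>f g. f \<in> F \<Longrightarrow> g \<in> F \<Longrightarrow> c f g \<in> q"
      "\<And>f. f \<in> F \<Longrightarrow> s ^ L * u * f - (\<Sum>g\<in>F. c f g * g) \<in> P" by metis
    \<comment> \<open>The assumption u M \<subseteq> q M as a linear system: s ^ L * u times the
      identity minus a matrix over q annihilates F modulo P. The unknowns are the elements of F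
      themselves; as 1 is one of them, some d in D - q would lie in P, against P \<inter> D
      \<subseteq> q.\<close>
    define a where "a f g = (if f = g then s ^ L * u else 0) - c f g" for f g
    have su: "s ^ L * u \<in> D" "s ^ L * u \<notin> q"
      using u(1,2) sL[of L] prime_power[OF D q(1) s, of L] q(1) subring_mult[OF D]
      unfolding is_prime_def by blast+
    have F1: "insert 1 (F - {1}) = F" using F by auto
    have "\<exists>d\<in>D - q. d * 1 \<in> P"
    proof (rule elimination[OF D DC C Pi q(1), of "F - {1}" 1 a "\<lambda>x. x"]; (simp only: F1)?)
      show "a i j \<in> D" if "i \<in> F" "j \<in> F" for i j
        using that c su ideal_subset[OF D qi] subring_zero[OF D]
        by (auto simp: a_def intro!: subring_diff[OF D] subring_uminus[OF D])
      show "a i i \<notin> q" if "i \<in> F" for i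
      proof
        assume "a i i \<in> q"
        then have "a i i + c i i \<in> q" using c that by (intro ideal_add[OF D qi]) auto
        then show False using su by (simp add: a_def)
      qed
      show "a i j \<in> q" if "i \<in> F" "j \<in> F" "i \<noteq> j" for i j
        using that c by (auto simp: a_def intro: ideal_uminus[OF D qi])
      show "(\<Sum>j\<in>F. a i j * j) \<in> P" if "i \<in> F" for i
      proof -
        have "(\<Sum>j\<in>F. a i j * j) = (\<Sum>j\<in>F. if i = j then s ^ L * u * j else 0) - (\<Sum>j\<in>F. c i j * j)"
          unfolding a_def left_diff_distrib sum_subtractf
          by (intro arg_cong2[where f = "(-)"] sum.cong) auto
        then show ?thesis using c(2)[OF that] F(1) that by (simp add: sum.delta)
      qed
    qed (use F in auto)
    then show False using q(2) by auto
  qed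
  moreover have "1 \<in> D - q" "\<And>x y. x \<in> D - q \<Longrightarrow> y \<in> D - q \<Longrightarrow> x * y \<in> D - q"
    using q subring_one[OF D] subring_mult[OF D] by (auto simp: is_prime_def)
  ultimately obtain Q where Q: "is_prime C Q" "J \<subseteq> Q" "Q \<inter> (D - q) = {}"
    using ex_prime_avoiding[OF C Ji, of "D - q"] DC by blast
  then show ?thesis using PJ qJ ideal_subset[OF D qi] by blast
qed

end

text \<open>Induction on the columns: unless column f vanishes modulo p, some row k serves as pivot
  to clear it, with cross-multiplication in place of division in the domain D/p. One row and one
  column are lost, so the rows stay in excess.\<close>

lemma ex_dependency:
  fixes v :: "'j \<Rightarrow> 'f \<Rightarrow> 'r::comm_ring_1"
  assumes D: "is_subring D" and p: "is_prime D p"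
    and "finite F" "finite J" "card F < card J" "\<And>j f. j \<in> J \<Longrightarrow> f \<in> F \<Longrightarrow> v j f \<in> D"
  shows "\<exists>c. (\<forall>j\<in>J. c j \<in> D) \<and> (\<exists>j\<in>J. c j \<notin> p) \<and> (\<forall>f\<in>F. (\<Sum>j\<in>J. c j * v j f) \<in> p)"
  using assms(3-)
proof (induction F arbitrary: J v rule: finite_induct)
  case empty
  then show ?case using p subring_one[OF D]
    by (intro exI[of _ "\<lambda>_. 1"]) (auto simp: is_prime_def card_gt_0_iff)
next
  case (insert f F)
  have pi: "is_ideal D p" using p by (simp add: is_prime_def)
  show ?case
  proof (cases "\<forall>j\<in>J. v j f \<in> p")
    case True
    obtain c where c: "\<forall>j\<in>J. c j \<in> D" "\<exists>j\<in>J. c j \<notin> p" "\<forall>f\<in>F. (\<Sum>j\<in>J. c j * v j f) \<in> p"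
      using insert.IH[of J v] insert.prems insert.hyps by auto
    moreover have "(\<Sum>j\<in>J. c j * v j f) \<in> p"
      using c True by (intro ideal_sum[OF D pi] ideal_mult_left[OF D pi]) auto
    ultimately show ?thesis by auto
  next
    case False
    then obtain k where k: "k \<in> J" "v k f \<notin> p" by blast
    define u where "u j g = v k f * v j g - v j f * v k g" for j g
    have "\<exists>c. (\<forall>j\<in>J - {k}. c j \<in> D) \<and> (\<exists>j\<in>J - {k}. c j \<notin> p) \<and> (\<forall>g\<in>F. (\<Sum>j\<in>J - {k}. c j * u j g) \<in> p)"
      using insert.prems insert.hyps k
      by (intro insert.IH) (auto simp: u_def intro!: subring_diff[OF D] subring_mult[OF D])
    then obtain c where c: "\<forall>j\<in>J - {k}. c j \<in> D" "\<exists>j\<in>J - {k}. c j \<notin> p"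
      "\<forall>g\<in>F. (\<Sum>j\<in>J - {k}. c j * u j g) \<in> p" by blast
    \<comment> \<open>A relation between the reduced rows u is one between the rows v: the
      coefficient of the pivot row collects the multiples of it that were subtracted. The relation
      stays nontrivial because v k f lies outside the prime p.\<close>
    define d where "d j = (if j = k then - (\<Sum>j\<in>J - {k}. c j * v j f) else v k f * c j)" for j
    have eq: "(\<Sum>j\<in>J. d j * v j g) = (\<Sum>j\<in>J - {k}. c j * u j g)" for g
    proof -
      have "(\<Sum>j\<in>J. d j * v j g) = d k * v k g + (\<Sum>j\<in>J - {k}. d j * v j g)"
        using insert.prems k by (intro sum.remove) auto
      also have "(\<Sum>j\<in>J - {k}. d j * v j g) = (\<Sum>j\<in>J - {k}. v k f * c j * v j g)"
        by (intro sum.cong) (auto simp: d_def)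
      finally show ?thesis by (simp add: d_def u_def algebra_simps sum_distrib_left sum_subtractf)
    qed
    have "\<forall>j\<in>J. d j \<in> D" using c k insert.prems
      by (auto simp: d_def intro!: subring_uminus[OF D] subring_sum[OF D] subring_mult[OF D])
    moreover have "\<exists>j\<in>J. d j \<notin> p"
    proof -
      obtain j where j: "j \<in> J" "j \<noteq> k" "c j \<in> D" "c j \<notin> p" using c by blast
      then have "v k f * c j \<notin> p" using k p insert.prems unfolding is_prime_def by blast
      then show ?thesis using j by (auto simp: d_def)
    qed
    moreover have "(\<Sum>j\<in>J. d j * v j g) \<in> p" if "g \<in> insert f F" for g
    proof (cases "g = f")
      case True
      then show ?thesis unfolding eq using ideal_zero[OF D pi] by (simp add: u_def algebra_simps)
    qed (use c that eq in auto)
    ultimately show ?thesis by blast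
  qed
qed

context subring_pair
begin

text \<open>Modulo P, z is algebraic over D, since the card F + 1 powers 1, ..., z ^ card F lie, up
  to powers of s, in the span of F. The lowest coefficient of a relation between them is, up to a
  power of s, a multiple of z modulo P. In particular a prime that properly contains P contains a
  nonzero element of D.\<close>

lemma ex_constant_in_ideal:
  assumes PD: "P \<inter> D = {0}" and s: "s \<in> D" "s \<noteq> 0"
    and F: "finite F" "F \<subseteq> C" "1 \<in> F" "finite_over C D P s F" and z: "z \<in> C" "z \<notin> P"
  shows "\<exists>d\<in>D - {0}. \<exists>w\<in>C. d + z * w \<in> P"
proof -
  have D0: "is_prime D {0}" using prime_contract[OF D DC P] PD by simp
  define n where "n = card F"
  have "\<exists>L. s ^ L * z ^ j \<in> combinations P F D" for j
    using F(3,4) subring_power[OF C z(1), of j] unfolding finite_over_def by (metis mult.right_neutral)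
  then obtain L where L: "\<And>j. s ^ L j * z ^ j \<in> combinations P F D" by metis
  define M where "M = (\<Sum>j\<le>n. L j)"
  have "s ^ M * z ^ j \<in> combinations P F D" if "j \<le> n" for j
  proof -
    have "L j \<le> M" unfolding M_def using that by (intro member_le_sum) auto
    then have "s ^ M * z ^ j = s ^ (M - L j) * (s ^ L j * z ^ j)"
      by (simp add: power_add[symmetric] mult.assoc[symmetric])
    also have "\<dots> \<in> combinations P F D"
      by (intro combinations_mult[OF _ _ L] subring_mult[OF D] subring_power[OF D] s)
    finally show ?thesis .
  qed
  then have "\<forall>j. \<exists>c. j \<le> n \<longrightarrow> (\<forall>g\<in>F. c g \<in> D) \<and> s ^ M * z ^ j - (\<Sum>g\<in>F. c g * g) \<in> P"
    unfolding combinations_def by blast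
  then obtain v where v: "\<And>j g. j \<le> n \<Longrightarrow> g \<in> F \<Longrightarrow> v j g \<in> D"
    "\<And>j. j \<le> n \<Longrightarrow> s ^ M * z ^ j - (\<Sum>g\<in>F. v j g * g) \<in> P" by metis
  have "\<exists>c. (\<forall>j\<in>{..n}. c j \<in> D) \<and> (\<exists>j\<in>{..n}. c j \<notin> {0}) \<and> (\<forall>f\<in>F. (\<Sum>j\<le>n. c j * v j f) \<in> {0})"
    using F v by (intro ex_dependency[OF D D0]) (auto simp: n_def)
  then obtain c where c: "\<And>j. j \<le> n \<Longrightarrow> c j \<in> D" "\<exists>j\<le>n. c j \<noteq> 0" "\<And>f. f \<in> F \<Longrightarrow> (\<Sum>j\<le>n. c j * v j f) = 0"
    by auto
  have "(\<Sum>j\<le>n. c j * (s ^ M * z ^ j - (\<Sum>g\<in>F. v j g * g))) \<in> P"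
    using c v DC by (intro ideal_sum[OF C Pi] ideal_mult_left[OF C Pi]) auto
  also have "(\<Sum>j\<le>n. c j * (s ^ M * z ^ j - (\<Sum>g\<in>F. v j g * g))) =
      (\<Sum>j\<le>n. c j * s ^ M * z ^ j) - (\<Sum>j\<le>n. \<Sum>g\<in>F. c j * v j g * g)"
    by (simp add: right_diff_distrib sum_subtractf sum_distrib_left mult.assoc)
  also have "(\<Sum>j\<le>n. \<Sum>g\<in>F. c j * v j g * g) = (\<Sum>g\<in>F. (\<Sum>j\<le>n. c j * v j g) * g)"
    by (subst sum.swap) (simp add: sum_distrib_right)
  also have "\<dots> = 0" using c by simp
  finally have sum: "(\<Sum>j\<le>n. c j * s ^ M * z ^ j) \<in> P" by simp
  \<comment> \<open>Below the index i all coefficients vanish, so the relation is z ^ i times an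
    expression with constant term c i * s ^ M. The prime P does not contain z ^ i, so this factor
    can be cancelled.\<close>
  define i where "i = (LEAST j. j \<le> n \<and> c j \<noteq> 0)"
  have i: "i \<le> n" "c i \<noteq> 0" using LeastI_ex[of "\<lambda>j. j \<le> n \<and> c j \<noteq> 0"] c(2) by (auto simp: i_def)
  have least: "c j = 0" if "j < i" for j
    using not_less_Least[of j "\<lambda>j. j \<le> n \<and> c j \<noteq> 0"] that i by (auto simp: i_def)
  define w where "w = (\<Sum>j\<in>{i<..n}. c j * s ^ M * z ^ (j - Suc i))"
  have "(\<Sum>j\<le>n. c j * s ^ M * z ^ j) = (\<Sum>j\<in>insert i {i<..n}. c j * s ^ M * z ^ j)"
  proof (rule sum.mono_neutral_right)
    show "\<forall>j\<in>{..n} - insert i {i<..n}. c j * s ^ M * z ^ j = 0"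
      using least by (auto simp: not_less le_less)
  qed (use i in auto)
  also have "\<dots> = c i * s ^ M * z ^ i + (\<Sum>j\<in>{i<..n}. c j * s ^ M * z ^ j)"
    by simp
  also have "(\<Sum>j\<in>{i<..n}. c j * s ^ M * z ^ j) = z ^ i * z * w"
  proof -
    have "z ^ j = z ^ i * z * z ^ (j - Suc i)" if "i < j" for j
      using that by (metis Suc_leI le_add_diff_inverse power_Suc2 power_add)
    then show ?thesis unfolding w_def sum_distrib_left by (intro sum.cong) (auto simp: algebra_simps)
  qed
  finally have "z ^ i * (c i * s ^ M + z * w) \<in> P" using sum by (simp add: algebra_simps)
  moreover have w: "w \<in> C" unfolding w_def
    using c s DC z by (intro subring_sum[OF C] subring_mult[OF C] subring_power[OF C]) auto
  moreover have d: "c i * s ^ M \<in> D" using c i s by (intro subring_mult[OF D] subring_power[OF D]) auto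
  moreover have "c i * s ^ M + z * w \<in> C"
    by (rule subring_add[OF C subsetD[OF DC d] subring_mult[OF C z(1) w]])
  ultimately have "c i * s ^ M + z * w \<in> P"
    using P prime_power[OF C P z] subring_power[OF C z(1)] unfolding is_prime_def by blast
  moreover have "c i * s ^ M \<noteq> 0"
    using D0 prime_power[OF D D0 s(1), of M] s c i subring_power[OF D s(1), of M] unfolding is_prime_def by auto
  ultimately show ?thesis using d w by blast
qed

end

section \<open>Polynomials\<close>

abbreviation polys :: "'v set \<Rightarrow> (('v \<Rightarrow>\<^sub>0 nat) \<Rightarrow>\<^sub>0 'k::comm_ring_1) set" where
  "polys V \<equiv> carrier (mpoly_ring V)"

definition Const :: "'k::zero \<Rightarrow> ('v \<Rightarrow>\<^sub>0 nat) \<Rightarrow>\<^sub>0 'k" where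
  "Const = Poly_Mapping.single 0"

definition Var :: "'v \<Rightarrow> ('v \<Rightarrow>\<^sub>0 nat) \<Rightarrow>\<^sub>0 'k::comm_ring_1" where
  "Var v = Poly_Mapping.single (Poly_Mapping.single v 1) 1"

definition ev :: "('v \<Rightarrow> 'k::comm_ring_1) \<Rightarrow> (('v \<Rightarrow>\<^sub>0 nat) \<Rightarrow>\<^sub>0 'k) \<Rightarrow> 'k" where
  "ev = mpoly_eval id"

lemma in_polys: "f \<in> polys V \<longleftrightarrow> (\<forall>m\<in>Poly_Mapping.keys f. Poly_Mapping.keys m \<subseteq> V)"
  by (simp add: mpoly_ring_def)

lemma keys_minus_subset: "Poly_Mapping.keys (f - g :: 'v \<Rightarrow>\<^sub>0 'k::ab_group_add) \<subseteq> Poly_Mapping.keys f \<union> Poly_Mapping.keys g"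
  by (auto simp: in_keys_iff lookup_minus)

lemma polys_subring: "is_subring (polys V :: (('v \<Rightarrow>\<^sub>0 nat) \<Rightarrow>\<^sub>0 'k::comm_ring_1) set)"
  unfolding is_subring_def
proof (intro conjI ballI)
  show "1 \<in> (polys V :: (('v \<Rightarrow>\<^sub>0 nat) \<Rightarrow>\<^sub>0 'k) set)" by (simp add: in_polys)
  fix f g :: "('v \<Rightarrow>\<^sub>0 nat) \<Rightarrow>\<^sub>0 'k" assume fg: "f \<in> polys V" "g \<in> polys V"
  show "f - g \<in> polys V" using fg keys_minus_subset[of f g] by (auto simp: in_polys)
  show "f * g \<in> polys V"
    unfolding in_polys
  proof
    fix m assume "m \<in> Poly_Mapping.keys (f * g)"
    then obtain a b where "m = a + b" "a \<in> Poly_Mapping.keys f" "b \<in> Poly_Mapping.keys g"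
      using keys_mult[of f g] by blast
    then show "Poly_Mapping.keys m \<subseteq> V" using fg Poly_Mapping.keys_add[of a b] by (force simp: in_polys)
  qed
qed

lemmas polys_add = subring_add[OF polys_subring]
  and polys_mult = subring_mult[OF polys_subring]
  and polys_diff = subring_diff[OF polys_subring]
  and polys_power = subring_power[OF polys_subring]
  and polys_sum = subring_sum[OF polys_subring]

lemma polys_mono: "U \<subseteq> V \<Longrightarrow> polys U \<subseteq> polys V"
  unfolding in_polys subset_iff[of "polys U"] by blast

lemma Const_one: "Const 1 = 1" and Const_zero: "Const 0 = 0"
  by (simp_all add: Const_def)

lemma Const_add: "Const (a + b) = Const a + Const b"
  and Const_mult: "Const (a * b) = Const a * Const b"
  for a b :: "'k::comm_ring_1"
  by (simp_all add: Const_def single_add mult_single)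

lemma Const_in_polys: "Const c \<in> polys V"
  by (simp add: in_polys Const_def)

lemma Var_in_polys: "v \<in> V \<Longrightarrow> Var v \<in> polys V"
  by (simp add: in_polys Var_def)

lemma poly_mapping_as_sum: "f = (\<Sum>m\<in>Poly_Mapping.keys f. Poly_Mapping.single m (Poly_Mapping.lookup f m))"
proof (rule poly_mapping_eqI)
  fix k
  show "Poly_Mapping.lookup f k = Poly_Mapping.lookup (\<Sum>m\<in>Poly_Mapping.keys f. Poly_Mapping.single m (Poly_Mapping.lookup f m)) k"
    by (simp add: lookup_sum lookup_single when_def in_keys_iff)
qed

lemma single_monomial_sum:
  "Poly_Mapping.single (sum g I) (1::'k::comm_ring_1) = (\<Prod>i\<in>I. Poly_Mapping.single (g i :: 'v \<Rightarrow>\<^sub>0 nat) 1)"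
proof (induction I rule: infinite_finite_induct)
  case (insert i I)
  then show ?case using mult_single[of "g i" "1::'k" "sum g I" 1] by simp
qed simp_all

lemma Var_power: "Var v ^ n = Poly_Mapping.single (Poly_Mapping.single v n) (1::'k::comm_ring_1)"
  unfolding Var_def by (induction n) (simp_all add: mult_single single_add[symmetric])

lemma polys_induct [consumes 1, case_names const add Var]:
  assumes f: "f \<in> polys V" and const: "\<And>c. Q (Const c)"
    and add: "\<And>f g. f \<in> polys V \<Longrightarrow> g \<in> polys V \<Longrightarrow> Q f \<Longrightarrow> Q g \<Longrightarrow> Q (f + g)"
    and Var: "\<And>v f. v \<in> V \<Longrightarrow> f \<in> polys V \<Longrightarrow> Q f \<Longrightarrow> Q (Var v * f)"
  shows "Q f"
proof -
  have Vpow: "Q (Var v ^ n * g) \<and> Var v ^ n * g \<in> polys V" if "v \<in> V" "g \<in> polys V" "Q g" for v n g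
  proof (induction n)
    case (Suc n)
    then show ?case using that Var[of v "Var v ^ n * g"] polys_mult[OF Var_in_polys, of v V "Var v ^ n * g"] by (simp add: mult.assoc)
  qed (use that in auto)
  have mon: "Q (Poly_Mapping.single m c) \<and> Poly_Mapping.single m c \<in> polys V" if m: "Poly_Mapping.keys m \<subseteq> V" for m c
  proof -
    have "Q ((\<Prod>v\<in>S. Var v ^ Poly_Mapping.lookup m v) * Const c) \<and>
        (\<Prod>v\<in>S. Var v ^ Poly_Mapping.lookup m v) * Const c \<in> polys V" if "finite S" "S \<subseteq> V" for S
      using that
    proof (induction S rule: finite_induct)
      case empty
      then show ?case using const Const_in_polys by simp
    next
      case (insert v S)
      then show ?case using Vpow[of v "(\<Prod>v\<in>S. Var v ^ Poly_Mapping.lookup m v) * Const c" "Poly_Mapping.lookup m v"]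
        by (simp add: mult.assoc)
    qed
    moreover have "(\<Prod>v\<in>Poly_Mapping.keys m. Var v ^ Poly_Mapping.lookup m v) * Const c = Poly_Mapping.single m c"
      unfolding Var_power single_monomial_sum[symmetric] poly_mapping_as_sum[of m, symmetric]
      by (simp add: mult_single Const_def)
    ultimately show ?thesis using m by (metis finite_keys)
  qed
  have "Q (\<Sum>m\<in>S. Poly_Mapping.single m (Poly_Mapping.lookup f m)) \<and>
      (\<Sum>m\<in>S. Poly_Mapping.single m (Poly_Mapping.lookup f m)) \<in> polys V"
    if "finite S" "S \<subseteq> Poly_Mapping.keys f" for S
    using that
  proof (induction S rule: finite_induct)
    case empty
    then show ?case using const[of 0] Const_in_polys[of 0] by (simp add: Const_zero)
  next
    case (insert m S)
    then have "Poly_Mapping.keys m \<subseteq> V" using f by (auto simp: in_polys)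
    with insert have *: "Q (\<Sum>m\<in>S. Poly_Mapping.single m (Poly_Mapping.lookup f m))"
      "(\<Sum>m\<in>S. Poly_Mapping.single m (Poly_Mapping.lookup f m)) \<in> polys V"
      "Q (Poly_Mapping.single m (Poly_Mapping.lookup f m))" "Poly_Mapping.single m (Poly_Mapping.lookup f m) \<in> polys V"
      using mon[of m] by auto
    then show ?case using add[OF *(4,2,3,1)] polys_add[OF *(4,2)] insert.hyps by simp
  qed
  then show ?thesis using poly_mapping_as_sum[of f] by (metis finite_keys subset_refl)
qed

lemma polys_subset:
  fixes N :: "(('a \<Rightarrow>\<^sub>0 nat) \<Rightarrow>\<^sub>0 'b::comm_ring_1) set"
  assumes "\<And>c. Const c \<in> N" "\<And>v. v \<in> V \<Longrightarrow> Var v \<in> N"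
    "\<And>x y. x \<in> N \<Longrightarrow> y \<in> N \<Longrightarrow> x + y \<in> N" "\<And>x y. x \<in> N \<Longrightarrow> y \<in> N \<Longrightarrow> x * y \<in> N"
  shows "polys V \<subseteq> N"
proof
  fix f :: "('a \<Rightarrow>\<^sub>0 nat) \<Rightarrow>\<^sub>0 'b" assume "f \<in> polys V"
  then show "f \<in> N" by (induction rule: polys_induct) (use assms in auto)
qed

definition monomial_value :: "('v \<Rightarrow> 'k::comm_ring_1) \<Rightarrow> ('v \<Rightarrow>\<^sub>0 nat) \<Rightarrow> 'k" where
  "monomial_value x m = (\<Prod>v\<in>Poly_Mapping.keys m. x v ^ Poly_Mapping.lookup m v)"

lemma monomial_value_superset:
  assumes "finite S" "Poly_Mapping.keys m \<subseteq> S"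
  shows "monomial_value x m = (\<Prod>v\<in>S. x v ^ Poly_Mapping.lookup m v)"
  unfolding monomial_value_def using assms by (intro prod.mono_neutral_left) (auto simp: in_keys_iff)

lemma monomial_value_add: "monomial_value x (m + n) = monomial_value x m * monomial_value x n"
proof -
  let ?S = "Poly_Mapping.keys m \<union> Poly_Mapping.keys n"
  have "finite ?S" "Poly_Mapping.keys (m + n) \<subseteq> ?S" using Poly_Mapping.keys_add[of m n] by auto
  then show ?thesis
    by (simp add: monomial_value_superset[of ?S] lookup_add power_add prod.distrib)
qed

lemma ev_eq: "ev x f = (\<Sum>m\<in>Poly_Mapping.keys f. Poly_Mapping.lookup f m * monomial_value x m)"
  by (simp add: ev_def mpoly_eval_def monomial_value_def)

lemma ev_add [simp]: "ev x (f + g) = ev x f + ev x g"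
  unfolding ev_eq by (rule setsum_keys_plus_distrib) (simp_all add: algebra_simps)

lemma ev_zero [simp]: "ev x 0 = 0"
  by (simp add: ev_eq)

lemma ev_single: "ev x (Poly_Mapping.single m c) = c * monomial_value x m"
  by (simp add: ev_eq)

lemma ev_Const [simp]: "ev x (Const c) = c"
  by (simp add: ev_single monomial_value_def Const_def)

lemma ev_Var [simp]: "ev x (Var v) = x v"
  by (simp add: ev_single monomial_value_def Var_def)

lemma ev_uminus [simp]: "ev x (- f) = - ev x f"
  using ev_add[of x f "- f"] by (metis add.right_inverse ev_zero minus_unique)

lemma ev_diff [simp]: "ev x (f - g) = ev x f - ev x g"
  using ev_add[of x f "- g"] by simp

lemma ev_sum [simp]: "ev x (sum f I) = (\<Sum>i\<in>I. ev x (f i))"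
  by (induction I rule: infinite_finite_induct) simp_all

lemma ev_mult [simp]: "ev x (f * g) = ev x f * ev x g"
proof -
  have "f * g = (\<Sum>m\<in>Poly_Mapping.keys f. \<Sum>n\<in>Poly_Mapping.keys g.
      Poly_Mapping.single (m + n) (Poly_Mapping.lookup f m * Poly_Mapping.lookup g n))"
    by (subst poly_mapping_as_sum[of f], subst poly_mapping_as_sum[of g]) (simp add: sum_product mult_single)
  also have "ev x \<dots> = ev x f * ev x g"
    by (simp add: ev_single monomial_value_add ev_eq[of x f] ev_eq[of x g] sum_product algebra_simps)
  finally show ?thesis .
qed

lemma ev_one [simp]: "ev x 1 = 1"
  using ev_Const[of x 1] by (simp add: Const_one)

lemma ev_power [simp]: "ev x (f ^ n) = ev x f ^ n"
  by (induction n) simp_all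

lemma ev_cong:
  assumes "f \<in> polys U" "\<And>u. u \<in> U \<Longrightarrow> x u = y u"
  shows "ev x f = ev y f"
  using assms(1) by (induction rule: polys_induct) (use assms(2) in auto)

lemma polys_empty:
  assumes "f \<in> polys {}"
  shows "\<exists>c. f = Const c"
  using assms by (induction rule: polys_induct) (auto simp: Const_add[symmetric])

lemma polys_insert:
  assumes "f \<in> polys (insert x U)"
  shows "\<exists>n c. (\<forall>i. c i \<in> polys U) \<and> f = (\<Sum>i<n. c i * Var x ^ i)"
  using assms
proof (induction rule: polys_induct)
  case (const c)
  show ?case by (intro exI[of _ 1] exI[of _ "\<lambda>_. Const c"]) (simp add: Const_in_polys)
next
  case (add f g)
  then obtain m c n d where *: "\<And>i. c i \<in> polys U" "f = (\<Sum>i<m. c i * Var x ^ i)"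
    "\<And>i. d i \<in> polys U" "g = (\<Sum>i<n. d i * Var x ^ i)" by blast
  have pad: "(\<Sum>i<k. a i * Var x ^ i) = (\<Sum>i<m + n. (if i < k then a i else 0) * Var x ^ i)" if "k \<le> m + n" for a k
    using that by (intro sum.mono_neutral_cong_left) auto
  let ?e = "\<lambda>i. (if i < m then c i else 0) + (if i < n then d i else 0)"
  have "f + g = (\<Sum>i<m + n. ?e i * Var x ^ i)"
    unfolding *(2,4) distrib_right sum.distrib by (simp only: pad[of m] pad[of n] le_add1 le_add2)
  moreover have "\<forall>i. ?e i \<in> polys U"
    using * subring_zero[OF polys_subring] by (auto intro!: polys_add)
  ultimately show ?case by (intro exI[of _ "m + n"] exI[of _ ?e] conjI)
next
  case (Var v f)
  then obtain n c where *: "\<And>i. c i \<in> polys U" "f = (\<Sum>i<n. c i * Var x ^ i)" by blast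
  show ?case
  proof (cases "v = x")
    case True
    have "Var v * f = (\<Sum>i<Suc n. (case i of 0 \<Rightarrow> 0 | Suc j \<Rightarrow> c j) * Var x ^ i)"
      unfolding sum.lessThan_Suc_shift by (simp add: *(2) True sum_distrib_left algebra_simps)
    moreover have "\<forall>i. (case i of 0 \<Rightarrow> 0 | Suc j \<Rightarrow> c j) \<in> polys U"
      using *(1) subring_zero[OF polys_subring] by (simp split: nat.splits)
    ultimately show ?thesis by blast
  next
    case False
    then have "v \<in> U" using Var by auto
    then have "\<forall>i. Var v * c i \<in> polys U" using *(1) by (intro allI polys_mult Var_in_polys)
    moreover have "Var v * f = (\<Sum>i<n. Var v * c i * Var x ^ i)"
      by (simp add: *(2) sum_distrib_left mult.assoc)
    ultimately show ?thesis by (intro exI conjI)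
  qed
qed

section \<open>Zariski density, tested by polynomial values over an infinite field\<close>

lemma ex_nonroot:
  fixes F :: "'k::idom poly"
  assumes "infinite (UNIV :: 'k set)" "F \<noteq> 0"
  shows "\<exists>t. poly F t \<noteq> 0"
  using poly_roots_finite[OF assms(2)] assms(1) by (metis (mono_tags, lifting) UNIV_eq_I mem_Collect_eq)

lemma ev_line:
  "\<exists>F. \<forall>t. poly F t = ev (\<lambda>v. p v + t * (q v - p v)) f"
proof -
  have "f \<in> polys UNIV" by (simp add: in_polys)
  then show ?thesis
  proof (induction rule: polys_induct)
    case (const c)
    show ?case by (intro exI[of _ "[:c:]"]) simp
  next
    case (add f g)
    then obtain F G where "\<forall>t. poly F t = ev (\<lambda>v. p v + t * (q v - p v)) f"
      "\<forall>t. poly G t = ev (\<lambda>v. p v + t * (q v - p v)) g" by blast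
    then show ?case by (intro exI[of _ "F + G"]) simp
  next
    case (Var v f)
    then obtain F where "\<forall>t. poly F t = ev (\<lambda>v. p v + t * (q v - p v)) f" by blast
    then show ?case by (intro exI[of _ "[:p v, q v - p v:] * F"]) (simp add: algebra_simps)
  qed
qed

text \<open>Irreducibility of an affine subspace: on the line through p and q, f is nonzero at t = 0
  and g at t = 1, so both restrict to nonzero polynomials in t, and their product has a nonzero
  value over an infinite field.\<close>

lemma nonvanishing_mult_on_affine:
  fixes f g :: "('v \<Rightarrow>\<^sub>0 nat) \<Rightarrow>\<^sub>0 'k::field"
  assumes "infinite (UNIV :: 'k set)"
    and L: "\<And>p q t. p \<in> L \<Longrightarrow> q \<in> L \<Longrightarrow> (\<lambda>v. p v + t * (q v - p v)) \<in> L"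
    and "p \<in> L" "ev p f \<noteq> 0" "q \<in> L" "ev q g \<noteq> 0"
  shows "\<exists>r\<in>L. ev r (f * g) \<noteq> 0"
proof -
  obtain F G where FG: "\<And>t. poly F t = ev (\<lambda>v. p v + t * (q v - p v)) f"
    "\<And>t. poly G t = ev (\<lambda>v. p v + t * (q v - p v)) g" using ev_line[of p q f] ev_line[of p q g] by blast
  have "poly F 0 \<noteq> 0" "poly G 1 \<noteq> 0" using assms by (simp_all add: FG)
  then have "F * G \<noteq> 0" by auto
  then obtain t where "poly (F * G) t \<noteq> 0" using ex_nonroot assms(1) by blast
  then show ?thesis using L assms(3,5) by (auto simp: FG)
qed

text \<open>This is density of the projection of Z to the coordinates in U. The projection is not
  formed, since a polynomial in \<open>polys U\<close> reads only those coordinates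
  (\<open>ev_cong\<close>).\<close>

definition zariski_dense :: "'v set \<Rightarrow> ('v \<Rightarrow> 'k::comm_ring_1) set \<Rightarrow> bool" where
  "zariski_dense U Z \<longleftrightarrow> (\<forall>f\<in>polys U. (\<forall>p\<in>Z. ev p f = 0) \<longrightarrow> f = 0)"

lemma zariski_dense_empty: "Z \<noteq> {} \<Longrightarrow> zariski_dense {} Z"
  using polys_empty unfolding zariski_dense_def by (metis Const_zero all_not_in_conv ev_Const)

lemma zariski_dense_transfer:
  assumes "zariski_dense U Z" "\<And>p. p \<in> Z \<Longrightarrow> \<exists>q\<in>Y. \<forall>u\<in>U. q u = p u"
  shows "zariski_dense U Y"
  unfolding zariski_dense_def
proof (intro ballI impI)
  fix f :: "('a \<Rightarrow>\<^sub>0 nat) \<Rightarrow>\<^sub>0 'b" assume f: "f \<in> polys U" "\<forall>p\<in>Y. ev p f = 0"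
  have "ev p f = 0" if p: "p \<in> Z" for p
  proof -
    obtain q where "q \<in> Y" "\<forall>u\<in>U. q u = p u" using assms(2)[OF p] by blast
    then show ?thesis using f ev_cong[OF f(1), of p q] by simp
  qed
  then show "f = 0" using assms(1) f(1) by (auto simp: zariski_dense_def)
qed

text \<open>Over a fixed p, f becomes a polynomial in the coordinate x alone with every field
  element as a root. So all its coefficients vanish at p, and density over U applies to each of
  them.\<close>

lemma zariski_dense_insert:
  fixes Z :: "('v \<Rightarrow> 'k::field) set"
  assumes inf: "infinite (UNIV :: 'k set)" and U: "zariski_dense U Z" "x \<notin> U"
    and Z: "\<And>p c. p \<in> Z \<Longrightarrow> p(x := c) \<in> Z"
  shows "zariski_dense (insert x U) Z"
  unfolding zariski_dense_def
proof (intro ballI impI)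
  fix f :: "('v \<Rightarrow>\<^sub>0 nat) \<Rightarrow>\<^sub>0 'k" assume f: "f \<in> polys (insert x U)" "\<forall>p\<in>Z. ev p f = 0"
  obtain n c where c: "\<And>i. c i \<in> polys U" "f = (\<Sum>i<n. c i * Var x ^ i)" using polys_insert[OF f(1)] by blast
  have "ev p (c i) = 0" if p: "p \<in> Z" and i: "i < n" for p i
  proof -
    let ?F = "\<Sum>i<n. Polynomial.monom (ev p (c i)) i"
    have "poly ?F t = 0" for t
    proof -
      have "poly ?F t = (\<Sum>i<n. ev p (c i) * t ^ i)" by (simp add: poly_sum poly_monom)
      also have "\<dots> = (\<Sum>i<n. ev (p(x := t)) (c i) * t ^ i)"
      proof (rule sum.cong)
        fix i
        have "ev p (c i) = ev (p(x := t)) (c i)" using U(2) by (intro ev_cong[OF c(1)]) auto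
        then show "ev p (c i) * t ^ i = ev (p(x := t)) (c i) * t ^ i" by simp
      qed simp
      also have "\<dots> = ev (p(x := t)) f" by (simp add: c(2) del: One_nat_def)
      finally show ?thesis using f(2) Z[OF p] by simp
    qed
    then have "?F = 0" using ex_nonroot[OF inf] by blast
    then have "Polynomial.coeff ?F i = 0" by simp
    then show ?thesis using i by (simp add: coeff_sum if_distrib cong: if_cong)
  qed
  then have "c i = 0" if "i < n" for i using U(1) c(1) that by (auto simp: zariski_dense_def)
  then show "f = 0" by (simp add: c(2))
qed

lemma zariski_dense_extend:
  fixes Z :: "('v \<Rightarrow> 'k::field) set"
  assumes inf: "infinite (UNIV :: 'k set)" and U: "zariski_dense U Z" "finite W" "W \<inter> U = {}"
    and Y: "\<And>p w. p \<in> Z \<Longrightarrow> \<exists>q\<in>Y. (\<forall>u\<in>U. q u = p u) \<and> (\<forall>v\<in>W. q v = w v)"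
  shows "zariski_dense (U \<union> W) Y"
proof -
  \<comment> \<open>The cylinder over the projection of Z to U. It is stable under changing any
    coordinate outside U, as \<open>zariski_dense_insert\<close> requires; this is not assumed of
    Z.\<close>
  define T where "T = {q. \<exists>p\<in>Z. \<forall>u\<in>U. q u = p u}"
  have "zariski_dense (U \<union> W) T"
    using U(2,3)
  proof (induction W rule: finite_induct)
    case empty
    show ?case using zariski_dense_transfer[OF U(1), of T] by (force simp: T_def)
  next
    case (insert x W)
    then have "zariski_dense (U \<union> W) T" "x \<notin> U" by auto
    then have "zariski_dense (insert x (U \<union> W)) T"
      using insert.hyps by (intro zariski_dense_insert[OF inf]) (auto simp: T_def)
    then show ?case by simp
  qed
  then show ?thesis
  proof (rule zariski_dense_transfer)
    fix q assume "q \<in> T"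
    then obtain p where p: "p \<in> Z" "\<forall>u\<in>U. q u = p u" by (auto simp: T_def)
    obtain q' where "q' \<in> Y" "\<forall>u\<in>U. q' u = p u" "\<forall>v\<in>W. q' v = q v"
      using Y[OF p(1), of q] by blast
    then show "\<exists>q'\<in>Y. \<forall>u\<in>U \<union> W. q' u = q u" using p(2) by (intro bexI[of _ q']) auto
  qed
qed

lemma zariski_dense_UNIV:
  assumes "infinite (UNIV :: 'k::field set)" "finite U"
  shows "zariski_dense U (UNIV :: ('v \<Rightarrow> 'k) set)"
proof -
  have "zariski_dense ({} \<union> U) (UNIV :: ('v \<Rightarrow> 'k) set)"
    by (rule zariski_dense_extend[OF assms(1) zariski_dense_empty assms(2)]) auto
  then show ?thesis by simp
qed

text \<open>Each nonzero polynomial has a nonzero value somewhere, and on the line through two such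
  points both polynomials are nonzero at a common point.\<close>

lemma zero_prime:
  assumes inf: "infinite (UNIV :: 'k::field set)" and "finite U"
  shows "is_prime (polys U) {0 :: ('v \<Rightarrow>\<^sub>0 nat) \<Rightarrow>\<^sub>0 'k}"
proof -
  have "f = 0 \<or> g = 0" if fg: "f \<in> polys U" "g \<in> polys U" "f * g = 0" for f g :: "('v \<Rightarrow>\<^sub>0 nat) \<Rightarrow>\<^sub>0 'k"
  proof (rule ccontr)
    assume "\<not> (f = 0 \<or> g = 0)"
    moreover have "\<exists>p. ev p h \<noteq> 0" if "h \<in> polys U" "h \<noteq> 0" for h :: "('v \<Rightarrow>\<^sub>0 nat) \<Rightarrow>\<^sub>0 'k"
      using zariski_dense_UNIV[OF assms] that unfolding zariski_dense_def by auto
    ultimately obtain p q where "ev p f \<noteq> 0" "ev q g \<noteq> 0" using fg by metis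
    then show False using nonvanishing_mult_on_affine[OF inf, of UNIV p f q g] fg by auto
  qed
  then have "\<forall>f\<in>polys U. \<forall>g\<in>polys U. f * g \<in> {0} \<longrightarrow> f \<in> {0} \<or> g \<in> {0 :: ('v \<Rightarrow>\<^sub>0 nat) \<Rightarrow>\<^sub>0 'k}" by blast
  moreover have "is_ideal (polys U) {0 :: ('v \<Rightarrow>\<^sub>0 nat) \<Rightarrow>\<^sub>0 'k}"
    using subring_zero[OF polys_subring] by (simp add: is_ideal_def)
  ultimately show ?thesis by (simp add: is_prime_def)
qed

section \<open>Dimension of a polynomial ideal\<close>

lemma combinations_mono: "P \<subseteq> Q \<Longrightarrow> combinations P F D \<subseteq> combinations Q F D"
  unfolding combinations_def by blast

lemma finite_over_mono: "P \<subseteq> Q \<Longrightarrow> finite_over C D P s F \<Longrightarrow> finite_over C D Q s F"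
  unfolding finite_over_def by (meson combinations_mono subsetD)

lemma is_subring_pair:
  assumes "U \<subseteq> V" "is_prime (polys V) P"
  shows "subring_pair (polys V) (polys U) P"
  using assms polys_mono[OF assms(1)] polys_subring by unfold_locales auto

text \<open>For a prime \<open>P\<close>, \<open>maximal_independent V P U\<close> says that \<open>U\<close> is a transcendence basis of the
  fraction field of \<open>K[V]/P\<close>.\<close>

definition maximal_independent ::
    "'v set \<Rightarrow> (('v \<Rightarrow>\<^sub>0 nat) \<Rightarrow>\<^sub>0 'k::comm_ring_1) set \<Rightarrow> 'v set \<Rightarrow> bool" where
  "maximal_independent V P U \<longleftrightarrow> U \<subseteq> V \<and> P \<inter> polys U = {0} \<and>
     (\<forall>x\<in>V - U. P \<inter> polys (insert x U) \<noteq> {0})"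

lemma ex_maximal_independent:
  assumes "finite V" "U \<subseteq> V" "P \<inter> polys U = {0}"
  shows "\<exists>U'. U \<subseteq> U' \<and> maximal_independent V P U'"
proof -
  let ?\<U> = "{U'. U \<subseteq> U' \<and> U' \<subseteq> V \<and> P \<inter> polys U' = {0}}"
  have "finite ?\<U>" using assms(1) by (rule finite_subset[rotated, OF finite_Pow_iff[THEN iffD2]]) auto
  moreover have "U \<in> ?\<U>" using assms by auto
  ultimately obtain W where W: "W \<in> ?\<U>" "\<And>Y. Y \<in> ?\<U> \<Longrightarrow> W \<subseteq> Y \<Longrightarrow> W = Y"
    using finite_has_maximal[of ?\<U>] by (metis (lifting) empty_iff)
  have "maximal_independent V P W"
    unfolding maximal_independent_def
  proof (intro conjI ballI notI)
    fix x assume x: "x \<in> V - W" "P \<inter> polys (insert x W) = {0}"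
    then have "insert x W \<in> ?\<U>" using W(1) by auto
    then show False using W(2)[of "insert x W"] x by auto
  qed (use W in auto)
  then show ?thesis using W(1) by blast
qed

lemma ex_algebraic_relation:
  assumes "P \<inter> polys U = {0}" "P \<inter> polys (insert x U) \<noteq> {0}" "0 \<in> P"
  shows "\<exists>e>0. \<exists>c. (\<forall>i. c i \<in> polys U) \<and> c e \<noteq> 0 \<and> (\<Sum>i\<le>e. c i * Var x ^ i) \<in> P"
proof -
  obtain f where f: "f \<in> P" "f \<in> polys (insert x U)" "f \<noteq> 0"
    using assms(2,3) subring_zero[OF polys_subring, of "insert x U"] by blast
  \<comment> \<open>Writing f with the least possible number n of coefficients makes the leading one
    nonzero. The degree e = n - 1 is positive, as otherwise f would lie in \<open>polys U\<close>,
    where P contains only 0.\<close>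
  define Q where "Q n \<longleftrightarrow> (\<exists>c. (\<forall>i. c i \<in> polys U) \<and> f = (\<Sum>i<n. c i * Var x ^ i))" for n
  define n where "n = (LEAST n. Q n)"
  have "\<exists>n. Q n" using polys_insert[OF f(2)] by (auto simp: Q_def)
  then have "Q n" unfolding n_def by (rule LeastI_ex)
  then obtain c where c: "\<And>i. c i \<in> polys U" "f = (\<Sum>i<n. c i * Var x ^ i)" by (auto simp: Q_def)
  have "n \<noteq> 0" using f(3) c(2) by (intro notI) simp
  then obtain e where e: "n = Suc e" using not0_implies_Suc by blast
  have "c e \<noteq> 0"
  proof
    assume "c e = 0"
    then have "Q e" using c by (auto simp: Q_def e)
    then show False using Least_le[of Q e] e by (simp add: n_def)
  qed
  moreover have "e > 0"
  proof (rule ccontr)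
    assume "\<not> e > 0"
    then have "f = c 0" using c(2) e by simp
    then show False using f assms(1) c(1)[of 0] by blast
  qed
  ultimately show ?thesis using c f(1) e by (auto simp: lessThan_Suc_atMost)
qed

context
  fixes V :: "'v set"
  assumes inf: "infinite (UNIV :: 'k::field set)" and V: "finite V"
begin

text \<open>By maximality of U each remaining variable is algebraic over K[U] modulo P. With s the
  product of the leading coefficients, each relation is multiplied by the leading coefficients of
  the others, so that inverting s makes all variables integral at once. The relations are part of
  the conclusion because the search for zeros in \<open>ex_zero_of_prime\<close> solves
  them.\<close>

lemma ex_finite_over:
  fixes P :: "(('v \<Rightarrow>\<^sub>0 nat) \<Rightarrow>\<^sub>0 'k) set"
  assumes P: "is_prime (polys V) P" and U: "maximal_independent V P U"
  shows "\<exists>s\<in>polys U. s \<noteq> 0 \<and>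
    (\<forall>x\<in>V - U. \<exists>e c. e > 0 \<and> (\<forall>i<e. c i \<in> polys U) \<and> s * Var x ^ e - (\<Sum>i<e. c i * Var x ^ i) \<in> P) \<and>
    (\<exists>F. finite F \<and> F \<subseteq> polys V \<and> 1 \<in> F \<and> finite_over (polys V) (polys U) P s F)"
proof -
  have UV: "U \<subseteq> V" and PU: "P \<inter> polys U = {0}" using U by (auto simp: maximal_independent_def)
  interpret subring_pair "polys V" "polys U" P by (rule is_subring_pair[OF UV P])
  have "0 \<in> P" using ideal_zero[OF C Pi] .
  then have "\<forall>x\<in>V - U. \<exists>e c. e > 0 \<and> (\<forall>i. c i \<in> polys U) \<and> c e \<noteq> 0 \<and> (\<Sum>i\<le>e. c i * Var x ^ i) \<in> P"
    using U ex_algebraic_relation[OF PU] unfolding maximal_independent_def by meson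
  from bchoice[OF this] obtain e where
    "\<forall>x\<in>V - U. \<exists>c. e x > (0::nat) \<and> (\<forall>i. c i \<in> polys U) \<and> c (e x) \<noteq> 0 \<and> (\<Sum>i\<le>e x. c i * Var x ^ i) \<in> P"
    by blast
  from bchoice[OF this] obtain c where
    "\<forall>x\<in>V - U. e x > 0 \<and> (\<forall>i. c x i \<in> polys U) \<and> c x (e x) \<noteq> 0 \<and> (\<Sum>i\<le>e x. c x i * Var x ^ i) \<in> P"
    by blast
  then have ec: "\<And>x. x \<in> V - U \<Longrightarrow> e x > 0" "\<And>x i. x \<in> V - U \<Longrightarrow> c x i \<in> polys U"
    "\<And>x. x \<in> V - U \<Longrightarrow> c x (e x) \<noteq> 0" "\<And>x. x \<in> V - U \<Longrightarrow> (\<Sum>i\<le>e x. c x i * Var x ^ i) \<in> P"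
    by simp_all
  define s where "s = (\<Prod>x\<in>V - U. c x (e x))"
  have s: "s \<in> polys U" unfolding s_def using ec by (intro subring_prod[OF D]) auto
  have "s \<noteq> 0"
    using prime_prod[OF D zero_prime[OF inf finite_subset[OF UV V]], of "V - U" "\<lambda>x. c x (e x)"] ec
    by (auto simp: s_def)
  have fin: "finite (V - U)" using V by simp
  have rel: "\<exists>e c. e > 0 \<and> (\<forall>i<e. c i \<in> polys U) \<and> s * Var x ^ e - (\<Sum>i<e. c i * Var x ^ i) \<in> P"
    if x: "x \<in> V - U" for x
  proof -
    define t where "t = (\<Prod>y\<in>V - U - {x}. c y (e y))"
    have t: "t \<in> polys U" unfolding t_def using ec by (intro subring_prod[OF D]) auto
    have st: "s = t * c x (e x)" unfolding s_def t_def using prod.remove[OF fin x] by (simp add: mult.commute)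
    have "t * (\<Sum>i\<le>e x. c x i * Var x ^ i) \<in> P"
      using ec(4)[OF x] t DC by (intro ideal_mult_left[OF C Pi]) auto
    also have "t * (\<Sum>i\<le>e x. c x i * Var x ^ i) = s * Var x ^ e x - (\<Sum>i<e x. (- (t * c x i)) * Var x ^ i)"
      unfolding lessThan_Suc_atMost[symmetric]
      by (simp add: st sum_distrib_left sum_negf algebra_simps)
    finally show ?thesis
      using ec(1,2)[OF x] t
      by (intro exI[of _ "e x"] exI[of _ "\<lambda>i. - (t * c x i)"]) (auto intro!: subring_uminus[OF D] subring_mult[OF D])
  qed
  have "\<exists>F. finite F \<and> F \<subseteq> polys V \<and> 1 \<in> F \<and> (\<forall>x\<in>Var ` (V - U). \<forall>f\<in>F. s * x * f \<in> combinations P F (polys U))"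
    using rel fin Var_in_polys s by (intro ex_spanning_set) auto
  then obtain F where F: "finite F" "F \<subseteq> polys V" "1 \<in> F"
    "\<And>x f. x \<in> Var ` (V - U) \<Longrightarrow> f \<in> F \<Longrightarrow> s * x * f \<in> combinations P F (polys U)" by blast
  have "finite_over (polys V) (polys U) P s F"
  proof (rule finite_over_generated[OF s F(1) _ _ F(4)])
    fix N :: "(('v \<Rightarrow>\<^sub>0 nat) \<Rightarrow>\<^sub>0 'k) set"
    assume N: "polys U \<subseteq> N" "Var ` (V - U) \<subseteq> N" "\<And>x y. x \<in> N \<Longrightarrow> y \<in> N \<Longrightarrow> x + y \<in> N"
      "\<And>x y. x \<in> N \<Longrightarrow> y \<in> N \<Longrightarrow> x * y \<in> N"
    have "Var v \<in> N" if "v \<in> V" for v using N(1,2) that Var_in_polys[of v U] by (cases "v \<in> U") auto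
    moreover have "Const c \<in> N" for c using N(1) Const_in_polys[of c U] by blast
    ultimately show "polys V \<subseteq> N" using N(3,4) by (intro polys_subset)
  next
    show "Var ` (V - U) \<subseteq> polys V" using Var_in_polys by auto
  qed
  then show ?thesis using s \<open>s \<noteq> 0\<close> F(1-3) rel by (intro bexI[of _ s] conjI ballI exI[of _ F])
qed

lemma nonvanishing_mult_in_polys:
  fixes f g :: "('v \<Rightarrow>\<^sub>0 nat) \<Rightarrow>\<^sub>0 'k"
  assumes "U \<subseteq> V" "f \<in> polys U" "f \<noteq> 0" "g \<in> polys U" "g \<noteq> 0"
  shows "\<exists>p. ev p f \<noteq> 0 \<and> ev p g \<noteq> 0"
proof -
  have "f * g \<noteq> 0" "f * g \<in> polys U"
    using zero_prime[OF inf finite_subset[OF assms(1) V]] assms by (auto simp: is_prime_def polys_mult)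
  then obtain p where "ev p (f * g) \<noteq> 0"
    using zariski_dense_UNIV[OF inf finite_subset[OF assms(1) V]] unfolding zariski_dense_def by blast
  then show ?thesis by auto
qed

text \<open>The chain lies over a flag of affine subspaces of the affine space with coordinates in \<open>U\<close>,
  through a point \<open>c\<close> with \<open>s c \<noteq> 0\<close>.\<close>

lemma ex_prime_chain:
  fixes P :: "(('v \<Rightarrow>\<^sub>0 nat) \<Rightarrow>\<^sub>0 'k) set"
  assumes P: "is_prime (polys V) P" and U: "maximal_independent V P U"
  shows "\<exists>Q. (\<forall>i\<le>card U. is_prime (polys V) (Q i) \<and> P \<subseteq> Q i) \<and> (\<forall>i<card U. Q i \<subset> Q (Suc i))"
proof -
  have UV: "U \<subseteq> V" and PU: "P \<inter> polys U = {0}" using U by (auto simp: maximal_independent_def)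
  have fU: "finite U" using UV V finite_subset by blast
  obtain s F where s: "s \<in> polys U" "s \<noteq> 0"
    and F: "finite F" "F \<subseteq> polys V" "1 \<in> F" "finite_over (polys V) (polys U) P s F"
    using ex_finite_over[OF P U] by blast
  obtain c where c: "ev c s \<noteq> 0" using nonvanishing_mult_in_polys[OF UV s s] by blast
  obtain y where y: "bij_betw y {..<card U} U"
    using ex_bij_betw_nat_finite[OF fU] by (auto simp: atLeast0LessThan)
  \<comment> \<open>\<open>L j\<close> has codimension j in the U-space and contains c, which keeps
    s outside its ideal \<open>q j\<close>. As \<open>L 0\<close> is everything, the ideals start
    with q 0 = {0}.\<close>
  define L where "L j = {p. \<forall>i<j. p (y i) = c (y i)}" for j
  define q where "q j = {g\<in>polys U. \<forall>p\<in>L j. ev p g = 0}" for j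
  have L: "(\<lambda>v. p v + t * (r v - p v)) \<in> L j" if "p \<in> L j" "r \<in> L j" for p r t j
    using that by (auto simp: L_def)
  have qp: "is_prime (polys U) (q j)" for j
    unfolding is_prime_def
  proof (intro conjI ballI impI)
    show "is_ideal (polys U) (q j)"
      using subring_zero[OF polys_subring] by (auto simp: is_ideal_def q_def polys_add polys_mult)
    have "c \<in> L j" by (simp add: L_def)
    then show "1 \<notin> q j" by (auto simp: q_def)
    fix f g assume fg: "f \<in> polys U" "g \<in> polys U" "f * g \<in> q j"
    show "f \<in> q j \<or> g \<in> q j"
    proof (rule ccontr)
      assume "\<not> (f \<in> q j \<or> g \<in> q j)"
      then obtain p r where "p \<in> L j" "ev p f \<noteq> 0" "r \<in> L j" "ev r g \<noteq> 0" using fg by (auto simp: q_def)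
      then obtain z where "z \<in> L j" "ev z (f * g) \<noteq> 0"
        using nonvanishing_mult_on_affine[where L = "L j", OF inf L] by blast
      then show False using fg by (auto simp: q_def)
    qed
  qed
  have sq: "s \<notin> q j" for j
  proof -
    have "c \<in> L j" by (simp add: L_def)
    then show ?thesis using c by (auto simp: q_def)
  qed
  have qsub: "q j \<subset> q (Suc j)" if j: "j < card U" for j
  proof
    show "q j \<subseteq> q (Suc j)" by (auto simp: q_def L_def)
    have yU: "y j \<in> U" using y j by (auto simp: bij_betw_def)
    \<comment> \<open>Moving c along the coordinate y j stays in L j but leaves L (Suc j), which
      separates the two ideals.\<close>
    let ?p = "c(y j := c (y j) + 1)"
    have "y i \<noteq> y j" if "i < j" for i
      using y j that by (auto simp: bij_betw_def inj_on_def)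
    then have "?p \<in> L j" by (simp add: L_def)
    then have "Var (y j) - Const (c (y j)) \<notin> q j" by (auto simp: q_def intro!: bexI[of _ ?p])
    moreover have "Var (y j) - Const (c (y j)) \<in> q (Suc j)"
      by (auto simp: q_def L_def intro!: polys_diff Var_in_polys yU Const_in_polys)
    ultimately show "q j \<noteq> q (Suc j)" by blast
  qed
  \<comment> \<open>Each new prime is obtained by going up from Q m rather than from P, which keeps
    the chain increasing; the traces q i on K[U] show afterwards that it is strict.\<close>
  have "\<exists>Q. (\<forall>i\<le>m. is_prime (polys V) (Q i) \<and> P \<subseteq> Q i \<and> Q i \<inter> polys U = q i) \<and> (\<forall>i<m. Q i \<subseteq> Q (Suc i))"
    if "m \<le> card U" for m
    using that
  proof (induction m)
    case 0
    have "q 0 = {0}"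
      using zariski_dense_UNIV[OF inf fU] subring_zero[OF polys_subring]
      by (auto simp: q_def L_def zariski_dense_def)
    then show ?case using P PU by (intro exI[of _ "\<lambda>_. P"]) auto
  next
    case (Suc m)
    then obtain Q where Q: "\<And>i. i \<le> m \<Longrightarrow> is_prime (polys V) (Q i) \<and> P \<subseteq> Q i \<and> Q i \<inter> polys U = q i"
      "\<And>i. i < m \<Longrightarrow> Q i \<subseteq> Q (Suc i)" by auto
    interpret subring_pair "polys V" "polys U" "Q m" using is_subring_pair[OF UV] Q by blast
    have "Q m \<inter> polys U \<subseteq> q (Suc m)" using qsub[of m] Q(1)[of m] Suc.prems by auto
    moreover have "finite_over (polys V) (polys U) (Q m) s F" using finite_over_mono[OF _ F(4)] Q(1)[of m] by blast
    ultimately obtain R where R: "is_prime (polys V) R" "Q m \<subseteq> R" "R \<inter> polys U = q (Suc m)"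
      using going_up[OF qp _ s(1) sq F(1-3)] by blast
    have "P \<subseteq> R" using R(2) Q(1)[of m] by blast
    then have "(\<forall>i\<le>Suc m. is_prime (polys V) ((Q(Suc m := R)) i) \<and> P \<subseteq> (Q(Suc m := R)) i \<and> (Q(Suc m := R)) i \<inter> polys U = q i)"
      using Q(1) R by (simp add: le_Suc_eq)
    moreover have "\<forall>i<Suc m. (Q(Suc m := R)) i \<subseteq> (Q(Suc m := R)) (Suc i)"
      using Q R by (auto simp: less_Suc_eq)
    ultimately show ?case by blast
  qed
  then obtain Q where Q: "\<And>i. i \<le> card U \<Longrightarrow> is_prime (polys V) (Q i) \<and> P \<subseteq> Q i \<and> Q i \<inter> polys U = q i"
    "\<And>i. i < card U \<Longrightarrow> Q i \<subseteq> Q (Suc i)" by blast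
  have "Q i \<subset> Q (Suc i)" if "i < card U" for i
    using Q(2)[OF that] Q(1)[of i] Q(1)[of "Suc i"] qsub[OF that] that by auto
  then show ?thesis using Q by (intro exI[of _ Q]) auto
qed

text \<open>Induction with the first prime removed gives U independent modulo Q 1 with at least n
  elements. Were U maximal for Q 0, an element of Q 1 outside Q 0 would divide a nonzero element of
  K[U] modulo Q 0, and the latter would lie in Q 1. So U can be enlarged by a variable for Q
  0.\<close>

lemma chain_imp_independent:
  fixes Q :: "nat \<Rightarrow> (('v \<Rightarrow>\<^sub>0 nat) \<Rightarrow>\<^sub>0 'k) set"
  assumes "\<And>i. i \<le> n \<Longrightarrow> is_prime (polys V) (Q i)" "\<And>i. i < n \<Longrightarrow> Q i \<subset> Q (Suc i)"
  shows "\<exists>U\<subseteq>V. n \<le> card U \<and> Q 0 \<inter> polys U = {0}"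
  using assms
proof (induction n arbitrary: Q)
  case 0
  have Q0: "is_prime (polys V) (Q 0)" using 0 by simp
  have "Q 0 \<inter> polys {} = {0}"
  proof (intro equalityI subsetI)
    fix f assume f: "f \<in> Q 0 \<inter> polys {}"
    then obtain c where c: "f = Const c" using polys_empty by blast
    have "c = 0"
    proof (rule ccontr)
      assume "c \<noteq> 0"
      then have "Const (inverse c) * f = 1" by (simp add: c Const_mult[symmetric] Const_one)
      moreover have "Const (inverse c) * f \<in> Q 0"
        using f Q0 Const_in_polys[of "inverse c" V] by (auto simp: is_prime_def is_ideal_def)
      ultimately show False using Q0 by (simp add: is_prime_def)
    qed
    then show "f \<in> {0}" by (simp add: c Const_zero)
  qed (use Q0 subring_zero[OF polys_subring] in \<open>auto simp: is_prime_def is_ideal_def\<close>)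
  then show ?case by (intro exI[of _ "{}"]) auto
next
  case (Suc n)
  have "\<exists>U\<subseteq>V. n \<le> card U \<and> Q (Suc 0) \<inter> polys U = {0}"
    using Suc.IH[of "\<lambda>i. Q (Suc i)"] Suc.prems by simp
  then obtain U where U: "U \<subseteq> V" "n \<le> card U" "Q (Suc 0) \<inter> polys U = {0}" by blast
  have Q0: "is_prime (polys V) (Q 0)" and Q01: "Q 0 \<subset> Q (Suc 0)" and Q1: "is_prime (polys V) (Q (Suc 0))"
    using Suc.prems by auto
  interpret subring_pair "polys V" "polys U" "Q 0" by (rule is_subring_pair[OF U(1) Q0])
  have QU: "Q 0 \<inter> polys U = {0}" using U(3) Q01 ideal_zero[OF C Pi] subring_zero[OF D] by auto
  have "\<not> maximal_independent V (Q 0) U"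
  proof
    assume "maximal_independent V (Q 0) U"
    then obtain s F where s: "s \<in> polys U" "s \<noteq> 0"
      and F: "finite F" "F \<subseteq> polys V" "1 \<in> F" "finite_over (polys V) (polys U) (Q 0) s F"
      using ex_finite_over[OF Q0] by blast
    obtain z where z: "z \<in> Q (Suc 0)" "z \<notin> Q 0" using Q01 by blast
    have Q1i: "is_ideal (polys V) (Q (Suc 0))" using Q1 by (simp add: is_prime_def)
    have zV: "z \<in> polys V" using z ideal_subset[OF C Q1i] by blast
    obtain d w where dw: "d \<in> polys U - {0}" "w \<in> polys V" "d + z * w \<in> Q 0"
      using ex_constant_in_ideal[OF QU s F zV z(2)] by blast
    have "d + z * w - z * w \<in> Q (Suc 0)"
      using dw z Q01 by (intro ideal_diff[OF C Q1i] ideal_mult_right[OF C Q1i]) auto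
    then show False using U(3) dw(1) by auto
  qed
  then obtain x where x: "x \<in> V - U" "Q 0 \<inter> polys (insert x U) = {0}"
    using U(1) QU by (auto simp: maximal_independent_def)
  have "card (insert x U) = Suc (card U)" using x finite_subset[OF U(1) V] by simp
  then show ?case using x U by (intro exI[of _ "insert x U"]) auto
qed

text \<open>The nonzero elements of K[U] are multiplicatively closed and miss I, so some prime over
  I avoids them. For this prime U is still independent and is enlarged to a maximal set.\<close>

lemma ex_prime_of_independent:
  fixes I :: "(('v \<Rightarrow>\<^sub>0 nat) \<Rightarrow>\<^sub>0 'k) set"
  assumes I: "is_ideal (polys V) I" and U: "U \<subseteq> V" "I \<inter> polys U = {0}"
  shows "\<exists>P U'. is_prime (polys V) P \<and> I \<subseteq> P \<and> U \<subseteq> U' \<and> maximal_independent V P U'"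
proof -
  have z: "is_prime (polys U) {0 :: ('v \<Rightarrow>\<^sub>0 nat) \<Rightarrow>\<^sub>0 'k}"
    by (rule zero_prime[OF inf finite_subset[OF U(1) V]])
  let ?S = "polys U - {0} :: (('v \<Rightarrow>\<^sub>0 nat) \<Rightarrow>\<^sub>0 'k) set"
  have "\<exists>P. is_prime (polys V) P \<and> I \<subseteq> P \<and> P \<inter> ?S = {}"
  proof (rule ex_prime_avoiding[OF polys_subring I])
    show "?S \<subseteq> polys V" using polys_mono[OF U(1)] by blast
    show "1 \<in> ?S" using subring_one[OF polys_subring, of U] by simp
    show "I \<inter> ?S = {}" using U(2) by blast
    fix f g assume "f \<in> ?S" "g \<in> ?S"
    then show "f * g \<in> ?S" using z polys_mult[of f U g] unfolding is_prime_def by blast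
  qed
  then obtain P where P: "is_prime (polys V) P" "I \<subseteq> P" "P \<inter> ?S = {}" by blast
  moreover have "0 \<in> P" "0 \<in> polys U"
    using P(1) subring_zero[OF polys_subring] by (simp_all add: is_prime_def is_ideal_def)
  ultimately have "P \<inter> polys U = {0}" by blast
  then show ?thesis using ex_maximal_independent[OF V U(1), of P] P by blast
qed

text \<open>A set independent for the first prime of a chain is independent for I as well; in the
  other direction I is first replaced by a prime that keeps U independent. If I is the whole ring,
  both sides are false even for n = 0.\<close>

theorem prime_chain_iff:
  fixes I :: "(('v \<Rightarrow>\<^sub>0 nat) \<Rightarrow>\<^sub>0 'k) set"
  assumes I: "is_ideal (polys V) I"
  shows "(\<exists>Q. (\<forall>i\<le>n. is_prime (polys V) (Q i) \<and> I \<subseteq> Q i) \<and> (\<forall>i<n. Q i \<subset> Q (Suc i))) \<longleftrightarrow>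
    (\<exists>U\<subseteq>V. n \<le> card U \<and> I \<inter> polys U = {0})"
proof
  assume "\<exists>Q. (\<forall>i\<le>n. is_prime (polys V) (Q i) \<and> I \<subseteq> Q i) \<and> (\<forall>i<n. Q i \<subset> Q (Suc i))"
  then obtain Q where Q: "\<And>i. i \<le> n \<Longrightarrow> is_prime (polys V) (Q i)" "\<And>i. i < n \<Longrightarrow> Q i \<subset> Q (Suc i)" "I \<subseteq> Q 0"
    by blast
  obtain U where "U \<subseteq> V" "n \<le> card U" "Q 0 \<inter> polys U = {0}" using chain_imp_independent[of n Q] Q by blast
  moreover have "I \<inter> polys U = {0}"
    using Q(3) calculation(3) ideal_zero[OF polys_subring I] subring_zero[OF polys_subring] by blast
  ultimately show "\<exists>U\<subseteq>V. n \<le> card U \<and> I \<inter> polys U = {0}" by blast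
next
  assume "\<exists>U\<subseteq>V. n \<le> card U \<and> I \<inter> polys U = {0}"
  then obtain U where U: "U \<subseteq> V" "n \<le> card U" "I \<inter> polys U = {0}" by blast
  obtain P U' where P: "is_prime (polys V) P" "I \<subseteq> P" "U \<subseteq> U'" "maximal_independent V P U'"
    using ex_prime_of_independent[OF I U(1,3)] by blast
  have "finite U'" using P(4) V finite_subset by (auto simp: maximal_independent_def)
  then have "n \<le> card U'" using U(2) card_mono[OF _ P(3)] by linarith
  moreover from ex_prime_chain[OF P(1,4)] obtain Q where
    Q: "\<forall>i\<le>card U'. is_prime (polys V) (Q i) \<and> P \<subseteq> Q i" "\<forall>i<card U'. Q i \<subset> Q (Suc i)" by blast
  ultimately have "\<forall>i\<le>n. is_prime (polys V) (Q i) \<and> I \<subseteq> Q i" "\<forall>i<n. Q i \<subset> Q (Suc i)"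
    using P(2) by (meson order_trans, meson less_le_trans)
  then show "\<exists>Q. (\<forall>i\<le>n. is_prime (polys V) (Q i) \<and> I \<subseteq> Q i) \<and> (\<forall>i<n. Q i \<subset> Q (Suc i))"
    by (intro exI[of _ Q] conjI)
qed

end

section \<open>Translation to the rings and quotients of HOL-Algebra\<close>

lemma ideal_imp_is_ideal:
  assumes "ideal I (mpoly_ring V)"
  shows "is_ideal (polys V) I"
proof -
  interpret ideal I "mpoly_ring V" by fact
  show ?thesis
    unfolding is_ideal_def
  proof (intro conjI ballI)
    show "I \<subseteq> polys V" by (rule a_subset)
    show "0 \<in> I" using additive_subgroup.zero_closed[OF is_additive_subgroup] by (simp add: mpoly_ring_def)
    show "x + y \<in> I" if "x \<in> I" "y \<in> I" for x y using additive_subgroup.a_closed[OF is_additive_subgroup that] by (simp add: mpoly_ring_def)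
    show "c * x \<in> I" if "c \<in> polys V" "x \<in> I" for c x
      using I_l_closed[OF that(2,1)] by (simp add: mpoly_ring_def)
  qed
qed

lemma cring_mpoly_ring: "cring (mpoly_ring V :: (('v \<Rightarrow>\<^sub>0 nat) \<Rightarrow>\<^sub>0 'k::comm_ring_1) ring)" (is "cring ?R")
proof (rule cringI)
  note [simp] = mpoly_ring_def
  show "abelian_group ?R"
  proof (rule abelian_groupI)
    fix x assume "x \<in> carrier ?R"
    then have "- x \<in> carrier ?R" "- x \<oplus>\<^bsub>?R\<^esub> x = \<zero>\<^bsub>?R\<^esub>"
      using subring_uminus[OF polys_subring] by auto
    then show "\<exists>y\<in>carrier ?R. y \<oplus>\<^bsub>?R\<^esub> x = \<zero>\<^bsub>?R\<^esub>" by blast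
  next
    show "\<zero>\<^bsub>?R\<^esub> \<in> carrier ?R" using subring_zero[OF polys_subring] by simp
    show "x \<oplus>\<^bsub>?R\<^esub> y \<in> carrier ?R" if "x \<in> carrier ?R" "y \<in> carrier ?R" for x y
      using polys_add[OF that] by simp
  qed (simp_all add: add_ac)
  show "comm_monoid ?R"
  proof (rule comm_monoidI)
    show "\<one>\<^bsub>?R\<^esub> \<in> carrier ?R" using subring_one[OF polys_subring] by simp
    show "x \<otimes>\<^bsub>?R\<^esub> y \<in> carrier ?R" if "x \<in> carrier ?R" "y \<in> carrier ?R" for x y
      using polys_mult[OF that] by simp
  qed (simp_all add: mult_ac)
qed (simp add: mpoly_ring_def algebra_simps)

lemma primeideal_iff_is_prime: "primeideal P (mpoly_ring V) \<longleftrightarrow> is_prime (polys V) P"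
  for P :: "(('v \<Rightarrow>\<^sub>0 nat) \<Rightarrow>\<^sub>0 'k::comm_ring_1) set"
proof
  assume "primeideal P (mpoly_ring V)"
  then interpret primeideal P "mpoly_ring V" .
  have "1 \<notin> P" using I_notcarr one_imp_carrier by (auto simp: mpoly_ring_def)
  moreover have "\<forall>x\<in>polys V. \<forall>y\<in>polys V. x * y \<in> P \<longrightarrow> x \<in> P \<or> y \<in> P"
    using I_prime by (auto simp: mpoly_ring_def)
  ultimately show "is_prime (polys V) P" using ideal_imp_is_ideal[OF ideal_axioms] by (simp add: is_prime_def)
next
  interpret cring "mpoly_ring V :: (('v \<Rightarrow>\<^sub>0 nat) \<Rightarrow>\<^sub>0 'k) ring" by (rule cring_mpoly_ring)
  assume P: "is_prime (polys V) P"
  then have Pi: "is_ideal (polys V) P" by (simp add: is_prime_def)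
  have uminus: "\<ominus>\<^bsub>mpoly_ring V\<^esub> x = - x" if "x \<in> polys V" for x :: "('v \<Rightarrow>\<^sub>0 nat) \<Rightarrow>\<^sub>0 'k"
    using that subring_uminus[OF polys_subring that] by (intro minus_equality) (auto simp: mpoly_ring_def)
  have I: "ideal P (mpoly_ring V)"
  proof (rule idealI[OF ring_axioms])
    show "subgroup P (add_monoid (mpoly_ring V))"
    proof (rule add.subgroupI)
      show "P \<subseteq> polys V" "P \<noteq> {}" using ideal_subset[OF polys_subring Pi] ideal_zero[OF polys_subring Pi] by auto
      show "\<ominus>\<^bsub>mpoly_ring V\<^esub> x \<in> P" if "x \<in> P" for x
        using uminus[of x] ideal_subset[OF polys_subring Pi] ideal_uminus[OF polys_subring Pi that] that by auto
      show "x \<oplus>\<^bsub>mpoly_ring V\<^esub> y \<in> P" if "x \<in> P" "y \<in> P" for x y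
        using ideal_add[OF polys_subring Pi that] by (simp add: mpoly_ring_def)
    qed
    show "x \<otimes>\<^bsub>mpoly_ring V\<^esub> a \<in> P" if "a \<in> P" "x \<in> polys V" for a x
      using ideal_mult_left[OF polys_subring Pi that(2,1)] by (simp add: mpoly_ring_def)
    show "a \<otimes>\<^bsub>mpoly_ring V\<^esub> x \<in> P" if "a \<in> P" "x \<in> polys V" for a x
      using ideal_mult_right[OF polys_subring Pi that(2,1)] by (simp add: mpoly_ring_def)
  qed
  show "primeideal P (mpoly_ring V)"
  proof (rule primeidealI[OF I cring_mpoly_ring])
    show "polys V \<noteq> P" using P subring_one[OF polys_subring, of V] by (auto simp: is_prime_def)
    show "x \<in> P \<or> y \<in> P" if "x \<in> polys V" "y \<in> polys V" "x \<otimes>\<^bsub>mpoly_ring V\<^esub> y \<in> P" for x y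
      using P that by (simp add: is_prime_def mpoly_ring_def)
  qed
qed

context cring
begin

lemma rcos_mem_image_iff:
  assumes I: "ideal I R" and J: "ideal J R" "I \<subseteq> J" and x: "x \<in> carrier R"
  shows "I +> x \<in> (+>) I ` J \<longleftrightarrow> x \<in> J"
proof
  assume "I +> x \<in> (+>) I ` J"
  then obtain z where z: "z \<in> J" "I +> x = I +> z" by blast
  have zc: "z \<in> carrier R" using z J(1) by (meson additive_subgroup.a_Hcarr ideal_def)
  have "x \<in> I +> z" 
  proof -
    have "\<zero> \<oplus> x \<in> I +> x"
      using additive_subgroup.zero_closed[OF ideal.axioms(1)[OF I]] by (auto simp: a_r_coset_def')
    then show ?thesis using x z(2) by simp
  qed
  then obtain i where i: "i \<in> I" "x = i \<oplus> z" by (auto simp: a_r_coset_def')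
  then show "x \<in> J" using J z by (metis additive_subgroup.a_closed ideal.axioms(1) subsetD)
qed auto

text \<open>Primes of the quotient correspond to primes of R containing I, by preimage and image.
  Strict inclusions survive preimages because the quotient map is surjective, and images because
  each P i is a union of cosets of I (\<open>rcos_mem_image_iff\<close>).\<close>

lemma krull_dim_quotient:
  assumes I: "ideal I R"
  shows "krull_dim (R Quot I) = Sup {enat n |n. \<exists>P. (\<forall>i\<le>n. primeideal (P i) R \<and> I \<subseteq> P i) \<and> (\<forall>i<n. P i \<subset> P (Suc i))}"
proof -
  have zero_eq: "\<zero>\<^bsub>R Quot I\<^esub> = I" by (simp add: FactRing_def)
  have carrier_eq: "\<exists>r\<in>carrier R. z = I +> r" if "z \<in> carrier (R Quot I)" for z
    using that by (auto simp: FactRing_def A_RCOSETS_def')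
  interpret I: ideal I R by (rule I)
  interpret q: ring_hom_ring R "R Quot I" "(+>) I" by (rule I.rcos_ring_hom_ring)
  have Qc: "cring (R Quot I)" by (rule I.quotient_is_cring[OF is_cring])
  have "(\<exists>P. (\<forall>i\<le>n. primeideal (P i) (R Quot I)) \<and> (\<forall>i<n. P i \<subset> P (Suc i))) \<longleftrightarrow>
      (\<exists>P. (\<forall>i\<le>n. primeideal (P i) R \<and> I \<subseteq> P i) \<and> (\<forall>i<n. P i \<subset> P (Suc i)))" (is "?L \<longleftrightarrow> ?R") for n
  proof
    assume ?L
    then obtain P where P: "\<And>i. i \<le> n \<Longrightarrow> primeideal (P i) (R Quot I)" "\<And>i. i < n \<Longrightarrow> P i \<subset> P (Suc i)" by blast
    define Q where "Q i = {r \<in> carrier R. I +> r \<in> P i}" for i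
    have "primeideal (Q i) R" if "i \<le> n" for i
      unfolding Q_def using P(1)[OF that] by (rule q.primeideal_vimage[OF is_cring])
    moreover have "I \<subseteq> Q i" if "i \<le> n" for i
    proof
      fix r assume r: "r \<in> I"
      interpret Pi: primeideal "P i" "R Quot I" by (rule P(1)[OF that])
      have "I +> r = \<zero>\<^bsub>R Quot I\<^esub>" unfolding zero_eq by (rule I.a_rcos_const[OF r])
      moreover have "\<zero>\<^bsub>R Quot I\<^esub> \<in> P i" by (rule additive_subgroup.zero_closed[OF Pi.is_additive_subgroup])
      ultimately show "r \<in> Q i" using I.a_Hcarr[OF r] by (simp add: Q_def)
    qed
    moreover have "Q i \<subset> Q (Suc i)" if i: "i < n" for i
    proof
      show "Q i \<subseteq> Q (Suc i)" using P(2)[OF i] by (auto simp: Q_def)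
      obtain z where z: "z \<in> P (Suc i)" "z \<notin> P i" using P(2)[OF i] by blast
      interpret Pi: primeideal "P (Suc i)" "R Quot I" by (rule P(1)) (use i in simp)
      have "z \<in> carrier (R Quot I)" using z Pi.a_subset by blast
      then obtain r where "r \<in> carrier R" "z = I +> r" using carrier_eq by blast
      then show "Q i \<noteq> Q (Suc i)" using z by (auto simp: Q_def)
    qed
    ultimately show ?R by blast
  next
    assume ?R
    then obtain P where P: "\<And>i. i \<le> n \<Longrightarrow> primeideal (P i) R" "\<And>i. i \<le> n \<Longrightarrow> I \<subseteq> P i" "\<And>i. i < n \<Longrightarrow> P i \<subset> P (Suc i)"
      by blast
    have Pid: "ideal (P i) R" if "i \<le> n" for i using P(1)[OF that] by (simp add: primeideal_def)
    have mem: "I +> x \<in> (+>) I ` P i \<longleftrightarrow> x \<in> P i" if "i \<le> n" "x \<in> carrier R" for i x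
      using rcos_mem_image_iff[OF I Pid P(2)] that by blast
    have "primeideal ((+>) I ` P i) (R Quot I)" if i: "i \<le> n" for i
    proof (rule primeidealI[OF ring_ideal_imp_quot_ideal[OF I Pid[OF i]] Qc])
      interpret Pi: primeideal "P i" R by (rule P(1)[OF i])
      have "\<one> \<notin> P i" using Pi.I_notcarr Pi.one_imp_carrier by blast
      then have "I +> \<one> \<notin> (+>) I ` P i" using mem[OF i one_closed] by blast
      moreover have "I +> \<one> \<in> carrier (R Quot I)" by (rule q.hom_closed[OF one_closed])
      ultimately show "carrier (R Quot I) \<noteq> (+>) I ` P i" by blast
      fix a b assume a: "a \<in> carrier (R Quot I)" and b: "b \<in> carrier (R Quot I)" and ab: "a \<otimes>\<^bsub>R Quot I\<^esub> b \<in> (+>) I ` P i"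
      obtain x y where xy: "x \<in> carrier R" "a = I +> x" "y \<in> carrier R" "b = I +> y"
        using carrier_eq[OF a] carrier_eq[OF b] by auto
      have "I +> (x \<otimes> y) \<in> (+>) I ` P i" using ab unfolding xy(2,4) q.hom_mult[OF xy(1,3)] .
      then have "x \<otimes> y \<in> P i" using mem[OF i m_closed[OF xy(1,3)]] by blast
      then show "a \<in> (+>) I ` P i \<or> b \<in> (+>) I ` P i" using Pi.I_prime xy by blast
    qed
    moreover have "(+>) I ` P i \<subset> (+>) I ` P (Suc i)" if i: "i < n" for i
    proof
      show "(+>) I ` P i \<subseteq> (+>) I ` P (Suc i)" using P(3)[OF i] by blast
      obtain z where z: "z \<in> P (Suc i)" "z \<notin> P i" using P(3)[OF i] by blast
      interpret Pi: primeideal "P (Suc i)" R by (rule P(1)) (use i in simp)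
      have "I +> z \<notin> (+>) I ` P i" using mem[of i z] z i Pi.a_Hcarr by simp
      then show "(+>) I ` P i \<noteq> (+>) I ` P (Suc i)" using z by blast
    qed
    ultimately show ?L by (intro exI[of _ "\<lambda>i. (+>) I ` P i"]) auto
  qed
  then show ?thesis by (simp add: krull_dim_def)
qed

end

lemma krull_dim_mpoly_quotient:
  fixes I :: "(('v \<Rightarrow>\<^sub>0 nat) \<Rightarrow>\<^sub>0 'k::field) set"
  assumes "infinite (UNIV :: 'k set)" "finite V" and I: "ideal I (mpoly_ring V)"
  shows "krull_dim (mpoly_ring V Quot I) = Sup {enat n |n. \<exists>U\<subseteq>V. n \<le> card U \<and> I \<inter> polys U = {0}}"
  unfolding cring.krull_dim_quotient[OF cring_mpoly_ring I] primeideal_iff_is_prime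
    prime_chain_iff[OF assms(1,2) ideal_imp_is_ideal[OF I]] ..

section \<open>Zeros over the algebraic closure\<close>

text \<open>G splits into linear factors, so its value at z is a nonzero constant times a product of
  factors z - a. The constant is a unit, and the prime Q contains one of the factors.\<close>

lemma prime_contains_linear_factor:
  fixes z :: "('v \<Rightarrow>\<^sub>0 nat) \<Rightarrow>\<^sub>0 'k::alg_closed_field"
  assumes Q: "is_prime (polys V) Q" and z: "z \<in> polys V"
    and G: "G \<noteq> 0" "poly (map_poly Const G) z \<in> Q"
  shows "\<exists>a. z - Const a \<in> Q"
proof -
  define \<Phi> where "\<Phi> H = poly (map_poly Const H) z" for H
  have map_add_poly: "map_poly Const (p + q) = map_poly Const p + map_poly Const q" for p q :: "'k poly"
    by (intro poly_eqI) (simp add: coeff_map_poly Const_zero Const_add)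
  have smult: "\<Phi> (smult c p) = Const c * \<Phi> p" for c p
    unfolding \<Phi>_def by (subst map_poly_smult) (simp_all add: Const_zero Const_mult)
  have pCons: "\<Phi> (pCons c p) = Const c + z * \<Phi> p" for c p
    by (cases "c = 0 \<and> p = 0") (auto simp: \<Phi>_def map_poly_pCons Const_zero)
  have lin: "\<Phi> ([:- r, 1:] * p) = (z - Const r) * \<Phi> p" for r p
  proof -
    have "[:- r, 1:] * p + smult r p = pCons 0 p" by simp
    then have "\<Phi> ([:- r, 1:] * p + smult r p) = z * \<Phi> p" using pCons[of 0 p] by (simp only: Const_zero add_0)
    then have "\<Phi> ([:- r, 1:] * p) + \<Phi> (smult r p) = z * \<Phi> p" unfolding \<Phi>_def map_add_poly poly_add .
    then show ?thesis by (simp add: smult algebra_simps)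
  qed
  have cl: "\<Phi> p \<in> polys V" for p
    by (induction p) (simp_all add: pCons Const_in_polys polys_add polys_mult z,
        simp add: \<Phi>_def subring_zero[OF polys_subring])
  obtain A where A: "G = smult (lead_coeff G) (\<Prod>x\<in>#A. [:- x, 1:])"
    using alg_closed_imp_factorization[OF G(1)] by blast
  have nz: "Const c \<notin> Q" if "c \<noteq> 0" for c
  proof
    assume "Const c \<in> Q"
    then have "Const (inverse c) * Const c \<in> Q"
      using Q Const_in_polys[of "inverse c" V] unfolding is_prime_def is_ideal_def by blast
    then show False using that Q by (simp add: Const_mult[symmetric] Const_one is_prime_def)
  qed
  have "Const (lead_coeff G) * \<Phi> (\<Prod>x\<in>#A. [:- x, 1:]) \<in> Q"
    using G(2) A smult by (metis \<Phi>_def)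
  then have "\<Phi> (\<Prod>x\<in>#A. [:- x, 1:]) \<in> Q"
    using nz[of "lead_coeff G"] G(1) Q cl Const_in_polys unfolding is_prime_def by (metis leading_coeff_0_iff)
  then show ?thesis
  proof (induction A)
    case empty
    then show ?case using Q nz[of 1] by (simp add: \<Phi>_def Const_one)
  next
    case (add x A)
    then have "(z - Const x) * \<Phi> (\<Prod>x\<in>#A. [:- x, 1:]) \<in> Q" using lin by simp
    moreover have "z - Const x \<in> polys V" by (intro polys_diff z Const_in_polys)
    ultimately have "z - Const x \<in> Q \<or> \<Phi> (\<Prod>x\<in>#A. [:- x, 1:]) \<in> Q"
      using Q cl unfolding is_prime_def by blast
    then show ?case using add.IH by blast
  qed
qed

text \<open>Take a point c where s and f do not vanish, and a prime Q over the ideal q of c in K[U].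
  Modulo Q every variable is a constant, because the field is algebraically closed, so every
  polynomial is congruent to its value at a point a. This a is a zero of P since P \<subseteq> Q,
  and f is nonzero there since f lies outside q.\<close>

lemma ex_zero_of_prime:
  fixes P :: "(('v \<Rightarrow>\<^sub>0 nat) \<Rightarrow>\<^sub>0 'k::alg_closed_field) set"
  assumes inf: "infinite (UNIV :: 'k set)" and V: "finite V"
    and P: "is_prime (polys V) P" and U: "maximal_independent V P U" and f: "f \<in> polys U" "f \<noteq> 0"
  shows "\<exists>a\<in>affine_space V. (\<forall>g\<in>P. ev a g = 0) \<and> ev a f \<noteq> 0"
proof -
  have UV: "U \<subseteq> V" and PU: "P \<inter> polys U = {0}" using U by (auto simp: maximal_independent_def)
  interpret subring_pair "polys V" "polys U" P by (rule is_subring_pair[OF UV P])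
  obtain s F where s: "s \<in> polys U" "s \<noteq> 0"
    and rel: "\<And>x. x \<in> V - U \<Longrightarrow>
      \<exists>e c. e > 0 \<and> (\<forall>i<e. c i \<in> polys U) \<and> s * Var x ^ e - (\<Sum>i<e. c i * Var x ^ i) \<in> P"
    and F: "finite F" "F \<subseteq> polys V" "1 \<in> F" "finite_over (polys V) (polys U) P s F"
    using ex_finite_over[OF inf V P U] by blast
  obtain c where c: "ev c s \<noteq> 0" "ev c f \<noteq> 0" using nonvanishing_mult_in_polys[OF inf V UV s f] by blast
  define q where "q = {g\<in>polys U. ev c g = 0}"
  have "is_prime (polys U) q"
    using subring_zero[OF D] by (auto simp: is_prime_def is_ideal_def q_def polys_add polys_mult)
  moreover have "P \<inter> polys U \<subseteq> q" "s \<notin> q" using PU c subring_zero[OF D] by (auto simp: q_def)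
  ultimately obtain Q where Q: "is_prime (polys V) Q" "P \<subseteq> Q" "Q \<inter> polys U = q"
    using going_up[OF _ _ s(1) _ F] by blast
  have Qi: "is_ideal (polys V) Q" using Q by (simp add: is_prime_def)
  have qQ: "g - Const (ev c g) \<in> Q" if "g \<in> polys U" for g
  proof -
    have "g - Const (ev c g) \<in> q" using polys_diff[OF that Const_in_polys] by (simp add: q_def)
    then show ?thesis using Q(3) by blast
  qed
  have "\<exists>a. Var x - Const a \<in> Q" if x: "x \<in> V" for x
  proof (cases "x \<in> U")
    case True
    then show ?thesis using qQ[OF Var_in_polys] by blast
  next
    case False
    then obtain e d where d: "\<And>i. i < e \<Longrightarrow> d i \<in> polys U" "s * Var x ^ e - (\<Sum>i<e. d i * Var x ^ i) \<in> P"
      using rel[of x] x by blast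
    \<comment> \<open>The relation for x with its coefficients evaluated at c; its leading
      coefficient is nonzero by the choice of c.\<close>
    define G where "G = Polynomial.monom (ev c s) e - (\<Sum>i<e. Polynomial.monom (ev c (d i)) i)"
    have "Polynomial.coeff G e = ev c s" by (simp add: G_def coeff_sum)
    then have "G \<noteq> 0" using c by auto
    have coeff: "Polynomial.coeff G i = - ev c (d i)" if "i < e" for i
      using that by (simp add: G_def coeff_sum if_distrib cong: if_cong)
    have deg: "degree G \<le> e"
      unfolding G_def by (intro degree_diff_le degree_monom_le degree_sum_le order_trans[OF degree_monom_le]) auto
    have "poly (map_poly Const G) (Var x) = (\<Sum>i\<le>e. Const (Polynomial.coeff G i) * Var x ^ i)"
    proof -
      have "degree (map_poly Const G :: (('v \<Rightarrow>\<^sub>0 nat) \<Rightarrow>\<^sub>0 'k) poly) \<le> e"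
        using deg by (intro degree_le) (auto simp: coeff_map_poly Const_zero coeff_eq_0)
      then have "poly (map_poly Const G) (Var x) = (\<Sum>i\<le>e. Polynomial.coeff (map_poly Const G) i * Var x ^ i)"
        unfolding poly_altdef by (intro sum.mono_neutral_left) (auto simp: coeff_eq_0)
      then show ?thesis by (simp add: coeff_map_poly Const_zero)
    qed
    also have "\<dots> = Const (ev c s) * Var x ^ e + (\<Sum>i<e. - Const (ev c (d i)) * Var x ^ i)"
    proof -
      have "Const (- ev c (d i)) = (- Const (ev c (d i)) :: ('v \<Rightarrow>\<^sub>0 nat) \<Rightarrow>\<^sub>0 'k)" for i by (simp add: Const_def single_uminus)
      then show ?thesis using coeff \<open>Polynomial.coeff G e = ev c s\<close>
        by (simp add: lessThan_Suc_atMost[symmetric])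
    qed
    \<comment> \<open>The value of G at the variable x differs from the given element of P only by
      multiples of g - Const (ev c g) with g in K[U], and these lie in Q.\<close>
    also have "\<dots> = (s * Var x ^ e - (\<Sum>i<e. d i * Var x ^ i)) - ((s - Const (ev c s)) * Var x ^ e -
        (\<Sum>i<e. (d i - Const (ev c (d i))) * Var x ^ i))"
      by (simp add: algebra_simps sum_subtractf sum_negf)
    also have "\<dots> \<in> Q"
      using d(1) s x
      by (intro ideal_diff[OF C Qi] subsetD[OF Q(2) d(2)] ideal_sum[OF C Qi] ideal_mult_right[OF C Qi _ qQ]
          polys_power Var_in_polys) auto
    finally show ?thesis using prime_contains_linear_factor[OF Q(1) Var_in_polys[OF x] \<open>G \<noteq> 0\<close>] by blast
  qed
  then obtain b where b: "\<And>x. x \<in> V \<Longrightarrow> Var x - Const (b x) \<in> Q" by metis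
  define a where "a x = (if x \<in> V then b x else 0)" for x
  have gQ: "g - Const (ev a g) \<in> Q" if "g \<in> polys V" for g
    using that
  proof (induction rule: polys_induct)
    case (const c)
    then show ?case using ideal_zero[OF C Qi] by simp
  next
    case (add f g)
    then have "(f - Const (ev a f)) + (g - Const (ev a g)) \<in> Q" by (intro ideal_add[OF C Qi])
    then show ?case by (simp add: Const_add algebra_simps)
  next
    case (Var v f)
    have "Var v - Const (a v) \<in> Q" using b[of v] Var(1) by (simp add: a_def)
    have "Var v * (f - Const (ev a f)) + Const (ev a f) * (Var v - Const (a v)) \<in> Q"
      using Var \<open>Var v - Const (a v) \<in> Q\<close>
      by (intro ideal_add[OF C Qi] ideal_mult_left[OF C Qi] Var_in_polys Const_in_polys)
    then show ?case by (simp add: Const_mult algebra_simps)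
  qed
  have const: "t = 0" if "Const t \<in> Q" for t
  proof (rule ccontr)
    assume "t \<noteq> 0"
    then have "Const (inverse t) * Const t \<in> Q" using that Const_in_polys by (intro ideal_mult_left[OF C Qi])
    then show False using \<open>t \<noteq> 0\<close> Q(1) by (simp add: Const_mult[symmetric] Const_one is_prime_def)
  qed
  have "ev a g = 0" if g: "g \<in> P" for g
  proof -
    have "g - (g - Const (ev a g)) \<in> Q"
      using g Q(2) ideal_subset[OF C Pi] by (intro ideal_diff[OF C Qi] gQ) auto
    then show ?thesis by (intro const) simp
  qed
  moreover have "ev a f \<noteq> 0"
  proof
    assume "ev a f = 0"
    then have "f \<in> Q" using gQ[of f] f polys_mono[OF UV] by (auto simp: Const_zero)
    then have "f \<in> q" using Q(3) f by blast
    then show False using c by (simp add: q_def)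
  qed
  moreover have "a \<in> affine_space V" by (simp add: affine_space_def a_def)
  ultimately show ?thesis by blast
qed

section \<open>Extension of scalars to the algebraic closure\<close>

definition K_linear :: "('k::field alg_closure \<Rightarrow> 'k) \<Rightarrow> bool" where
  "K_linear \<phi> \<longleftrightarrow> (\<forall>x y. \<phi> (x + y) = \<phi> x + \<phi> y) \<and> (\<forall>c x. \<phi> (to_ac c * x) = c * \<phi> x)"

lemma ex_K_linear_nonzero:
  fixes z :: "'k::field alg_closure"
  assumes "z \<noteq> 0"
  shows "\<exists>\<phi>. K_linear \<phi> \<and> \<phi> z \<noteq> 0"
proof -
  interpret v: vector_space_pair "\<lambda>(c::'k) x. to_ac c * x :: 'k alg_closure" "(*) :: 'k \<Rightarrow> 'k \<Rightarrow> 'k"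
    by unfold_locales (simp_all add: algebra_simps)
  have "v.vs1.independent {z}" using assms v.vs1.dependent_single[of z] by simp
  then obtain \<phi> where \<phi>: "Vector_Spaces.linear (\<lambda>(c::'k) x. to_ac c * x) (*) \<phi>" "\<phi> z = 1"
    using v.linear_independent_extend[of "{z}" "\<lambda>_. 1"] by auto
  interpret l: Vector_Spaces.linear "\<lambda>(c::'k) x. to_ac c * x" "(*)" \<phi> by (rule \<phi>(1))
  have "K_linear \<phi>" using l.add l.scale by (simp add: K_linear_def)
  then show ?thesis using \<phi>(2) by (intro exI[of _ \<phi>]) simp
qed

lemma lookup_map: "h 0 = 0 \<Longrightarrow> Poly_Mapping.lookup (Poly_Mapping.map h f) m = h (Poly_Mapping.lookup f m)"
  by (simp add: Poly_Mapping.map.rep_eq when_def)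

lemma map_in_polys: "f \<in> polys U \<Longrightarrow> h 0 = 0 \<Longrightarrow> Poly_Mapping.map h f \<in> polys U"
  for f :: "('v \<Rightarrow>\<^sub>0 nat) \<Rightarrow>\<^sub>0 'k::comm_ring_1" and h :: "'k \<Rightarrow> 'l::comm_ring_1"
proof -
  assume f: "f \<in> polys U" and h: "h 0 = 0"
  have "Poly_Mapping.keys (Poly_Mapping.map h f) \<subseteq> Poly_Mapping.keys f"
    using h lookup_map[of h f] by (auto simp: in_keys_iff)
  then show ?thesis using f unfolding in_polys by blast
qed

lemma mpoly_eval_map:
  fixes h :: "'k::comm_ring_1 \<Rightarrow> 'l::comm_ring_1"
  assumes "\<And>x. h x = 0 \<longleftrightarrow> x = 0"
  shows "mpoly_eval h x f = ev x (Poly_Mapping.map h f)"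
proof -
  have "h 0 = 0" using assms by simp
  then have "Poly_Mapping.keys (Poly_Mapping.map h f) = Poly_Mapping.keys f"
    using assms lookup_map[of h f] by (simp add: set_eq_iff in_keys_iff)
  then show ?thesis using \<open>h 0 = 0\<close> by (simp add: mpoly_eval_def ev_def lookup_map)
qed

text \<open>The ideal spanned by \<open>I\<close> after extending the base field, characterized by \<open>K\<close>-linear
  functionals on the algebraic closure.\<close>

definition extend_ideal ::
    "'v set \<Rightarrow> (('v \<Rightarrow>\<^sub>0 nat) \<Rightarrow>\<^sub>0 'k::field) set \<Rightarrow> (('v \<Rightarrow>\<^sub>0 nat) \<Rightarrow>\<^sub>0 'k alg_closure) set" where
  "extend_ideal V I = {f\<in>polys V. \<forall>\<phi>. K_linear \<phi> \<longrightarrow> Poly_Mapping.map \<phi> f \<in> I}"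

lemma K_linear_zero: "K_linear \<phi> \<Longrightarrow> \<phi> 0 = 0"
  unfolding K_linear_def by (metis add_cancel_right_right)

lemma map_add: "K_linear \<phi> \<Longrightarrow> Poly_Mapping.map \<phi> (f + g) = Poly_Mapping.map \<phi> f + Poly_Mapping.map \<phi> g"
  by (rule poly_mapping_eqI) (simp add: lookup_map K_linear_zero lookup_add, simp add: K_linear_def)

lemma map_sum: "K_linear \<phi> \<Longrightarrow> Poly_Mapping.map \<phi> (sum f A) = (\<Sum>i\<in>A. Poly_Mapping.map \<phi> (f i))"
  by (induction A rule: infinite_finite_induct)
    (simp_all add: map_add, simp_all add: poly_mapping_eq_iff fun_eq_iff lookup_map K_linear_zero)

text \<open>The factor c is absorbed by the functional, as z \<mapsto> \<phi> (c * z) is again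
  K-linear. This makes \<open>extend_ideal\<close> closed under multiplication by scalars of the
  algebraic closure.\<close>

lemma map_single_mult:
  fixes f :: "('v \<Rightarrow>\<^sub>0 nat) \<Rightarrow>\<^sub>0 'k::field alg_closure"
  assumes \<phi>: "K_linear \<phi>"
  shows "Poly_Mapping.map \<phi> (Poly_Mapping.single m c * f) =
    Poly_Mapping.single m 1 * Poly_Mapping.map (\<lambda>z. \<phi> (c * z)) f"
proof -
  let ?\<psi> = "\<lambda>z. \<phi> (c * z)"
  have \<psi>: "K_linear ?\<psi>" using \<phi> unfolding K_linear_def by (metis distrib_left mult.left_commute)
  have sgl: "Poly_Mapping.map \<chi> (Poly_Mapping.single n d) = Poly_Mapping.single n (\<chi> d)" if "K_linear \<chi>" for \<chi> n d
    using K_linear_zero[OF that] by (simp add: poly_mapping_eq_iff fun_eq_iff lookup_map lookup_single when_def)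
  let ?t = "\<lambda>n. Poly_Mapping.single n (Poly_Mapping.lookup f n)"
  have "Poly_Mapping.map \<phi> (Poly_Mapping.single m c * (\<Sum>n\<in>Poly_Mapping.keys f. ?t n)) =
      Poly_Mapping.single m 1 * Poly_Mapping.map ?\<psi> (\<Sum>n\<in>Poly_Mapping.keys f. ?t n)"
    by (simp add: sum_distrib_left map_sum[OF \<phi>] map_sum[OF \<psi>] mult_single sgl[OF \<phi>] sgl[OF \<psi>])
  then show ?thesis by (simp flip: poly_mapping_as_sum)
qed

lemma extend_ideal_is_ideal:
  fixes I :: "(('v \<Rightarrow>\<^sub>0 nat) \<Rightarrow>\<^sub>0 'k::field) set"
  assumes I: "is_ideal (polys V) I"
  shows "is_ideal (polys V) (extend_ideal V I)"
proof -
  have map0: "Poly_Mapping.map \<phi> 0 = (0 :: ('v \<Rightarrow>\<^sub>0 nat) \<Rightarrow>\<^sub>0 'k)" if "K_linear \<phi>" for \<phi>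
    using K_linear_zero[OF that] by (simp add: poly_mapping_eq_iff fun_eq_iff lookup_map)
  have single: "Poly_Mapping.single m c * f \<in> extend_ideal V I"
    if "f \<in> extend_ideal V I" "Poly_Mapping.keys m \<subseteq> V" for f m c
  proof -
    have "Poly_Mapping.map \<phi> (Poly_Mapping.single m c * f) \<in> I" if \<phi>: "K_linear \<phi>" for \<phi>
    proof -
      have "K_linear (\<lambda>z. \<phi> (c * z))" using \<phi> unfolding K_linear_def by (metis distrib_left mult.left_commute)
      then show ?thesis unfolding map_single_mult[OF \<phi>]
        using \<open>f \<in> _\<close> \<open>Poly_Mapping.keys m \<subseteq> V\<close>
        by (intro ideal_mult_left[OF polys_subring I]) (auto simp: extend_ideal_def in_polys)
    qed
    moreover have "Poly_Mapping.single m c \<in> polys V" using that by (simp add: in_polys)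
    ultimately show ?thesis using that by (auto simp: extend_ideal_def intro: polys_mult)
  qed
  have add_mem: "f + g \<in> extend_ideal V I" if "f \<in> extend_ideal V I" "g \<in> extend_ideal V I" for f g
    using that by (auto simp: extend_ideal_def map_add intro: polys_add ideal_add[OF polys_subring I])
  have zero: "0 \<in> extend_ideal V I"
    using subring_zero[OF polys_subring] ideal_zero[OF polys_subring I] by (auto simp: extend_ideal_def map0)
  have "h * f \<in> extend_ideal V I" if "h \<in> polys V" "f \<in> extend_ideal V I" for h f
    using that
  proof (induction arbitrary: f rule: polys_induct)
    case (const c)
    then show ?case using single[of f 0 c] by (simp add: Const_def)
  next
    case (add g h)
    then show ?case using add_mem[of "g * f" "h * f"] by (simp add: algebra_simps)
  next
    case (Var v h)
    then show ?case using single[of "h * f" "Poly_Mapping.single v 1" 1] by (simp add: Var_def mult.assoc)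
  qed
  then show ?thesis using add_mem zero by (auto simp: is_ideal_def extend_ideal_def)
qed

text \<open>Forward: functionals separate the coefficients of a polynomial, so U stays independent
  for the extended ideal, hence modulo some prime over it; a nonzero f in the variables U then has a
  nonzero value at some zero of that prime. Backward: an element of I in the variables U vanishes on
  the zero set and is 0 by density.\<close>

theorem independent_iff_zariski_dense:
  fixes I :: "(('v \<Rightarrow>\<^sub>0 nat) \<Rightarrow>\<^sub>0 'k::field) set"
  assumes inf: "infinite (UNIV :: 'k set)" and V: "finite V" and I: "is_ideal (polys V) I" and U: "U \<subseteq> V"
  shows "I \<inter> polys U = {0} \<longleftrightarrow>
    zariski_dense U {x \<in> affine_space V. \<forall>f\<in>I. mpoly_eval to_ac x f = 0}" (is "_ \<longleftrightarrow> zariski_dense U ?Z")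
proof
  have inf': "infinite (UNIV :: 'k alg_closure set)"
    using inf finite_imageD[OF finite_subset[of "range (to_ac :: 'k \<Rightarrow> _)" UNIV] inj_to_ac] by auto
  have ev: "mpoly_eval to_ac x f = ev x (Poly_Mapping.map to_ac f)" for x and f :: "('v \<Rightarrow>\<^sub>0 nat) \<Rightarrow>\<^sub>0 'k"
    by (rule mpoly_eval_map) simp
  {
    assume IU: "I \<inter> polys U = {0}"
    let ?J = "extend_ideal V I"
    have J: "is_ideal (polys V) ?J" by (rule extend_ideal_is_ideal[OF I])
    have "?J \<inter> polys U = {0}"
    proof (intro equalityI subsetI)
      fix f assume f: "f \<in> ?J \<inter> polys U"
      have "Poly_Mapping.lookup f m = 0" for m
      proof (rule ccontr)
        assume "Poly_Mapping.lookup f m \<noteq> 0"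
        then obtain \<phi> where \<phi>: "K_linear \<phi>" "\<phi> (Poly_Mapping.lookup f m) \<noteq> 0"
          using ex_K_linear_nonzero by blast
        have "Poly_Mapping.map \<phi> f \<in> I \<inter> polys U"
          using f \<phi> map_in_polys[of f U \<phi>] K_linear_zero[of \<phi>] by (auto simp: extend_ideal_def)
        then have "Poly_Mapping.map \<phi> f = 0" using IU by blast
        then show False using \<phi>(2) lookup_map[of \<phi> f m] K_linear_zero[OF \<phi>(1)] by simp
      qed
      then show "f \<in> {0}" by (simp add: poly_mapping_eq_iff fun_eq_iff)
    next
      fix f :: "('v \<Rightarrow>\<^sub>0 nat) \<Rightarrow>\<^sub>0 'k alg_closure"
      assume "f \<in> {0}"
      then show "f \<in> ?J \<inter> polys U" using ideal_zero[OF polys_subring J] subring_zero[OF polys_subring] by simp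
    qed
    then obtain P U' where P: "is_prime (polys V) P" "?J \<subseteq> P" "U \<subseteq> U'" "maximal_independent V P U'"
      using ex_prime_of_independent[OF inf' V J U] by blast
    show "zariski_dense U ?Z"
      unfolding zariski_dense_def
    proof (intro ballI impI, rule ccontr)
      fix f assume f: "f \<in> polys U" "\<forall>p\<in>?Z. ev p f = 0" "f \<noteq> 0"
      then have "f \<in> polys U'" using polys_mono[OF P(3)] by blast
      then obtain a where a: "a \<in> affine_space V" "\<forall>g\<in>P. ev a g = 0" "ev a f \<noteq> 0"
        using ex_zero_of_prime[OF inf' V P(1,4)] f(3) by blast
      have "mpoly_eval to_ac a g = 0" if g: "g \<in> I" for g
      proof -
        have "Poly_Mapping.map \<phi> (Poly_Mapping.map to_ac g) \<in> I" if \<phi>: "K_linear \<phi>" for \<phi>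
        proof -
          \<comment> \<open>On the base field a functional is multiplication by its value at 1, so
            it takes the image of g back to a multiple of g. Hence the extended ideal contains the
            image of I.\<close>
          have "\<phi> (to_ac x) = \<phi> 1 * x" for x
            using \<phi> unfolding K_linear_def by (metis mult.commute mult.right_neutral)
          then have "Poly_Mapping.map \<phi> (Poly_Mapping.map to_ac g) = Poly_Mapping.map ((*) (\<phi> 1)) g"
            by (simp add: poly_mapping_eq_iff fun_eq_iff lookup_map K_linear_zero[OF \<phi>])
          also have "\<dots> = Const (\<phi> 1) * g" by (simp add: mult_map_scale_conv_mult Const_def)
          also have "\<dots> \<in> I" using g Const_in_polys by (intro ideal_mult_left[OF polys_subring I])
          finally show ?thesis .
        qed
        moreover have "Poly_Mapping.map to_ac g \<in> polys V"
          using g ideal_subset[OF polys_subring I] map_in_polys[of g V to_ac] by auto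
        ultimately have "Poly_Mapping.map to_ac g \<in> ?J" by (simp add: extend_ideal_def)
        then show ?thesis using a P(2) by (auto simp: ev)
      qed
      then have "a \<in> ?Z" using a by simp
      then show False using f a by blast
    qed
  }
  assume dense: "zariski_dense U ?Z"
  show "I \<inter> polys U = {0}"
  proof (intro equalityI subsetI)
    fix f assume f: "f \<in> I \<inter> polys U"
    then have "Poly_Mapping.map to_ac f \<in> polys U" using map_in_polys[of f U to_ac] by auto
    moreover have "\<forall>p\<in>?Z. ev p (Poly_Mapping.map to_ac f) = 0" using f by (auto simp: ev)
    ultimately have "Poly_Mapping.map to_ac f = 0" using dense unfolding zariski_dense_def by blast
    then have "to_ac (Poly_Mapping.lookup f m) = 0" for m using lookup_map[of to_ac f m] by simp
    then show "f \<in> {0}" by (simp add: poly_mapping_eq_iff fun_eq_iff)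
  next
    fix f :: "('v \<Rightarrow>\<^sub>0 nat) \<Rightarrow>\<^sub>0 'k"
    assume "f \<in> {0}"
    then show "f \<in> I \<inter> polys U" using ideal_zero[OF polys_subring I] subring_zero[OF polys_subring] by simp
  qed
qed

section \<open>Tuples in a family of subspaces\<close>

definition coord_subspace :: "'a set \<Rightarrow> ('a \<Rightarrow> 'k::field) set \<Rightarrow> bool" where
  "coord_subspace B S \<longleftrightarrow> S \<subseteq> affine_space B \<and> (\<lambda>_. 0) \<in> S \<and>
     (\<forall>x\<in>S. \<forall>y\<in>S. (\<lambda>b. x b + y b) \<in> S) \<and> (\<forall>c. \<forall>x\<in>S. (\<lambda>b. c * x b) \<in> S)"

text \<open>The coordinates in \<open>W\<close> identify \<open>S\<close> with the space of functions on \<open>W\<close>, and \<open>e\<close> is the basis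
  of \<open>S\<close> corresponding to the standard basis.\<close>

definition coord_basis :: "'a set \<Rightarrow> ('a \<Rightarrow> 'k::field) set \<Rightarrow> 'a set \<Rightarrow> ('a \<Rightarrow> 'a \<Rightarrow> 'k) \<Rightarrow> bool" where
  "coord_basis B S W e \<longleftrightarrow> W \<subseteq> B \<and> (\<forall>w\<in>W. e w \<in> S \<and> (\<forall>v\<in>W. e w v = (if v = w then 1 else 0))) \<and>
     (\<forall>x\<in>S. \<forall>b\<in>B. x b = (\<Sum>w\<in>W. x w * e w b))"

definition tuples_in :: "'a set \<Rightarrow> ('a \<Rightarrow> 'k::field) set set \<Rightarrow> nat \<Rightarrow> (nat \<times> 'a \<Rightarrow> 'k) set" where
  "tuples_in B \<S> r = {x \<in> affine_space ({..<r} \<times> B). \<exists>S\<in>\<S>. \<forall>j<r. (\<lambda>b. x (j, b)) \<in> S}"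

text \<open>The members of the family in the affine chart of the Grassmannian that belongs to W:
  they project isomorphically onto the W-coordinates and so have dimension card W. A subspace may
  belong to several charts.\<close>

definition based_subspaces :: "'a set \<Rightarrow> ('a \<Rightarrow> 'k::field) set set \<Rightarrow> 'a set \<Rightarrow> ('a \<Rightarrow> 'k) set set" where
  "based_subspaces B \<S> W = {S\<in>\<S>. \<exists>e. coord_basis B S W e}"

lemma coord_subspace_add: "coord_subspace B S \<Longrightarrow> x \<in> S \<Longrightarrow> y \<in> S \<Longrightarrow> (\<lambda>b. x b + y b) \<in> S"
  and coord_subspace_scale: "coord_subspace B S \<Longrightarrow> x \<in> S \<Longrightarrow> (\<lambda>b. c * x b) \<in> S"
  by (simp_all add: coord_subspace_def)

lemma coord_subspace_sum:
  assumes S: "coord_subspace B S" and "\<And>w. w \<in> W \<Longrightarrow> e w \<in> S"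
  shows "(\<lambda>b. \<Sum>w\<in>W. c w * e w b) \<in> S"
  using assms(2)
proof (induction W rule: infinite_finite_induct)
  case (insert w W)
  have "(\<lambda>b. \<Sum>w\<in>W. c w * e w b) \<in> S" by (rule insert.IH) (simp add: insert.prems)
  moreover have "(\<lambda>b. c w * e w b) \<in> S"
    by (rule coord_subspace_scale[OF S]) (simp add: insert.prems)
  ultimately have "(\<lambda>b. c w * e w b + (\<Sum>w\<in>W. c w * e w b)) \<in> S"
    using coord_subspace_add[OF S] by simp
  then show ?case using insert.hyps by simp
qed (use S in \<open>auto simp: coord_subspace_def\<close>)

text \<open>W is chosen maximal among the sets of coordinates that admit a dual system
  \<open>e\<close> in S. If the W-coordinates of some x in S did not determine its value at b in
  this way, Gauss-Jordan elimination would adjoin b to W.\<close>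

lemma ex_coord_basis:
  assumes B: "finite B" and S: "coord_subspace B S"
  shows "\<exists>W e. coord_basis B S W e"
proof -
  let ?Q = "\<lambda>W e. \<forall>w\<in>W. e w \<in> S \<and> (\<forall>v\<in>W. e w v = (if v = w then 1 else 0))"
  let ?\<W> = "{W. W \<subseteq> B \<and> (\<exists>e. ?Q W e)}"
  have "finite ?\<W>" using B by (rule finite_subset[rotated, OF finite_Pow_iff[THEN iffD2]]) auto
  moreover have "{} \<in> ?\<W>" by simp
  ultimately obtain W where W: "W \<in> ?\<W>" "\<And>Y. Y \<in> ?\<W> \<Longrightarrow> W \<subseteq> Y \<Longrightarrow> W = Y"
    using finite_has_maximal[of ?\<W>] by (metis (lifting) empty_iff)
  then obtain e where e: "\<And>w. w \<in> W \<Longrightarrow> e w \<in> S" "\<And>w v. w \<in> W \<Longrightarrow> v \<in> W \<Longrightarrow> e w v = (if v = w then 1 else 0)"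
    by blast
  have WB: "W \<subseteq> B" and fW: "finite W" using W(1) B finite_subset by auto
  have "x b = (\<Sum>w\<in>W. x w * e w b)" if x: "x \<in> S" "b \<in> B" for x b
  proof (rule ccontr)
    assume neq: "x b \<noteq> (\<Sum>w\<in>W. x w * e w b)"
    \<comment> \<open>The part of x not accounted for by W: it vanishes on W but not at b. Scaled to
      1 at b it becomes the new basis vector and clears the coordinate b of the old ones.\<close>
    define y where "y c = x c - (\<Sum>w\<in>W. x w * e w c)" for c
    have yS: "y \<in> S"
    proof -
      have "(\<lambda>b. \<Sum>w\<in>W. (- x w) * e w b) \<in> S" by (rule coord_subspace_sum[OF S e(1)])
      then have "(\<lambda>b. x b + (\<Sum>w\<in>W. (- x w) * e w b)) \<in> S" by (rule coord_subspace_add[OF S x(1)])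
      then show ?thesis by (simp add: y_def[abs_def] sum_negf)
    qed
    have yb: "y b \<noteq> 0" using neq by (simp add: y_def)
    have yW: "y v = 0" if "v \<in> W" for v
    proof -
      have "(\<Sum>w\<in>W. x w * e w v) = (\<Sum>w\<in>W. if w = v then x w else 0)"
        using e(2) that by (intro sum.cong) auto
      then show ?thesis using that fW by (simp add: y_def)
    qed
    have bW: "b \<notin> W" using yb yW by blast
    define z where "z c = inverse (y b) * y c" for c
    have zS: "z \<in> S" unfolding z_def[abs_def] by (rule coord_subspace_scale[OF S yS])
    define e' where "e' w = (if w = b then z else (\<lambda>c. e w c + (- e w b) * z c))" for w
    have "?Q (insert b W) e'"
    proof
      fix w assume w: "w \<in> insert b W"
      show "e' w \<in> S \<and> (\<forall>v\<in>insert b W. e' w v = (if v = w then 1 else 0))"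
      proof (cases "w = b")
        case True
        then show ?thesis using zS yb yW bW by (auto simp: e'_def z_def)
      next
        case False
        then have wW: "w \<in> W" using w by blast
        have "(\<lambda>c. (- e w b) * z c) \<in> S" by (rule coord_subspace_scale[OF S zS])
        then have "(\<lambda>c. e w c + (- e w b) * z c) \<in> S" by (rule coord_subspace_add[OF S e(1)[OF wW]])
        then show ?thesis using False wW e(2) yb yW bW by (auto simp: e'_def z_def)
      qed
    qed
    then have "insert b W \<in> ?\<W>" using WB x(2) by blast
    then show False using W(2)[of "insert b W"] bW by blast
  qed
  then show ?thesis using e WB by (intro exI[of _ W] exI[of _ e]) (simp add: coord_basis_def)
qed

lemma coord_basis_combination:
  assumes "coord_basis B S W e" "finite W" "v \<in> W"
  shows "(\<Sum>w\<in>W. c w * e w v) = c v"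
proof -
  have "(\<Sum>w\<in>W. c w * e w v) = (\<Sum>w\<in>W. if w = v then c w else 0)"
    using assms by (intro sum.cong) (auto simp: coord_basis_def)
  then show ?thesis using assms by simp
qed

text \<open>Nonzero polynomials that vanish on the individual Z i have a nonzero product, and it
  vanishes on the union.\<close>

lemma zariski_dense_Union:
  fixes Z :: "'i \<Rightarrow> ('v \<Rightarrow> 'k::field) set"
  assumes inf: "infinite (UNIV :: 'k set)" and "finite U" "finite A"
    and dense: "zariski_dense U (\<Union>i\<in>A. Z i)"
  shows "\<exists>i\<in>A. zariski_dense U (Z i)"
proof (rule ccontr)
  assume "\<not> ?thesis"
  then have "\<forall>i\<in>A. \<exists>f. f \<in> polys U \<and> f \<noteq> 0 \<and> (\<forall>p\<in>Z i. ev p f = 0)"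
    unfolding zariski_dense_def by blast
  from bchoice[OF this] obtain f where f: "\<And>i. i \<in> A \<Longrightarrow> f i \<in> polys U" "\<And>i. i \<in> A \<Longrightarrow> f i \<noteq> 0"
    "\<And>i p. i \<in> A \<Longrightarrow> p \<in> Z i \<Longrightarrow> ev p (f i) = 0" by blast
  have ev_prod: "ev p (prod f A) = (\<Prod>i\<in>A. ev p (f i))" for p
    by (induction A rule: infinite_finite_induct) simp_all
  have "ev p (prod f A) = 0" if "p \<in> (\<Union>i\<in>A. Z i)" for p
    using that f(3) \<open>finite A\<close> by (auto simp: ev_prod intro!: prod_zero)
  moreover have "prod f A \<in> polys U" using f(1) by (intro subring_prod[OF polys_subring])
  ultimately have "prod f A = 0" using dense unfolding zariski_dense_def by blast
  then show False using prime_prod[OF polys_subring zero_prime[OF inf \<open>finite U\<close>], of A f] f by auto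
qed

lemma zariski_dense_nonempty: "zariski_dense U Z \<Longrightarrow> Z \<noteq> {}"
  unfolding zariski_dense_def using subring_one[OF polys_subring, of U] by force

lemma zariski_dense_mono: "zariski_dense U Z \<Longrightarrow> Z \<subseteq> Y \<Longrightarrow> zariski_dense U Y"
  unfolding zariski_dense_def by blast

lemma eventually_const_of_bounded_mono:
  fixes f :: "nat \<Rightarrow> nat"
  assumes "\<And>r. r \<ge> N \<Longrightarrow> f r \<le> f (Suc r)" "\<And>r. f r \<le> C"
  shows "\<exists>b. \<forall>\<^sub>F r in sequentially. f r = b"
proof -
  have fin: "finite (f ` {N..})" by (rule finite_subset[of _ "{..C}"]) (use assms(2) in auto)
  then have "Max (f ` {N..}) \<in> f ` {N..}" by (intro Max_in) auto
  then obtain M where M: "M \<ge> N" "f M = Max (f ` {N..})" by auto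
  have "f r = f M" if "r \<ge> M" for r
  proof (rule antisym)
    show "f r \<le> f M" unfolding M(2) using fin that M(1) by (intro Max_ge) auto
    show "f M \<le> f r" using that
    proof (induction r rule: dec_induct)
      case (step r)
      then show ?case using assms(1)[of r] M(1) by linarith
    qed simp
  qed
  then show ?thesis by (auto simp: eventually_sequentially)
qed

context
  fixes B :: "'a set" and \<S> :: "('a \<Rightarrow> 'k::field) set set"
  assumes inf: "infinite (UNIV :: 'k set)" and B: "finite B"
    and \<S>: "\<And>S. S \<in> \<S> \<Longrightarrow> coord_subspace B S"
begin

lemma tuples_in_eq_Union: "tuples_in B \<S> r = (\<Union>W\<in>Pow B. tuples_in B (based_subspaces B \<S> W) r)"
proof
  show "tuples_in B \<S> r \<subseteq> (\<Union>W\<in>Pow B. tuples_in B (based_subspaces B \<S> W) r)"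
  proof
    fix x assume "x \<in> tuples_in B \<S> r"
    then obtain S where S: "S \<in> \<S>" "x \<in> affine_space ({..<r} \<times> B)" "\<forall>j<r. (\<lambda>b. x (j, b)) \<in> S"
      by (auto simp: tuples_in_def)
    obtain W e where We: "coord_basis B S W e" using ex_coord_basis[OF B \<S>[OF S(1)]] by blast
    then have "W \<subseteq> B" "S \<in> based_subspaces B \<S> W" using S(1) by (auto simp: coord_basis_def based_subspaces_def)
    then show "x \<in> (\<Union>W\<in>Pow B. tuples_in B (based_subspaces B \<S> W) r)" using S by (auto simp: tuples_in_def)
  qed
qed (auto simp: tuples_in_def based_subspaces_def)

text \<open>A tuple in a subspace with basis \<open>e\<close> is given by its coordinates in \<open>W\<close> and by \<open>e\<close>: the
  coordinates of the basis vectors are put into the additional rows \<open>r, r + 1, \<dots>\<close>, and the relation between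
  tuple and basis becomes the graph of a polynomial map, whose ideal \<open>P\<close> has the coordinates
  in \<open>Y\<close> as free variables.\<close>

lemma card_le_of_based_tuples_dense:
  assumes W: "W \<subseteq> B" and U: "U \<subseteq> {..<r} \<times> B"
    and dense: "zariski_dense U (tuples_in B (based_subspaces B \<S> W) r)"
  shows "card U \<le> card W * (r + card B)"
proof -
  have fW: "finite W" using W B finite_subset by blast
  define m where "m = card W"
  obtain idx where idx: "bij_betw idx W {..<m}"
    using ex_bij_betw_finite_nat[OF fW] by (auto simp: m_def atLeast0LessThan)
  define V where "V = {..<r + m} \<times> B"
  \<comment> \<open>The free coordinates: the W-entries of the r tuple rows and all entries of the m
    basis rows, which makes m * r + m * card B.\<close>
  define Y where "Y = {..<r} \<times> W \<union> {r..<r + m} \<times> B"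
  have fV: "finite V" and YV: "Y \<subseteq> V" and UV: "U \<subseteq> V" using B W U by (auto simp: V_def Y_def)
  have fY: "finite Y" using YV fV finite_subset by blast
  have cardY: "card Y = card W * (r + card B)"
    unfolding Y_def using fW B by (subst card_Un_disjoint) (auto simp: card_cartesian_product m_def algebra_simps)
  \<comment> \<open>Only the entries of the tuple rows outside W are constrained; the basis rows are
    arbitrary and need not form a dual system. So G is the graph of a polynomial map on the whole
    Y-space.\<close>
  define G :: "(nat \<times> 'a \<Rightarrow> 'k) set" where
    "G = {p. \<forall>j<r. \<forall>b\<in>B - W. p (j, b) = (\<Sum>w\<in>W. p (j, w) * p (r + idx w, b))}"
  define P where "P = {f\<in>polys V. \<forall>p\<in>G. ev p f = 0}"
  have idx_lt: "idx w < m" if "w \<in> W" for w using idx that by (auto simp: bij_betw_def)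
  \<comment> \<open>Substituting the defining equations of G identifies K[V] modulo P with K[Y].
    This gives primality of P and later moves chains of primes to K[Y].\<close>
  have reduce: "\<exists>g\<in>polys Y. \<forall>p\<in>G. ev p f = ev p g" if "f \<in> polys V" for f
    using that
  proof (induction rule: polys_induct)
    case (const c)
    then show ?case using Const_in_polys by blast
  next
    case (add f g)
    then obtain f' g' where "f' \<in> polys Y" "\<forall>p\<in>G. ev p f = ev p f'" "g' \<in> polys Y" "\<forall>p\<in>G. ev p g = ev p g'"
      by blast
    then show ?case by (intro bexI[of _ "f' + g'"] polys_add) auto
  next
    case (Var v f)
    then obtain g where g: "g \<in> polys Y" "\<forall>p\<in>G. ev p f = ev p g" by blast
    show ?case
    proof (cases "v \<in> Y")
      case True
      then show ?thesis using g by (intro bexI[of _ "Var v * g"] polys_mult Var_in_polys) auto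
    next
      case False
      then obtain j b where v: "v = (j, b)" "j < r" "b \<in> B - W"
        using \<open>v \<in> V\<close> unfolding V_def Y_def by (cases v) (auto simp: not_less[symmetric])
      let ?h = "\<Sum>w\<in>W. Var (j, w) * Var (r + idx w, b)"
      have "?h \<in> polys Y"
        using v idx_lt by (intro polys_sum polys_mult Var_in_polys) (auto simp: Y_def)
      moreover have "ev p (Var v) = ev p ?h" if "p \<in> G" for p using that v by (simp add: G_def)
      ultimately show ?thesis using g by (intro bexI[of _ "?h * g"] polys_mult) auto
    qed
  qed
  have free: "zariski_dense Y G"
  proof (rule zariski_dense_transfer[OF zariski_dense_UNIV[OF inf fY]])
    fix p :: "nat \<times> 'a \<Rightarrow> 'k"
    define q where "q = (\<lambda>(j, b). if j < r \<and> b \<in> B - W then (\<Sum>w\<in>W. p (j, w) * p (r + idx w, b)) else p (j, b))"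
    have "q \<in> G" using fW by (auto simp: G_def q_def intro!: sum.cong)
    moreover have "\<forall>v\<in>Y. q v = p v" by (auto simp: q_def Y_def)
    ultimately show "\<exists>q\<in>G. \<forall>v\<in>Y. q v = p v" by blast
  qed
  have "(\<lambda>_. 0) \<in> G" by (simp add: G_def)
  have Pi: "is_ideal (polys V) P"
    using subring_zero[OF polys_subring] by (auto simp: is_ideal_def P_def polys_add polys_mult)
  have "f \<in> P \<or> g \<in> P" if fg: "f \<in> polys V" "g \<in> polys V" "f * g \<in> P" for f g
  proof -
    obtain f' g' where *: "f' \<in> polys Y" "\<forall>p\<in>G. ev p f = ev p f'" "g' \<in> polys Y" "\<forall>p\<in>G. ev p g = ev p g'"
      using reduce fg by meson
    have "\<forall>p\<in>G. ev p (f' * g') = 0" using fg(3) * by (auto simp: P_def)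
    then have "f' * g' = 0" using free polys_mult[OF *(1,3)] unfolding zariski_dense_def by blast
    then have "f' = 0 \<or> g' = 0" using zero_prime[OF inf fY] *(1,3) unfolding is_prime_def by blast
    then show ?thesis using * fg by (auto simp: P_def)
  qed
  moreover have "1 \<notin> P" using \<open>(\<lambda>_. 0) \<in> G\<close> by (auto simp: P_def)
  ultimately have P: "is_prime (polys V) P" using Pi by (simp add: is_prime_def)
  have "zariski_dense U G"
  proof (rule zariski_dense_transfer[OF dense])
    fix x assume "x \<in> tuples_in B (based_subspaces B \<S> W) r"
    then obtain S e where S: "coord_basis B S W e" "\<forall>j<r. (\<lambda>b. x (j, b)) \<in> S"
      by (auto simp: tuples_in_def based_subspaces_def)
    \<comment> \<open>Appending the basis turns a tuple in a based subspace into a point of G; U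
      involves only the first r rows and sees no difference.\<close>
    define q where "q = (\<lambda>(j, b). if j < r then x (j, b) else e (inv_into W idx (j - r)) b)"
    have "inv_into W idx (idx w) = w" if "w \<in> W" for w
      using idx that by (auto simp: bij_betw_def)
    then have "q \<in> G" using S by (auto simp: G_def q_def coord_basis_def)
    moreover have "\<forall>u\<in>U. q u = x u" using U by (auto simp: q_def)
    ultimately show "\<exists>q\<in>G. \<forall>u\<in>U. q u = x u" by blast
  qed
  then have "P \<inter> polys U = {0}"
    using subring_zero[OF polys_subring] by (auto simp: P_def zariski_dense_def)
  then have "\<exists>Q. (\<forall>i\<le>card U. is_prime (polys V) (Q i) \<and> P \<subseteq> Q i) \<and> (\<forall>i<card U. Q i \<subset> Q (Suc i))"
    using prime_chain_iff[OF inf fV Pi, of "card U"] UV by blast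
  then obtain Q where Q: "\<And>i. i \<le> card U \<Longrightarrow> is_prime (polys V) (Q i)" "\<And>i. i \<le> card U \<Longrightarrow> P \<subseteq> Q i"
    "\<And>i. i < card U \<Longrightarrow> Q i \<subset> Q (Suc i)" by blast
  \<comment> \<open>The traces on K[Y] of a chain over P still increase strictly, since each z is
    congruent modulo P to some g in K[Y]. So the length card U of the chain is at most card
    Y.\<close>
  have "\<exists>U'\<subseteq>Y. card U \<le> card U' \<and> (Q 0 \<inter> polys Y) \<inter> polys U' = {0}"
  proof (rule chain_imp_independent[OF inf fY])
    show "is_prime (polys Y) (Q i \<inter> polys Y)" if "i \<le> card U" for i
      by (rule prime_contract[OF polys_subring polys_mono[OF YV] Q(1)[OF that]])
    show "Q i \<inter> polys Y \<subset> Q (Suc i) \<inter> polys Y" if i: "i < card U" for i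
    proof
      show "Q i \<inter> polys Y \<subseteq> Q (Suc i) \<inter> polys Y" using Q(3)[OF i] by blast
      obtain z where z: "z \<in> Q (Suc i)" "z \<notin> Q i" using Q(3)[OF i] by blast
      have Qi: "is_ideal (polys V) (Q i)" "is_ideal (polys V) (Q (Suc i))"
        using Q(1)[of i] Q(1)[of "Suc i"] i by (simp_all add: is_prime_def)
      have zV: "z \<in> polys V" using z ideal_subset[OF polys_subring Qi(2)] by blast
      then obtain g where g: "g \<in> polys Y" "\<forall>p\<in>G. ev p z = ev p g" using reduce by blast
      then have "z - g \<in> P" using polys_diff[OF zV] polys_mono[OF YV] by (auto simp: P_def)
      then have zg: "z - g \<in> Q i" "z - g \<in> Q (Suc i)" using Q(2)[of i] Q(2)[of "Suc i"] i by auto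
      have "g \<in> Q (Suc i)" using ideal_diff[OF polys_subring Qi(2) z(1) zg(2)] by simp
      moreover have "g \<notin> Q i" using ideal_add[OF polys_subring Qi(1) zg(1), of g] z(2) by auto
      ultimately show "Q i \<inter> polys Y \<noteq> Q (Suc i) \<inter> polys Y" using g(1) by blast
    qed
  qed
  then obtain U' where "U' \<subseteq> Y" "card U \<le> card U'" by blast
  then show ?thesis using card_mono[OF fY, of U'] cardY by simp
qed

text \<open>The appended row may be any element of S, and its coefficients with respect to
  \<open>e\<close> prescribe its W-entries arbitrarily. So over each old tuple all card W new
  coordinates are free.\<close>

lemma based_tuples_dense_Suc:
  assumes W: "W \<subseteq> B" and U: "U \<subseteq> {..<r} \<times> B"
    and dense: "zariski_dense U (tuples_in B (based_subspaces B \<S> W) r)"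
  shows "zariski_dense (U \<union> {r} \<times> W) (tuples_in B (based_subspaces B \<S> W) (Suc r))"
proof (rule zariski_dense_extend[OF inf dense])
  have fW: "finite W" using W B finite_subset by blast
  then show "finite ({r} \<times> W)" by simp
  show "({r} \<times> W) \<inter> U = {}" using U by auto
  fix p c assume "p \<in> tuples_in B (based_subspaces B \<S> W) r"
  then obtain S e where S: "p \<in> affine_space ({..<r} \<times> B)" "S \<in> \<S>" "coord_basis B S W e" "\<forall>j<r. (\<lambda>b. p (j, b)) \<in> S"
    by (auto simp: tuples_in_def based_subspaces_def)
  define q where "q = (\<lambda>(j, b). if j = r then (\<Sum>w\<in>W. c (r, w) * e w b) else p (j, b))"
  have row: "(\<lambda>b. \<Sum>w\<in>W. c (r, w) * e w b) \<in> S"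
    using S(3) by (intro coord_subspace_sum[OF \<S>[OF S(2)]]) (auto simp: coord_basis_def)
  then have "(\<lambda>b. \<Sum>w\<in>W. c (r, w) * e w b) \<in> affine_space B"
    using \<S>[OF S(2)] by (auto simp: coord_subspace_def)
  then have "q \<in> affine_space ({..<Suc r} \<times> B)"
    using S(1) by (auto simp: affine_space_def q_def)
  moreover have "\<forall>j<Suc r. (\<lambda>b. q (j, b)) \<in> S" using S(4) row by (auto simp: q_def less_Suc_eq)
  ultimately have "q \<in> tuples_in B (based_subspaces B \<S> W) (Suc r)"
    using S(2,3) by (auto simp: tuples_in_def based_subspaces_def)
  moreover have "\<forall>u\<in>U. q u = p u" using U by (auto simp: q_def)
  moreover have "\<forall>v\<in>{r} \<times> W. q v = c v" using coord_basis_combination[OF S(3) fW] by (auto simp: q_def)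
  ultimately show "\<exists>q\<in>tuples_in B (based_subspaces B \<S> W) (Suc r). (\<forall>u\<in>U. q u = p u) \<and> (\<forall>v\<in>{r} \<times> W. q v = c v)"
    by blast
qed

theorem dimension_tuples_in:
  assumes "\<S> \<noteq> {}"
  shows "\<exists>a b. \<forall>\<^sub>F r in sequentially.
    (\<exists>U\<subseteq>{..<r} \<times> B. zariski_dense U (tuples_in B \<S> r) \<and> card U = a * r + b) \<and>
    (\<forall>U\<subseteq>{..<r} \<times> B. zariski_dense U (tuples_in B \<S> r) \<longrightarrow> card U \<le> a * r + b)"
proof -
  let ?T = "\<lambda>W r. tuples_in B (based_subspaces B \<S> W) r"
  define n where "n = card B"
  define \<W> where "\<W> = {W. W \<subseteq> B \<and> based_subspaces B \<S> W \<noteq> {}}"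
  have f\<W>: "finite \<W>" using B by (simp add: \<W>_def)
  have "\<W> \<noteq> {}"
  proof -
    obtain S where "S \<in> \<S>" using assms by blast
    then obtain W e where "coord_basis B S W e" using ex_coord_basis[OF B \<S>[OF \<open>S \<in> \<S>\<close>]] by blast
    moreover from this have "W \<subseteq> B" by (simp add: coord_basis_def)
    ultimately have "W \<in> \<W>" using \<open>S \<in> \<S>\<close> unfolding \<W>_def based_subspaces_def by blast
    then show ?thesis by blast
  qed
  define a where "a = Max (card ` \<W>)"
  have "a \<in> card ` \<W>" unfolding a_def using f\<W> \<open>\<W> \<noteq> {}\<close> by (intro Max_in) auto
  then obtain W0 where W0: "W0 \<in> \<W>" "card W0 = a" by auto
  have le_a: "card W \<le> a" if "W \<in> \<W>" for W unfolding a_def using f\<W> that by (intro Max_ge) auto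
  have split: "\<exists>W\<in>\<W>. zariski_dense U (?T W r)" if U: "U \<subseteq> {..<r} \<times> B" "zariski_dense U (tuples_in B \<S> r)" for U r
  proof -
    have "finite U" using U(1) B finite_subset by blast
    then obtain W where W: "W \<subseteq> B" "zariski_dense U (?T W r)"
      using zariski_dense_Union[OF inf _ finite_Pow_iff[THEN iffD2, OF B]] U(2)
      unfolding tuples_in_eq_Union by blast
    moreover have "based_subspaces B \<S> W \<noteq> {}"
      using zariski_dense_nonempty[OF W(2)] by (auto simp: tuples_in_def)
    ultimately show ?thesis by (auto simp: \<W>_def)
  qed
  have W0_dense: "zariski_dense ({..<r} \<times> W0) (?T W0 r)" for r
  proof (induction r)
    case 0
    have "(\<lambda>_. 0) \<in> ?T W0 0" using W0(1) by (auto simp: tuples_in_def \<W>_def affine_space_def)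
    then have "zariski_dense {} (?T W0 0)" by (intro zariski_dense_empty) blast
    then show ?case by simp
  next
    case (Suc r)
    have "{..<Suc r} \<times> W0 = {..<r} \<times> W0 \<union> {r} \<times> W0" by auto
    then show ?case using based_tuples_dense_Suc[OF _ _ Suc.IH] W0(1) by (auto simp: \<W>_def)
  qed
  have T_subset: "?T W r \<subseteq> tuples_in B \<S> r" for W r by (auto simp: tuples_in_def based_subspaces_def)
  define D where "D r = {card U |U. U \<subseteq> {..<r} \<times> B \<and> zariski_dense U (tuples_in B \<S> r)}" for r
  define d where "d r = Max (D r)" for r
  have fD: "finite (D r)" for r
  proof -
    have "D r \<subseteq> card ` Pow ({..<r} \<times> B)" by (auto simp: D_def)
    then show ?thesis using B by (meson finite_Pow_iff finite_SigmaI finite_imageI finite_lessThan finite_subset)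
  qed
  have "a * r \<in> D r" for r
  proof -
    have "card ({..<r} \<times> W0) = a * r" using W0 by (simp add: card_cartesian_product)
    moreover have "{..<r} \<times> W0 \<subseteq> {..<r} \<times> B" using W0 by (auto simp: \<W>_def)
    moreover have "zariski_dense ({..<r} \<times> W0) (tuples_in B \<S> r)"
      by (rule zariski_dense_mono[OF W0_dense T_subset])
    ultimately show ?thesis unfolding D_def by (metis (mono_tags, lifting) mem_Collect_eq)
  qed
  then have d_lower: "a * r \<le> d r" and d_in: "d r \<in> D r" for r
    using fD by (auto simp: d_def intro!: Max_ge Max_in)
  have d_upper: "d r \<le> a * (r + n)" for r
  proof -
    obtain U where U: "U \<subseteq> {..<r} \<times> B" "zariski_dense U (tuples_in B \<S> r)" "card U = d r"
      using d_in[of r] by (auto simp: D_def)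
    obtain W where W: "W \<in> \<W>" "zariski_dense U (?T W r)" using split[OF U(1,2)] by blast
    then have "card U \<le> card W * (r + n)"
      using card_le_of_based_tuples_dense[OF _ U(1)] by (auto simp: \<W>_def n_def)
    then show ?thesis using le_a[OF W(1)] U(3) mult_le_mono1 order_trans by metis
  qed
  have d_Suc: "d r + a \<le> d (Suc r)" if r: "r > a * n" for r
  proof -
    obtain U where U: "U \<subseteq> {..<r} \<times> B" "zariski_dense U (tuples_in B \<S> r)" "card U = d r"
      using d_in[of r] by (auto simp: D_def)
    obtain W where W: "W \<in> \<W>" "zariski_dense U (?T W r)" using split[OF U(1,2)] by blast
    have WB: "W \<subseteq> B" using W(1) by (simp add: \<W>_def)
    \<comment> \<open>For card W < a the bound is at most (a - 1) * (r + n), which is below a * r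
      because r > a * n. But card U = d r is at least a * r.\<close>
    have "card W = a"
    proof (rule ccontr)
      assume "card W \<noteq> a"
      then have "Suc (card W) \<le> a" using le_a[OF W(1)] by simp
      then have 1: "Suc (card W) * (r + n) \<le> a * (r + n)" by (rule mult_le_mono1)
      have "card U \<le> card W * (r + n)"
        using card_le_of_based_tuples_dense[OF WB U(1) W(2)] by (simp add: n_def)
      then show False using 1 d_lower[of r] U(3) r by (simp add: algebra_simps)
    qed
    have "zariski_dense (U \<union> {r} \<times> W) (tuples_in B \<S> (Suc r))"
      by (rule zariski_dense_mono[OF based_tuples_dense_Suc[OF WB U(1) W(2)] T_subset])
    moreover have "U \<union> {r} \<times> W \<subseteq> {..<Suc r} \<times> B" using U(1) WB by auto
    ultimately have "card (U \<union> {r} \<times> W) \<in> D (Suc r)" unfolding D_def by blast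
    moreover have "card (U \<union> {r} \<times> W) = d r + a"
    proof -
      have "finite U" "finite W" using U(1) WB B finite_subset by blast+
      moreover have "U \<inter> {r} \<times> W = {}" using U(1) by auto
      ultimately show ?thesis using U(3) \<open>card W = a\<close> by (simp add: card_Un_disjoint card_cartesian_product)
    qed
    ultimately show ?thesis unfolding d_def[of "Suc r"] using fD by (intro Max_ge) auto
  qed
  \<comment> \<open>The subtraction of naturals is exact because a * r \<le> d r; by
    \<open>d_upper\<close> the differences are at most a * n.\<close>
  have "\<exists>b. \<forall>\<^sub>F r in sequentially. d r - a * r = b"
  proof (rule eventually_const_of_bounded_mono)
    show "d r - a * r \<le> d (Suc r) - a * Suc r" if "r \<ge> Suc (a * n)" for r
      using d_Suc[of r] that by simp
    show "d r - a * r \<le> a * n" for r using d_upper[of r] by (simp add: algebra_simps)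
  qed
  then obtain b where "\<forall>\<^sub>F r in sequentially. d r - a * r = b" by blast
  then have "\<forall>\<^sub>F r in sequentially. d r = a * r + b"
  proof eventually_elim
    case (elim r)
    then show ?case using d_lower[of r] by simp
  qed
  then have "\<forall>\<^sub>F r in sequentially.
    (\<exists>U\<subseteq>{..<r} \<times> B. zariski_dense U (tuples_in B \<S> r) \<and> card U = a * r + b) \<and>
    (\<forall>U\<subseteq>{..<r} \<times> B. zariski_dense U (tuples_in B \<S> r) \<longrightarrow> card U \<le> a * r + b)"
  proof eventually_elim
    case (elim r)
    have max: "card U \<le> d r" if "U \<subseteq> {..<r} \<times> B" "zariski_dense U (tuples_in B \<S> r)" for U
      unfolding d_def using fD that by (intro Max_ge) (auto simp: D_def)
    obtain U where U: "U \<subseteq> {..<r} \<times> B" "zariski_dense U (tuples_in B \<S> r)" "card U = d r"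
      using d_in[of r] unfolding D_def by auto
    show ?case unfolding elim[symmetric]
    proof (intro conjI allI impI)
      show "\<exists>U\<subseteq>{..<r} \<times> B. zariski_dense U (tuples_in B \<S> r) \<and> card U = d r"
        by (intro exI[of _ U] conjI U)
      show "card U \<le> d r" if "U \<subseteq> {..<r} \<times> B" "zariski_dense U (tuples_in B \<S> r)" for U
        by (rule max[OF that])
    qed
  qed
  then show ?thesis by blast
qed

end

section \<open>Non-generating tuples\<close>

lemma function_module: "Modules.module (\<lambda>(c::'l::field) (x::'a \<Rightarrow> 'l) b. c * x b)"
  by unfold_locales (auto simp: fun_eq_iff algebra_simps)

lemma subalgebra_base_change_iff:
  fixes h :: "'k::field \<Rightarrow> 'l::field"
  shows "subalgebra (base_change h B A) S \<longleftrightarrow> coord_subspace B S \<and>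
    (\<forall>i\<in>ma_ops A. \<forall>xs. length xs = ma_arity A i \<longrightarrow> set xs \<subseteq> S \<longrightarrow> ma_op (base_change h B A) i xs \<in> S)"
  unfolding subalgebra_def coord_subspace_def
  by (simp add: base_change_def module.subspace_def[OF function_module] plus_fun_def zero_fun_def)

lemma subalgebra_base_change_whole:
  assumes "finite_dim_multialgebra A B" "h 0 = 0"
  shows "subalgebra (base_change h B A) (affine_space B)"
proof -
  interpret finite_dimensional_vector_space "ma_scale A" B
    using assms(1) by (simp add: finite_dim_multialgebra_def)
  have "representation B v b = 0" if "b \<notin> B" for v b
    using representation_ne_zero that by blast
  then show ?thesis using assms(2)
    unfolding subalgebra_base_change_iff coord_subspace_def by (auto simp: affine_space_def base_change_def)
qed

text \<open>The hull is itself a subalgebra: the whole space is one, and all conditions pass to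
  intersections. So if T does not generate, the hull is a proper subalgebra around it.\<close>

lemma generates_iff:
  assumes A: "finite_dim_multialgebra A B" "h 0 = 0" and T: "T \<subseteq> affine_space B"
  shows "generates (base_change h B A) T \<longleftrightarrow>
    \<not> (\<exists>S. subalgebra (base_change h B A) S \<and> S \<noteq> affine_space B \<and> T \<subseteq> S)"
proof -
  let ?A = "base_change h B A"
  have space: "ma_space ?A = affine_space B" by (simp add: base_change_def)
  have whole: "subalgebra ?A (affine_space B)" by (rule subalgebra_base_change_whole[where h = h, OF A])
  have sub: "S \<subseteq> affine_space B" if "subalgebra ?A S" for S using that by (simp add: subalgebra_def space)
  define H where "H = subalgebra ?A hull T"
  have H: "H = \<Inter>{S. subalgebra ?A S \<and> T \<subseteq> S}" by (simp add: H_def hull_def)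
  have "subalgebra ?A H"
    unfolding subalgebra_base_change_iff
  proof (intro conjI ballI allI impI)
    have mem: "\<And>S. subalgebra ?A S \<Longrightarrow> coord_subspace B S" by (simp add: subalgebra_base_change_iff)
    show "coord_subspace B H"
      unfolding coord_subspace_def
    proof (intro conjI ballI allI)
      show "H \<subseteq> affine_space B" unfolding H using whole T by blast
      show "(\<lambda>_. 0) \<in> H" unfolding H using mem by (auto simp: coord_subspace_def)
      show "(\<lambda>b. x b + y b) \<in> H" if "x \<in> H" "y \<in> H" for x y
        using that coord_subspace_add[OF mem] unfolding H by auto
      show "(\<lambda>b. c * x b) \<in> H" if "x \<in> H" for c x
        using that coord_subspace_scale[OF mem] unfolding H by auto
    qed
    fix i xs assume i: "i \<in> ma_ops A" "length xs = ma_arity A i" "set xs \<subseteq> H"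
    show "ma_op ?A i xs \<in> H"
      unfolding H
    proof
      fix S assume S: "S \<in> {S. subalgebra ?A S \<and> T \<subseteq> S}"
      then have "set xs \<subseteq> S" using i(3) unfolding H by blast
      then show "ma_op ?A i xs \<in> S" using S i(1,2) by (simp add: subalgebra_base_change_iff)
    qed
  qed
  moreover have "T \<subseteq> H" "\<And>S. subalgebra ?A S \<Longrightarrow> T \<subseteq> S \<Longrightarrow> H \<subseteq> S" unfolding H by blast+
  ultimately show ?thesis
    using sub unfolding generates_def space H_def[symmetric] by blast
qed

theorem corollary1p4:
  fixes A :: "('k::field, 'a::ab_group_add, 'i) multialgebra" and B :: "'a set"
  assumes "infinite (UNIV :: 'k set)"
    and "finite_dim_multialgebra A B"
    and "finite (maximal_subalgebra_orbits B (geometric_algebra B A))"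
  shows "\<exists>a b :: nat. \<forall>\<^sub>F r in sequentially.
           \<forall>I. nongenerator_ideal B A r I \<longrightarrow> krull_dim (tuple_ring B r Quot I) = enat (a * r + b)"
proof -
  have B: "finite B"
    using assms(2) by (simp add: finite_dim_multialgebra_def finite_dimensional_vector_space_def
        finite_dimensional_vector_space_axioms_def)
  have inf: "infinite (UNIV :: 'k alg_closure set)"
    using assms(1) finite_imageD[OF finite_subset[of "range (to_ac :: 'k \<Rightarrow> _)" UNIV] inj_to_ac] by auto
  define \<S> where "\<S> = {S. subalgebra (geometric_algebra B A) S \<and> S \<noteq> affine_space B}"
  have \<S>: "coord_subspace B S" if "S \<in> \<S>" for S
    using that by (simp add: \<S>_def subalgebra_base_change_iff)
  have zeros: "{x \<in> affine_space ({..<r} \<times> B). \<forall>f\<in>I. mpoly_eval to_ac x f = 0} = tuples_in B \<S> r"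
    if "nongenerator_ideal B A r I" for r I
  proof -
    have "\<not> generates (geometric_algebra B A) ((\<lambda>j b. x (j, b)) ` {..<r}) \<longleftrightarrow> (\<exists>S\<in>\<S>. \<forall>j<r. (\<lambda>b. x (j, b)) \<in> S)"
      if "x \<in> affine_space ({..<r} \<times> B)" for x :: "nat \<times> 'a \<Rightarrow> 'k alg_closure"
    proof -
      have "(\<lambda>j b. x (j, b)) ` {..<r} \<subseteq> affine_space B" using that by (auto simp: affine_space_def)
      moreover have "(\<lambda>j b. x (j, b)) ` {..<r} \<subseteq> S \<longleftrightarrow> (\<forall>j<r. (\<lambda>b. x (j, b)) \<in> S)" for S by auto
      ultimately show ?thesis using generates_iff[where h = to_ac, OF assms(2) to_ac_0] by (auto simp: \<S>_def)
    qed
    then show ?thesis using that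
      by (auto simp: nongenerator_ideal_def cuts_out_nongenerators_def tuples_in_def)
  qed
  \<comment> \<open>The right-hand side depends on I only through its zero set, which is the same
    for all admissible I. So one threshold for r serves them all.\<close>
  have dim: "krull_dim (tuple_ring B r Quot I) =
      Sup {enat n |n. \<exists>U\<subseteq>{..<r} \<times> B. n \<le> card U \<and> zariski_dense U (tuples_in B \<S> r)}"
    if I: "nongenerator_ideal B A r I" for r I
  proof -
    have fin: "finite ({..<r} \<times> B)" using B by simp
    have id: "ideal I (tuple_ring B r)" using I by (simp add: nongenerator_ideal_def)
    have "I \<inter> polys U = {0} \<longleftrightarrow> zariski_dense U (tuples_in B \<S> r)" if "U \<subseteq> {..<r} \<times> B" for U
      using independent_iff_zariski_dense[OF assms(1) fin ideal_imp_is_ideal[OF id] that] zeros[OF I] by simp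
    then show ?thesis
      unfolding krull_dim_mpoly_quotient[OF assms(1) fin id] by (metis (no_types, lifting))
  qed
  show ?thesis
  proof (cases "\<S> = {}")
    \<comment> \<open>There is no proper subalgebra, as for the zero algebra or one generated by its
      operations of arity 0. Then every tuple generates and Z_r is empty; the supremum over the
      empty set is 0, which fits a = b = 0.\<close>
    case True
    then have "\<not> zariski_dense U (tuples_in B \<S> r)" for U r
      using zariski_dense_nonempty[of U "tuples_in B \<S> r"] by (auto simp: tuples_in_def)
    then have "krull_dim (tuple_ring B r Quot I) = enat (0 * r + 0)" if "nongenerator_ideal B A r I" for r I
      using dim[OF that] by (simp add: bot_enat_def zero_enat_def)
    then show ?thesis by (intro exI[of _ 0]) simp
  next
    case False
    obtain a b where ab: "\<forall>\<^sub>F r in sequentially.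
      (\<exists>U\<subseteq>{..<r} \<times> B. zariski_dense U (tuples_in B \<S> r) \<and> card U = a * r + b) \<and>
      (\<forall>U\<subseteq>{..<r} \<times> B. zariski_dense U (tuples_in B \<S> r) \<longrightarrow> card U \<le> a * r + b)"
      using dimension_tuples_in[OF inf B \<S> False] by blast
    have "\<forall>\<^sub>F r in sequentially. \<forall>I. nongenerator_ideal B A r I \<longrightarrow> krull_dim (tuple_ring B r Quot I) = enat (a * r + b)"
      using ab
    proof eventually_elim
      case (elim r)
      have "Sup {enat n |n. \<exists>U\<subseteq>{..<r} \<times> B. n \<le> card U \<and> zariski_dense U (tuples_in B \<S> r)} = enat (a * r + b)"
      proof (rule antisym)
        show "Sup {enat n |n. \<exists>U\<subseteq>{..<r} \<times> B. n \<le> card U \<and> zariski_dense U (tuples_in B \<S> r)} \<le> enat (a * r + b)"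
        proof (rule Sup_least)
          fix x assume "x \<in> {enat n |n. \<exists>U\<subseteq>{..<r} \<times> B. n \<le> card U \<and> zariski_dense U (tuples_in B \<S> r)}"
          then obtain n U where n: "x = enat n" "U \<subseteq> {..<r} \<times> B" "n \<le> card U" "zariski_dense U (tuples_in B \<S> r)"
            by blast
          then have "card U \<le> a * r + b" using elim by blast
          then show "x \<le> enat (a * r + b)" using n by simp
        qed
        show "enat (a * r + b) \<le> Sup {enat n |n. \<exists>U\<subseteq>{..<r} \<times> B. n \<le> card U \<and> zariski_dense U (tuples_in B \<S> r)}"
        proof (rule Sup_upper)
          obtain U where "U \<subseteq> {..<r} \<times> B" "a * r + b \<le> card U" "zariski_dense U (tuples_in B \<S> r)"
            using elim order_refl by metis
          then show "enat (a * r + b) \<in> {enat n |n. \<exists>U\<subseteq>{..<r} \<times> B. n \<le> card U \<and> zariski_dense U (tuples_in B \<S> r)}"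
            by blast
        qed
      qed
      then show ?case using dim by simp
    qed
    then show ?thesis by blast
  qed
qed

end
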